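(* Let $N\ge 2$ and $k\ge 0$, and let $(\rho,v,\Phi)$ be a stationary weak solution on $\mathbb{R}^N$ (in the sense defined in the context) of the Navier–Stokes–Poisson/Euler–Poisson system with constants $k,\mu,\lambda$ and pressure law $p=p(\rho)$. Suppose that one of the following conditions holds. (i) Inviscid case (Euler–Poisson) $\mu=\lambda=0$, and: (i-a) if $N\ge 3$: there exists $w\in L^1_{loc}([0,\infty))$, positive and non-increasing on $[0,\infty)$, such that $$\int_{\mathbb{R}^N}\left(\rho|v|^2+p+k|\nabla\Phi|^2\right)\left[w(|x|)+\frac{1}{|x|}\int_0^{|x|}w(s)\,ds+\frac{1}{|x|^2}\int_0^{|x|}\int_0^r w(s)\,ds\,dr\right]dx<\infty;$$ (i-b) if $N=2$: $$\int_{\mathbb{R}^2}\left(\rho|v|^2+p+k|\nabla\Phi|^2\right)dx<\infty.$$ (ii) Viscous case (Navier–Stokes–Poisson) $\mu>0$, $N\ge 2$, and: (a) if $2\mu+\lambda=0$: $$\int_{\mathbb{R}^N}\left(\rho|v|^2+p+k|\nabla\Phi|^2\right)dx<\infty;$$ (b) if $2\mu+\lambda\ne 0$: $$\int_{\mathbb{R}^N}\left(\rho|v|^2+|v|^{\frac{N}{N-1}}+p+k|\nabla\Phi|^2\right)dx<\infty.$$ Then $\rho(x)=0$ and $\nabla\Phi(x)=0$ for almost every $x\in\mathbb{R}^N$.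
   Context: The constants $k,\mu,\lambda$ are real, with $k\ge 0$. The pressure is a given function $p=p(\rho)\ge 0$ of the density, with $p=0$ only if $\rho=0$; the density satisfies $\rho\ge 0$ almost everywhere. The time-dependent system is $\partial_t\rho+\mathrm{div}(\rho v)=0$, $\partial_t(\rho v)+\mathrm{div}(\rho v\otimes v)=-\nabla p+k\rho\nabla\Phi+\mu\Delta v+(\mu+\lambda)\nabla\,\mathrm{div}\,v$, $\Delta\Phi=\rho$. It is called Navier–Stokes–Poisson when $\mu>0$ and Euler–Poisson when $\mu=\lambda=0$. A triple $(\rho,v,\Phi)\in L^\infty_{loc}(\mathbb{R}^N)\times[L^2_{loc}(\mathbb{R}^N)]^N\times W^{2,2}_{loc}(\mathbb{R}^N)$ is a stationary weak solution if (1) $\int_{\mathbb{R}^N}\rho v\cdot\nabla\psi\,dx=0$ for all $\psi\in C_0^\infty(\mathbb{R}^N)$; (2) for all $\phi\in[C_0^\infty(\mathbb{R}^N)]^N$, $$\int_{\mathbb{R}^N}\rho v\otimes v:\nabla\phi\,dx=-\int_{\mathbb{R}^N}p\,\mathrm{div}\,\phi\,dx-k\int_{\mathbb{R}^N}\rho\nabla\Phi\cdot\phi\,dx-\mu\int_{\mathbb{R}^N}v\cdot\Delta\phi\,dx-(\mu+\lambda)\int_{\mathbb{R}^N}v\cdot\nabla\mathrm{div}\,\phi\,dx;$$ (3) $\Delta\Phi=\rho$ almost everywhere in $\mathbb{R}^N$; (4) $p=p(\rho)\ge 0$, and $p=0$ only if $\rho=0$, almost everywhere on $\mathbb{R}^N$.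 Here $C_0^\infty$ denotes smooth compactly supported functions.
   Formalization: The conclusion ∇Φ = 0 a.e. is claimed only for k > 0, since it fails for k = 0 (take ρ = 0, v = 0, Φ(x) = x₁, p(s) = s); ρ = 0 a.e. is still claimed for every k ≥ 0. *)

theory Defs
  imports "HOL-Analysis.Analysis"
begin

section \<open>Classical differential operators and test functions\<close>

definition partial :: "'n \<Rightarrow> (real^'n \<Rightarrow> 'b) \<Rightarrow> real^'n \<Rightarrow> 'b::real_normed_vector" where
  "partial i f x = frechet_derivative f (at x) (axis i 1)"

text \<open>A map is of class \<open>C^(k+1)\<close> iff it is differentiable everywhere and all its first
  partial derivatives are of class \<open>C^k\<close>.\<close>

primrec C_k :: "nat \<Rightarrow> (real^'n \<Rightarrow> 'b::real_normed_vector) \<Rightarrow> bool" where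
  "C_k 0 f \<longleftrightarrow> continuous_on UNIV f"
| "C_k (Suc m) f \<longleftrightarrow> (\<forall>x. f differentiable (at x)) \<and> (\<forall>i. C_k m (partial i f))"

definition test_fun :: "(real^'n \<Rightarrow> 'b::real_normed_vector) \<Rightarrow> bool" where
  "test_fun f \<longleftrightarrow> (\<forall>m. C_k m f) \<and> compact (closure {x. f x \<noteq> 0})"

definition grad :: "(real^'n \<Rightarrow> real) \<Rightarrow> real^'n \<Rightarrow> real^'n" where
  "grad f x = (\<chi> i. partial i f x)"

definition divergence :: "(real^'n \<Rightarrow> real^'n) \<Rightarrow> real^'n \<Rightarrow> real" where
  "divergence f x = (\<Sum>i\<in>UNIV. partial i f x $ i)"

definition laplacian :: "(real^'n \<Rightarrow> 'b) \<Rightarrow> real^'n \<Rightarrow> 'b::real_normed_vector" where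
  "laplacian f x = (\<Sum>i\<in>UNIV. partial i (partial i f) x)"

text \<open>The contraction \<open>(a \<otimes> a) : \<nabla>f(x)\<close>.\<close>

definition tensor_contract :: "real^'n \<Rightarrow> (real^'n \<Rightarrow> real^'n) \<Rightarrow> real^'n \<Rightarrow> real" where
  "tensor_contract a f x = (\<Sum>i\<in>UNIV. \<Sum>j\<in>UNIV. a $ i * a $ j * partial i f x $ j)"

section \<open>Local Lebesgue and Sobolev spaces\<close>

definition L1_loc_on :: "'a::euclidean_space set \<Rightarrow> ('a \<Rightarrow> real) \<Rightarrow> bool" where
  "L1_loc_on S f \<longleftrightarrow> (\<forall>K. compact K \<and> K \<subseteq> S \<longrightarrow> set_integrable lebesgue K f)"

definition L2_loc :: "('a::euclidean_space \<Rightarrow> 'b::euclidean_space) \<Rightarrow> bool" where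
  "L2_loc f \<longleftrightarrow> f \<in> borel_measurable lebesgue \<and>
     (\<forall>K. compact K \<longrightarrow> set_integrable lebesgue K (\<lambda>x. (norm (f x))\<^sup>2))"

definition Linf_loc :: "('a::euclidean_space \<Rightarrow> real) \<Rightarrow> bool" where
  "Linf_loc f \<longleftrightarrow> f \<in> borel_measurable lebesgue \<and>
     (\<forall>K. compact K \<longrightarrow> (\<exists>C. AE x in lebesgue. x \<in> K \<longrightarrow> \<bar>f x\<bar> \<le> C))"

definition has_weak_partial :: "'n \<Rightarrow> (real^'n \<Rightarrow> real) \<Rightarrow> (real^'n \<Rightarrow> real) \<Rightarrow> bool" where
  "has_weak_partial i f g \<longleftrightarrow> L1_loc_on UNIV f \<and> L1_loc_on UNIV g \<and>
     (\<forall>\<psi>. test_fun \<psi> \<longrightarrow>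
        (LINT x|lebesgue. f x * partial i \<psi> x) = - (LINT x|lebesgue. g x * \<psi> x))"

definition weakly_differentiable :: "'n \<Rightarrow> (real^'n \<Rightarrow> real) \<Rightarrow> bool" where
  "weakly_differentiable i f \<longleftrightarrow> (\<exists>g. has_weak_partial i f g)"

text \<open>A fixed representative; weak derivatives are unique only up to null sets.\<close>

definition weak_partial :: "'n \<Rightarrow> (real^'n \<Rightarrow> real) \<Rightarrow> real^'n \<Rightarrow> real" where
  "weak_partial i f = (SOME g. has_weak_partial i f g)"

primrec W2_loc :: "nat \<Rightarrow> (real^'n \<Rightarrow> real) \<Rightarrow> bool" where
  "W2_loc 0 f \<longleftrightarrow> L2_loc f"
| "W2_loc (Suc m) f \<longleftrightarrow>
     L2_loc f \<and> (\<forall>i. weakly_differentiable i f \<and> W2_loc m (weak_partial i f))"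

definition weak_grad :: "(real^'n \<Rightarrow> real) \<Rightarrow> real^'n \<Rightarrow> real^'n" where
  "weak_grad f x = (\<chi> i. weak_partial i f x)"

definition weak_laplacian :: "(real^'n \<Rightarrow> real) \<Rightarrow> real^'n \<Rightarrow> real" where
  "weak_laplacian f x = (\<Sum>i\<in>UNIV. weak_partial i (weak_partial i f) x)"

section \<open>Stationary weak solutions\<close>

text \<open>The pressure is the composition of the pressure law \<open>p\<close> with the density.  Its local
  integrability is what gives a meaning to the integral of \<open>p div \<phi>\<close>; all the other integrands
  below are integrable by the regularity of \<open>\<rho>\<close>, \<open>v\<close> and \<open>\<Phi>\<close>.\<close>

definition stationary_weak_solution ::
  "real \<Rightarrow> real \<Rightarrow> real \<Rightarrow> (real \<Rightarrow> real) \<Rightarrow>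
   (real^'n \<Rightarrow> real) \<Rightarrow> (real^'n \<Rightarrow> real^'n) \<Rightarrow> (real^'n \<Rightarrow> real) \<Rightarrow> bool" where
  "stationary_weak_solution k \<mu> lam p \<rho> v \<Phi> \<longleftrightarrow>
     Linf_loc \<rho> \<and> L2_loc v \<and> W2_loc 2 \<Phi> \<and>
     (AE x in lebesgue. \<rho> x \<ge> 0) \<and>
     L1_loc_on UNIV (\<lambda>x. p (\<rho> x)) \<and>
     (\<forall>\<psi>::real^'n \<Rightarrow> real. test_fun \<psi> \<longrightarrow>
        (LINT x|lebesgue. \<rho> x * (v x \<bullet> grad \<psi> x)) = 0) \<and>
     (\<forall>\<phi>::real^'n \<Rightarrow> real^'n. test_fun \<phi> \<longrightarrow>
        (LINT x|lebesgue. \<rho> x * tensor_contract (v x) \<phi> x) =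
          - (LINT x|lebesgue. p (\<rho> x) * divergence \<phi> x)
          - k * (LINT x|lebesgue. \<rho> x * (weak_grad \<Phi> x \<bullet> \<phi> x))
          - \<mu> * (LINT x|lebesgue. v x \<bullet> laplacian \<phi> x)
          - (\<mu> + lam) * (LINT x|lebesgue. v x \<bullet> grad (divergence \<phi>) x)) \<and>
     (AE x in lebesgue. weak_laplacian \<Phi> x = \<rho> x) \<and>
     (AE x in lebesgue. p (\<rho> x) \<ge> 0 \<and> (p (\<rho> x) = 0 \<longrightarrow> \<rho> x = 0))"

definition energy ::
  "real \<Rightarrow> (real \<Rightarrow> real) \<Rightarrow> (real^'n \<Rightarrow> real) \<Rightarrow> (real^'n \<Rightarrow> real^'n) \<Rightarrow>
   (real^'n \<Rightarrow> real) \<Rightarrow> real^'n \<Rightarrow> real" where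
  "energy k p \<rho> v \<Phi> x =
     \<rho> x * (norm (v x))\<^sup>2 + p (\<rho> x) + k * (norm (weak_grad \<Phi> x))\<^sup>2"

definition radial_weight :: "(real \<Rightarrow> real) \<Rightarrow> real \<Rightarrow> real" where
  "radial_weight w R = w R + 1 / R * (LINT s:{0..R}|lebesgue. w s)
     + 1 / R\<^sup>2 * (LINT r:{0..R}|lebesgue. LINT s:{0..r}|lebesgue. w s)"

end

theory Submission
  imports Defs
begin

text \<open>
  Write \<open>u = \<nabla>\<Phi>\<close>.  Since \<open>\<Delta>\<Phi> = \<rho>\<close>, the gravitational force is itself a divergence,
  \<open>\<rho> u = div (u \<otimes> u - |u|\<^sup>2/2 I)\<close> in the weak sense (lemma \<open>poisson_stress\<close>).  Testing the
  momentum equation with \<open>\<phi> = \<nabla>\<psi>\<close> therefore gives, for every scalar test function \<open>\<psi>\<close>,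
  \<open>\<integral> T : \<nabla>\<^sup>2\<psi> = - (2\<mu> + \<lambda>) \<integral> v \<bullet> \<nabla>\<Delta>\<psi>\<close> with the total stress
  \<open>T = \<rho> v \<otimes> v + p I + k (|u|\<^sup>2/2 I - u \<otimes> u)\<close> (lemma \<open>stress_identity\<close>), and pointwise
  \<open>|T : H|\<close> is at most a constant times the energy density times \<open>max |H\<^sub>i\<^sub>j|\<close>.  It remains to choose
  \<open>\<psi>\<close> such that \<open>\<nabla>\<^sup>2\<psi>\<close> converges, dominated by a weight against which the energy is integrable, to a
  matrix field \<open>H\<close> with \<open>T : H\<close> of one sign; then \<open>T : H = 0\<close> almost everywhere
  (lemma \<open>stress_limit\<close>).

  For finite energy take \<open>\<psi>\<^sub>n(x) = n\<^sup>2 b(x/n)\<close> with a fixed bump function \<open>b\<close>.  The Hessians are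
  bounded and converge to \<open>\<nabla>\<^sup>2b(0)\<close>, a multiple of the identity, and
  \<open>tr T = \<rho>|v|\<^sup>2 + N p + k (N/2 - 1)|u|\<^sup>2\<close>.  The viscous term, if \<open>2\<mu> + \<lambda> \<noteq> 0\<close>, is a multiple of
  \<open>\<integral> v \<bullet> (1/n) (\<nabla>\<Delta>b)(x/n)\<close>, which tends to zero because \<open>v \<in> L\<^sup>q\<close> with \<open>q = N/(N-1)\<close>, while the other factor
  tends to zero uniformly with an \<open>L\<^sup>N\<close> norm that does not depend on \<open>n\<close> (lemma \<open>viscous_pairing_tendsto\<close>).  So \<open>p = 0\<close> and hence \<open>\<rho> = 0\<close>.  When \<open>N = 2\<close> the trace carries no
  information on \<open>u\<close>; but in every dimension \<open>\<Phi>\<close> is now weakly harmonic, with \<open>\<nabla>\<Phi> \<in> L\<^sup>2\<close> if \<open>k > 0\<close>, and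
  a Liouville theorem based on Caccioppoli's inequality gives \<open>u = 0\<close> (lemma \<open>weak_harmonic_gradient_eq_0\<close>).

  In the weighted case the weight only matters through the bound
  \<open>radial_weight w r \<ge> w(1)/(1 + r)\<close>, so that one smooth convex function serves for all \<open>w\<close>: take
  \<open>\<psi>\<^sub>n(x) = \<surd>(1 + |x|\<^sup>2) b(x/n)\<close>.  The Hessians are bounded by a multiple of \<open>1/(1 + |x|)\<close>, and the
  contraction of \<open>T\<close> with the Hessian of \<open>\<surd>(1 + |x|\<^sup>2)\<close> controls both \<open>p\<close> and \<open>k|u|\<^sup>2\<close> when \<open>N \<ge> 3\<close>
  (lemma \<open>stress_hessian_bracket_ge\<close>).

  Since \<open>u\<close> and its first weak derivatives are only locally square integrable, the products of weak derivatives in these arguments need a product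
  rule for \<open>L\<^sup>2\<close> fields whose divergence is in \<open>L\<^sup>2\<close> (lemma \<open>weak_divergence_product\<close>).
\<close>

section \<open>Smooth functions\<close>

text \<open>Functions that are \<open>C\<^sup>k\<close> for every \<open>k\<close>.\<close>

definition smooth :: "(real^'n \<Rightarrow> 'b::real_normed_vector) \<Rightarrow> bool" where
  "smooth f \<longleftrightarrow> (\<forall>m. C_k m f)"

lemma partial_eq: "(f has_derivative f') (at x) \<Longrightarrow> partial i f x = f' (axis i 1)"
  unfolding partial_def by (simp add: frechet_derivative_at[symmetric])

lemma smooth_differentiable: "smooth f \<Longrightarrow> f differentiable (at x)"
  unfolding smooth_def by (metis C_k.simps(2))

lemma smooth_partial: "smooth f \<Longrightarrow> smooth (partial i f)"
  unfolding smooth_def by (metis C_k.simps(2))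

lemma smooth_continuous: "smooth f \<Longrightarrow> continuous_on UNIV f"
  unfolding smooth_def by (metis C_k.simps(1))

lemma has_derivative_partial:
  assumes "f differentiable (at x)"
  shows "(f has_derivative (\<lambda>h. \<Sum>i\<in>UNIV. h $ i *\<^sub>R partial i f x)) (at x)"
proof -
  obtain f' where f': "(f has_derivative f') (at x)" using assms unfolding differentiable_def by blast
  interpret f': bounded_linear f' by (rule has_derivative_bounded_linear[OF f'])
  have "f' h = (\<Sum>i\<in>UNIV. h $ i *\<^sub>R partial i f x)" for h
  proof -
    have "f' h = f' (\<Sum>i\<in>UNIV. h $ i *\<^sub>R axis i 1)"
      by (metis (mono_tags, lifting) basis_expansion scalar_mult_eq_scaleR sum.cong)
    also have "\<dots> = (\<Sum>i\<in>UNIV. h $ i *\<^sub>R f' (axis i 1))"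
      by (simp add: f'.sum f'.scaleR)
    finally show ?thesis using partial_eq[OF f'] by simp
  qed
  then have "f' = (\<lambda>h. \<Sum>i\<in>UNIV. h $ i *\<^sub>R partial i f x)" by blast
  then show ?thesis using f' by simp
qed

text \<open>A class of differentiable functions closed under partial derivatives consists of smooth
  functions.\<close>

lemma smooth_coinduct:
  assumes "P f" and step: "\<And>f. P f \<Longrightarrow> (\<forall>x. f differentiable (at x)) \<and> (\<forall>i. P (partial i f))"
  shows "smooth f"
proof -
  have "C_k m f" if "P f" for m f
    using that
  proof (induction m arbitrary: f)
    case 0
    then show ?case using step by (auto intro!: continuous_at_imp_continuous_on differentiable_imp_continuous_within)
  next
    case (Suc m)
    then show ?case using step by simp
  qed
  then show ?thesis using assms(1) unfolding smooth_def by blast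
qed

lemma partial_add: "f differentiable (at x) \<Longrightarrow> g differentiable (at x) \<Longrightarrow>
    partial i (\<lambda>x. f x + g x) x = partial i f x + partial i g x"
  by (rule trans[OF partial_eq[OF has_derivative_add[OF has_derivative_partial has_derivative_partial]]])
     (auto simp: axis_def if_distrib[of "\<lambda>c. c *\<^sub>R _"] cong: if_cong)

lemma partial_const [simp]: "partial i (\<lambda>x. c) = (\<lambda>x. 0)"
  by (rule ext, rule partial_eq[OF has_derivative_const])

lemma partial_bounded_linear:
  assumes "bounded_linear L" "f differentiable (at x)"
  shows "partial i (\<lambda>x. L (f x)) x = L (partial i f x)"
proof -
  obtain f' where f': "(f has_derivative f') (at x)" using assms unfolding differentiable_def by blast
  show ?thesis using partial_eq[OF f'] partial_eq[OF bounded_linear.has_derivative[OF assms(1) f']] by simp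
qed

lemma partial_scaleR:
  fixes f :: "real^'n \<Rightarrow> real"
  assumes "f differentiable (at x)" "g differentiable (at x)"
  shows "partial i (\<lambda>x. f x *\<^sub>R g x) x = f x *\<^sub>R partial i g x + partial i f x *\<^sub>R g x"
proof -
  obtain f' g' where f': "(f has_derivative f') (at x)" and g': "(g has_derivative g') (at x)"
    using assms unfolding differentiable_def by blast
  show ?thesis using partial_eq[OF f'] partial_eq[OF g'] partial_eq[OF has_derivative_scaleR[OF f' g']] by simp
qed

lemma partial_mult:
  fixes f :: "real^'n \<Rightarrow> real"
  assumes "f differentiable (at x)" "g differentiable (at x)"
  shows "partial i (\<lambda>x. f x * g x) x = f x * partial i g x + partial i f x * g x"
  using partial_scaleR[OF assms] by simp

lemma partial_affine:
  assumes "f differentiable (at (c *\<^sub>R x + a))"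
  shows "partial i (\<lambda>x. f (c *\<^sub>R x + a)) x = c *\<^sub>R partial i f (c *\<^sub>R x + a)"
proof -
  obtain f' where f': "(f has_derivative f') (at (c *\<^sub>R x + a))" using assms unfolding differentiable_def by blast
  interpret f': bounded_linear f' by (rule has_derivative_bounded_linear[OF f'])
  have "((\<lambda>x. c *\<^sub>R x + a) has_derivative (\<lambda>h. c *\<^sub>R h)) (at x)"
    by (auto intro!: derivative_eq_intros)
  from has_derivative_compose[OF this f'] partial_eq[OF f']
  show ?thesis using partial_eq by (fastforce simp: f'.scaleR)
qed

lemma partial_real_comp:
  fixes f :: "real^'n \<Rightarrow> real"
  assumes "f differentiable (at x)" "(g has_real_derivative d) (at (f x))"
  shows "partial i (\<lambda>x. g (f x)) x = d * partial i f x"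
proof -
  obtain f' where f': "(f has_derivative f') (at x)" using assms unfolding differentiable_def by blast
  have "(g has_derivative (\<lambda>h. h * d)) (at (f x))" using assms(2) by (simp add: has_field_derivative_def mult_commute_abs)
  from has_derivative_compose[OF f' this] partial_eq[OF f']
  show ?thesis using partial_eq by (fastforce)
qed

lemma smooth_const: "smooth (\<lambda>x. c)"
  by (rule smooth_coinduct[where P="\<lambda>f. \<exists>c. f = (\<lambda>x. c)"]) auto

lemma partial_bounded_linear_fun:
  assumes "bounded_linear (f::real^'n \<Rightarrow> 'b::real_normed_vector)" shows "partial i f = (\<lambda>x. f (axis i 1))"
  by (rule ext, rule partial_eq) (use bounded_linear_imp_has_derivative[OF assms] in simp)

lemma smooth_bounded_linear_fun:
  assumes "bounded_linear (f::real^'n \<Rightarrow> 'b::real_normed_vector)" shows "smooth f"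
  by (rule smooth_coinduct[where P="\<lambda>f. (\<exists>c. f = (\<lambda>x. c)) \<or> bounded_linear f"])
    (auto simp: partial_bounded_linear_fun bounded_linear_imp_differentiable assms)

lemma smooth_component: "smooth (\<lambda>x::real^'n. x $ i)"
  by (rule smooth_bounded_linear_fun) (rule bounded_linear_vec_nth)

lemma partial_component [simp]: "partial i (\<lambda>x::real^'n. x $ j) = (\<lambda>x. if i = j then 1 else 0)"
  by (subst partial_bounded_linear_fun) (auto simp: bounded_linear_vec_nth axis_def)

lemma smooth_linear_image:
  assumes L: "bounded_linear L" and f: "smooth f"
  shows "smooth (\<lambda>x. L (f x))"
proof (rule smooth_coinduct[where P="\<lambda>g. \<exists>f. smooth f \<and> g = (\<lambda>x. L (f x))"])
  fix g assume "\<exists>f. smooth f \<and> g = (\<lambda>x. L (f x))"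
  then obtain f where f: "smooth f" and g: "g = (\<lambda>x. L (f x))" by blast
  have "partial i g = (\<lambda>x. L (partial i f x))" for i
    unfolding g using partial_bounded_linear[OF L smooth_differentiable[OF f]] by blast
  moreover have "g differentiable (at x)" for x
    using smooth_differentiable[OF f, of x] bounded_linear.has_derivative[OF L]
    unfolding g differentiable_def by blast
  ultimately show "(\<forall>x. g differentiable (at x)) \<and> (\<forall>i. \<exists>f. smooth f \<and> partial i g = (\<lambda>x. L (f x)))"
    using smooth_partial[OF f] by blast
qed (use f in blast)

lemma C_k_add: "C_k m f \<Longrightarrow> C_k m g \<Longrightarrow> C_k m (\<lambda>x. f x + g x)"
proof (induction m arbitrary: f g)
  case 0 then show ?case by (simp add: continuous_on_add)
next
  case (Suc m)
  then have "partial i (\<lambda>x. f x + g x) = (\<lambda>x. partial i f x + partial i g x)" for i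
    by (auto simp: partial_add)
  then show ?case using Suc by (auto intro: differentiable_add)
qed

lemma smooth_add: "smooth f \<Longrightarrow> smooth g \<Longrightarrow> smooth (\<lambda>x. f x + g x)"
  unfolding smooth_def by (blast intro: C_k_add)

lemma smooth_sum: "(\<And>i. i \<in> I \<Longrightarrow> smooth (f i)) \<Longrightarrow> smooth (\<lambda>x. \<Sum>i\<in>I. f i x)"
  by (induction I rule: infinite_finite_induct) (auto simp: smooth_const intro: smooth_add)

lemma C_k_Suc_imp: "C_k (Suc m) f \<Longrightarrow> C_k m f"
proof (induction m arbitrary: f)
  case 0
  then show ?case by (auto intro!: continuous_at_imp_continuous_on differentiable_imp_continuous_within)
next
  case (Suc m)
  show ?case using Suc.prems Suc.IH by (auto simp del: C_k.simps(2) simp: C_k.simps(2)[of "Suc m" f] C_k.simps(2)[of m f])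
qed

lemma C_k_scaleR:
  fixes f :: "real^'n \<Rightarrow> real"
  assumes "C_k m f" "C_k m g" shows "C_k m (\<lambda>x. f x *\<^sub>R g x)"
  using assms
proof (induction m arbitrary: f g)
  case 0 then show ?case by (auto intro!: continuous_intros)
next
  case (Suc m)
  have d: "f differentiable (at x)" "g differentiable (at x)" for x using Suc.prems by auto
  have "partial i (\<lambda>x. f x *\<^sub>R g x) = (\<lambda>x. f x *\<^sub>R partial i g x + partial i f x *\<^sub>R g x)" for i
    using d by (auto simp: partial_scaleR)
  moreover have "C_k m (\<lambda>x. f x *\<^sub>R partial i g x + partial i f x *\<^sub>R g x)" for i
    using Suc.prems Suc.prems[THEN C_k_Suc_imp] by (intro C_k_add Suc.IH) auto
  moreover have "(\<lambda>x. f x *\<^sub>R g x) differentiable (at x)" for x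
    using d[of x] unfolding differentiable_def by (blast intro: has_derivative_scaleR)
  ultimately show ?case by simp
qed

lemma smooth_scaleR:
  fixes f :: "real^'n \<Rightarrow> real"
  shows "smooth f \<Longrightarrow> smooth g \<Longrightarrow> smooth (\<lambda>x. f x *\<^sub>R g x)"
  unfolding smooth_def by (blast intro: C_k_scaleR)

lemma smooth_mult:
  fixes f :: "real^'n \<Rightarrow> real"
  assumes "smooth f" "smooth g" shows "smooth (\<lambda>x. f x * g x)"
  using smooth_scaleR[OF assms] by simp

lemma smooth_affine:
  assumes "smooth f" shows "smooth (\<lambda>x. f (c *\<^sub>R x + a))"
proof (rule smooth_coinduct[where P="\<lambda>g. \<exists>f d. smooth f \<and> g = (\<lambda>x. d *\<^sub>R f (c *\<^sub>R x + a))"])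
  fix g assume "\<exists>f d. smooth f \<and> g = (\<lambda>x. d *\<^sub>R f (c *\<^sub>R x + a))"
  then obtain f d where f: "smooth f" and g: "g = (\<lambda>x. d *\<^sub>R f (c *\<^sub>R x + a))" by blast
  have diff: "(\<lambda>x. f (c *\<^sub>R x + a)) differentiable (at x)" for x
    by (rule differentiable_chain_at[unfolded o_def, where f="\<lambda>x. c *\<^sub>R x + a"])
      (auto intro!: derivative_intros smooth_differentiable f)
  have "partial i g = (\<lambda>x. (d*c) *\<^sub>R partial i f (c *\<^sub>R x + a))" for i
    unfolding g using partial_bounded_linear[OF bounded_linear_scaleR_right diff] partial_affine[OF smooth_differentiable[OF f]]
    by (simp add: fun_eq_iff)
  moreover have "g differentiable (at x)" for x
    unfolding g by (intro derivative_intros diff) 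
  ultimately show "(\<forall>x. g differentiable (at x)) \<and> (\<forall>i. \<exists>f d. smooth f \<and> partial i g = (\<lambda>x. d *\<^sub>R f (c *\<^sub>R x + a)))"
    using smooth_partial[OF f] by blast
qed (use assms in \<open>intro exI[of _ f] exI[of _ 1], simp\<close>)

text \<open>Composition with a member of a family of real functions whose derivatives are linear combinations of
  members of the same family.\<close>

lemma smooth_real_comp:
  fixes g :: "'a \<Rightarrow> real \<Rightarrow> real" and q :: "real^'n \<Rightarrow> real"
  assumes deriv: "\<And>a t. t \<in> T \<Longrightarrow> (g a has_real_derivative (\<Sum>b\<in>B a. c a b * g b t)) (at t)"
    and q: "smooth q" "\<And>x. q x \<in> T"
  shows "smooth (\<lambda>x. g a (q x))"
proof -
  have "C_k m (\<lambda>x. g a (q x))" for m a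
  proof (induction m arbitrary: a)
    case 0
    have "isCont (\<lambda>x. g a (q x)) x" for x
      by (rule isCont_o2[where g="g a"])
        (use q smooth_differentiable[OF q(1)] DERIV_isCont[OF deriv] in
         \<open>auto intro: differentiable_imp_continuous_within\<close>)
    then show ?case by (simp add: continuous_at_imp_continuous_on)
  next
    case (Suc m)
    have d: "(\<lambda>x. g a (q x)) differentiable (at x)" for x
      using has_derivative_compose[OF has_derivative_partial[OF smooth_differentiable[OF q(1)]]
          deriv[OF q(2), unfolded has_field_derivative_def]]
      unfolding differentiable_def by blast
    have p: "partial i (\<lambda>x. g a (q x)) = (\<lambda>x. \<Sum>b\<in>B a. (c a b * g b (q x)) * partial i q x)" for i
      using partial_real_comp[OF smooth_differentiable[OF q(1)] deriv[OF q(2)]]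
      by (auto simp: sum_distrib_right)
    have 1: "C_k m (\<lambda>x. (c a b * g b (q x)) * partial i q x)" for b i
      using C_k_scaleR[OF C_k_scaleR[OF smooth_const[unfolded smooth_def, rule_format] Suc.IH]
          smooth_partial[OF q(1), unfolded smooth_def, rule_format]]
      by simp
    have "C_k m (\<lambda>x. \<Sum>b\<in>B. (c a b * g b (q x)) * partial i q x)" for i B
      by (induction B rule: infinite_finite_induct)
        (auto intro: C_k_add 1 smooth_const[unfolded smooth_def, rule_format])
    with d show ?case by (simp add: p)
  qed
  then show ?thesis unfolding smooth_def by blast
qed

section \<open>Test functions\<close>

lemma test_fun_iff:
  "test_fun f \<longleftrightarrow> smooth f \<and> (\<exists>K. compact K \<and> (\<forall>x. x \<notin> K \<longrightarrow> f x = 0))"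
proof
  assume "test_fun f"
  moreover have "\<forall>x. x \<notin> closure {x. f x \<noteq> 0} \<longrightarrow> f x = 0"
    using closure_subset[of "{x. f x \<noteq> 0}"] by blast
  ultimately show "smooth f \<and> (\<exists>K. compact K \<and> (\<forall>x. x \<notin> K \<longrightarrow> f x = 0))"
    unfolding test_fun_def smooth_def by blast
next
  assume *: "smooth f \<and> (\<exists>K. compact K \<and> (\<forall>x. x \<notin> K \<longrightarrow> f x = 0))"
  then obtain K where K: "compact K" "\<And>x. x \<notin> K \<Longrightarrow> f x = 0" by blast
  then have "closure {x. f x \<noteq> 0} \<subseteq> K" by (intro closure_minimal) (auto intro: compact_imp_closed)
  then have "closure {x. f x \<noteq> 0} = K \<inter> closure {x. f x \<noteq> 0}" by blast
  with K(1) have "compact (closure {x. f x \<noteq> 0})" by (metis closed_closure compact_Int_closed)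
  with * show "test_fun f" unfolding test_fun_def smooth_def by blast
qed

lemma test_fun_smooth: "test_fun f \<Longrightarrow> smooth f" by (simp add: test_fun_iff)

lemma test_fun_differentiable: "test_fun f \<Longrightarrow> f differentiable (at x)"
  by (simp add: test_fun_smooth smooth_differentiable)

lemma test_fun_continuous: "test_fun f \<Longrightarrow> continuous_on UNIV f"
  by (simp add: test_fun_smooth smooth_continuous)

lemma partial_eq_0:
  assumes "compact K" "\<And>x. x \<notin> K \<Longrightarrow> f x = 0" "x \<notin> K"
  shows "partial i f x = 0"
proof -
  have "open (- K)" using assms(1) by (simp add: compact_imp_closed open_Compl)
  have "(f has_derivative (\<lambda>_. 0)) (at x)"
    by (rule has_derivative_transform_within_open[OF has_derivative_const \<open>open (- K)\<close>]) (use assms in auto)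
  from partial_eq[OF this] show ?thesis by simp
qed

lemma test_fun_partial: "test_fun f \<Longrightarrow> test_fun (partial i f)"
  unfolding test_fun_iff by (meson smooth_partial partial_eq_0)

lemma test_fun_mult_smooth:
  fixes f g :: "real^'n \<Rightarrow> real"
  shows "smooth g \<Longrightarrow> test_fun f \<Longrightarrow> test_fun (\<lambda>x. g x * f x)"
  unfolding test_fun_iff using smooth_mult by (metis mult_zero_right)

lemma test_fun_affine:
  assumes f: "test_fun f" and c: "c \<noteq> 0"
  shows "test_fun (\<lambda>x. f (c *\<^sub>R x + a))"
proof -
  obtain K where K: "compact K" "\<And>x. x \<notin> K \<Longrightarrow> f x = 0" using f test_fun_iff by blast
  have "compact ((\<lambda>y. (1/c) *\<^sub>R (y - a)) ` K)"
    by (intro compact_continuous_image K) (auto intro!: continuous_intros)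
  moreover have "f (c *\<^sub>R x + a) = 0" if "x \<notin> (\<lambda>y. (1/c) *\<^sub>R (y - a)) ` K" for x
    using that c by (intro K(2)) (force simp: image_iff)
  ultimately show ?thesis using smooth_affine[OF test_fun_smooth[OF f]] unfolding test_fun_iff by blast
qed

lemma test_fun_linear_image:
  assumes "bounded_linear L" "test_fun f" shows "test_fun (\<lambda>x. L (f x))"
  using assms(2) smooth_linear_image[OF assms(1)] linear_simps(3)[OF assms(1)] unfolding test_fun_iff by auto

lemma test_fun_add: "test_fun f \<Longrightarrow> test_fun g \<Longrightarrow> test_fun (\<lambda>x. f x + g x)"
proof -
  assume f: "test_fun f" and g: "test_fun g"
  obtain K L where "compact K" "\<And>x. x \<notin> K \<Longrightarrow> f x = 0" "compact L" "\<And>x. x \<notin> L \<Longrightarrow> g x = 0"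
    using f g unfolding test_fun_iff by blast
  then show ?thesis using f g unfolding test_fun_iff
    by (intro conjI smooth_add exI[of _ "K \<union> L"]) auto
qed

lemma test_fun_zero: "test_fun (\<lambda>x. 0)"
  unfolding test_fun_iff using smooth_const compact_empty by blast

lemma test_fun_sum: "(\<And>i. i \<in> I \<Longrightarrow> test_fun (f i)) \<Longrightarrow> test_fun (\<lambda>x. \<Sum>i\<in>I. f i x)"
  by (induction I rule: infinite_finite_induct) (auto simp: test_fun_zero intro: test_fun_add)

lemma test_fun_bounded:
  assumes "test_fun f" obtains C where "C > 0" "\<And>x. norm (f x) \<le> C"
proof -
  obtain K where K: "compact K" "\<And>x. x \<notin> K \<Longrightarrow> f x = 0" using assms test_fun_iff by blast
  have "bounded (f ` K)"
    by (intro compact_imp_bounded compact_continuous_image continuous_on_subset[OF test_fun_continuous[OF assms]] K) auto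
  then obtain C where C: "C > 0" "\<And>x. x \<in> K \<Longrightarrow> norm (f x) \<le> C" unfolding bounded_pos by auto
  then have "norm (f x) \<le> C" for x using K(2)[of x] by (cases "x \<in> K") auto
  with C(1) show thesis by (rule that)
qed

lemma has_real_derivative_along_axis:
  fixes f :: "real^'n \<Rightarrow> real"
  assumes "smooth f"
  shows "((\<lambda>t. f (x + t *\<^sub>R axis i 1)) has_real_derivative partial i f (x + t *\<^sub>R axis i 1)) (at t)"
proof -
  obtain f' where f': "(f has_derivative f') (at (x + t *\<^sub>R axis i 1))"
    using smooth_differentiable[OF assms] unfolding differentiable_def by blast
  interpret f': bounded_linear f' by (rule has_derivative_bounded_linear[OF f'])
  have "((\<lambda>t. x + t *\<^sub>R axis i 1) has_derivative (\<lambda>h. h *\<^sub>R axis i 1)) (at t)"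
    by (auto intro!: derivative_eq_intros)
  from has_derivative_compose[OF this f'] partial_eq[OF f', of i]
  show ?thesis by (simp add: has_field_derivative_def f'.scaleR mult.commute mult_commute_abs)
qed

text \<open>The second difference is symmetric in \<open>i\<close> and \<open>j\<close>, and two applications of the mean value
  theorem identify it with a mixed second derivative.\<close>

lemma second_difference_eq:
  fixes f :: "real^'n \<Rightarrow> real"
  assumes f: "smooth f" and h: "h > 0"
  shows "\<exists>s t. 0 < s \<and> s < h \<and> 0 < t \<and> t < h \<and>
    f (x + h *\<^sub>R axis i 1 + h *\<^sub>R axis j 1) - f (x + h *\<^sub>R axis i 1) - f (x + h *\<^sub>R axis j 1) + f x
      = h\<^sup>2 * partial j (partial i f) (x + s *\<^sub>R axis i 1 + t *\<^sub>R axis j 1)"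
proof -
  let ?g = "\<lambda>s. f ((x + h *\<^sub>R axis j 1) + s *\<^sub>R axis i 1) - f (x + s *\<^sub>R axis i 1)"
  obtain s where s: "0 < s" "s < h" "?g h - ?g 0
      = (h - 0) * (partial i f ((x + h *\<^sub>R axis j 1) + s *\<^sub>R axis i 1) - partial i f (x + s *\<^sub>R axis i 1))"
    using MVT2[OF h, of ?g "\<lambda>s. partial i f ((x + h *\<^sub>R axis j 1) + s *\<^sub>R axis i 1) - partial i f (x + s *\<^sub>R axis i 1)"]
      DERIV_diff[OF has_real_derivative_along_axis[OF f] has_real_derivative_along_axis[OF f]] by blast
  let ?k = "\<lambda>t. partial i f ((x + s *\<^sub>R axis i 1) + t *\<^sub>R axis j 1)"
  obtain t where t: "0 < t" "t < h" "?k h - ?k 0 = (h - 0) * partial j (partial i f) ((x + s *\<^sub>R axis i 1) + t *\<^sub>R axis j 1)"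
    using MVT2[OF h, of ?k "\<lambda>t. partial j (partial i f) ((x + s *\<^sub>R axis i 1) + t *\<^sub>R axis j 1)"]
      has_real_derivative_along_axis[OF smooth_partial[OF f]] by blast
  have "f (x + h *\<^sub>R axis i 1 + h *\<^sub>R axis j 1) - f (x + h *\<^sub>R axis i 1) - f (x + h *\<^sub>R axis j 1) + f x = ?g h - ?g 0"
    by (simp add: algebra_simps)
  also have "\<dots> = h * (?k h - ?k 0)" using s(3) by (simp add: algebra_simps)
  also have "\<dots> = h\<^sup>2 * partial j (partial i f) ((x + s *\<^sub>R axis i 1) + t *\<^sub>R axis j 1)"
    using t(3) by (simp add: power2_eq_square)
  finally show ?thesis using s t by blast
qed

lemma partial_commute:
  fixes f :: "real^'n \<Rightarrow> real"
  assumes f: "smooth f"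
  shows "partial i (partial j f) = partial j (partial i f)"
proof
  fix x
  have near: "\<exists>d>0. \<forall>s t. 0 < s \<and> s < d \<and> 0 < t \<and> t < d \<longrightarrow>
      \<bar>partial j (partial i f) (x + s *\<^sub>R axis i 1 + t *\<^sub>R axis j 1) - partial j (partial i f) x\<bar> < e"
    if "e > 0" for e and i j :: 'n
  proof -
    have "isCont (partial j (partial i f)) x"
      using smooth_continuous[OF smooth_partial[OF smooth_partial[OF f]]] by (simp add: continuous_on_eq_continuous_at)
    from this[unfolded continuous_at_eps_delta dist_real_def, rule_format, OF that]
    obtain d where d: "d > 0" "\<forall>y. dist y x < d \<longrightarrow> \<bar>partial j (partial i f) y - partial j (partial i f) x\<bar> < e"
      by blast
    have "dist (x + s *\<^sub>R axis i 1 + t *\<^sub>R axis j 1) x < d" if "0 < s" "s < d/2" "0 < t" "t < d/2" for s t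
    proof -
      have "norm (s *\<^sub>R axis i (1::real) + t *\<^sub>R axis j 1) \<le> \<bar>s\<bar> + \<bar>t\<bar>"
        using norm_triangle_ineq[of "s *\<^sub>R axis i (1::real)" "t *\<^sub>R axis j 1"] by (simp add: norm_axis_1)
      then show ?thesis using that by (simp add: dist_norm add.assoc)
    qed
    then show ?thesis using d by (intro exI[of _ "d/2"]) simp
  qed
  have "\<bar>partial i (partial j f) x - partial j (partial i f) x\<bar> \<le> e" if "e > 0" for e
  proof -
    have e2: "e/2 > 0" using that by simp
    obtain d1 where d1: "d1 > 0" "\<And>s t. 0 < s \<Longrightarrow> s < d1 \<Longrightarrow> 0 < t \<Longrightarrow> t < d1 \<Longrightarrow>
      \<bar>partial j (partial i f) (x + s *\<^sub>R axis i 1 + t *\<^sub>R axis j 1) - partial j (partial i f) x\<bar> < e/2"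
      using near[OF e2, of j i] by blast
    obtain d2 where d2: "d2 > 0" "\<And>s t. 0 < s \<Longrightarrow> s < d2 \<Longrightarrow> 0 < t \<Longrightarrow> t < d2 \<Longrightarrow>
      \<bar>partial i (partial j f) (x + s *\<^sub>R axis j 1 + t *\<^sub>R axis i 1) - partial i (partial j f) x\<bar> < e/2"
      using near[OF e2, of i j] by blast
    define h where "h = min d1 d2"
    have h: "h > 0" "h \<le> d1" "h \<le> d2" using d1(1) d2(1) by (auto simp: h_def)
    obtain s t where st: "0 < s" "s < h" "0 < t" "t < h"
      "f (x + h *\<^sub>R axis i 1 + h *\<^sub>R axis j 1) - f (x + h *\<^sub>R axis i 1) - f (x + h *\<^sub>R axis j 1) + f x
      = h\<^sup>2 * partial j (partial i f) (x + s *\<^sub>R axis i 1 + t *\<^sub>R axis j 1)"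
      using second_difference_eq[OF f h(1), of x i j] by blast
    obtain s' t' where st': "0 < s'" "s' < h" "0 < t'" "t' < h"
      "f (x + h *\<^sub>R axis j 1 + h *\<^sub>R axis i 1) - f (x + h *\<^sub>R axis j 1) - f (x + h *\<^sub>R axis i 1) + f x
      = h\<^sup>2 * partial i (partial j f) (x + s' *\<^sub>R axis j 1 + t' *\<^sub>R axis i 1)"
      using second_difference_eq[OF f h(1), of x j i] by blast
    have "h\<^sup>2 * partial j (partial i f) (x + s *\<^sub>R axis i 1 + t *\<^sub>R axis j 1)
        = h\<^sup>2 * partial i (partial j f) (x + s' *\<^sub>R axis j 1 + t' *\<^sub>R axis i 1)"
      unfolding st(5)[symmetric] st'(5)[symmetric] by (simp add: algebra_simps)
    then have "partial j (partial i f) (x + s *\<^sub>R axis i 1 + t *\<^sub>R axis j 1)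
        = partial i (partial j f) (x + s' *\<^sub>R axis j 1 + t' *\<^sub>R axis i 1)" using h(1) by simp
    moreover have "\<bar>partial j (partial i f) (x + s *\<^sub>R axis i 1 + t *\<^sub>R axis j 1) - partial j (partial i f) x\<bar> < e/2"
      using d1(2) st h by auto
    moreover have "\<bar>partial i (partial j f) (x + s' *\<^sub>R axis j 1 + t' *\<^sub>R axis i 1) - partial i (partial j f) x\<bar> < e/2"
      using d2(2) st' h by auto
    ultimately show ?thesis by linarith
  qed
  then show "partial i (partial j f) x = partial j (partial i f) x"
    by (metis abs_le_zero_iff eq_iff_diff_eq_0 field_le_epsilon add_0)
qed

text \<open>The functions \<open>exp (-1/t) / t^n\<close>, extended by zero to \<open>t \<le> 0\<close>; each derivative is a linear
  combination of two members of the family.\<close>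

definition flat :: "nat \<Rightarrow> real \<Rightarrow> real" where
  "flat n t = (if t > 0 then exp (- 1 / t) / t ^ n else 0)"

lemma DERIV_flat: "(flat n has_real_derivative (flat (n + 2) t - real n * flat (n + 1) t)) (at t)"
proof (cases t "0::real" rule: linorder_cases)
  case less
  have "((\<lambda>_. 0) has_real_derivative 0) (at t)" by simp
  then have "(flat n has_real_derivative 0) (at t)"
    by (rule has_field_derivative_transform_within_open[of _ _ _ "{..<0}"]) (use less in \<open>auto simp: flat_def\<close>)
  then show ?thesis using less by (simp add: flat_def)
next
  case greater
  have "((\<lambda>t. exp (- 1 / t) / t ^ n) has_real_derivative
      (exp (- 1 / t) * (1 / t^2) * t^n - exp (- 1 / t) * (real n * t ^ (n - 1))) / (t^n * t^n)) (at t)"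
    using greater by (auto intro!: derivative_eq_intros simp: power2_eq_square)
  also have "(exp (- 1 / t) * (1 / t^2) * t^n - exp (- 1 / t) * (real n * t ^ (n - 1))) / (t^n * t^n)
      = flat (n + 2) t - real n * flat (n + 1) t"
    using greater by (cases n) (auto simp: flat_def field_simps power2_eq_square)
  finally show ?thesis
    by (rule has_field_derivative_transform_within_open[of _ _ _ "{0<..}"]) (use greater in \<open>auto simp: flat_def\<close>)
next
  case equal
  have "((\<lambda>h. (1 / h) ^ Suc n / exp (1 / h)) \<longlongrightarrow> 0) (at_right (0::real))"
    by (rule filterlim_compose[OF tendsto_power_div_exp_0])
      (simp add: filterlim_inverse_at_top_right divide_inverse)
  then have "((\<lambda>h. flat n h / h) \<longlongrightarrow> 0) (at_right 0)"
    by (rule Lim_transform_eventually)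
      (auto simp: eventually_at_right_less flat_def exp_minus field_simps intro!: eventually_mono[OF eventually_at_right_less])
  moreover have "((\<lambda>h. flat n h / h) \<longlongrightarrow> 0) (at_left 0)"
    by (rule Lim_transform_eventually[OF tendsto_const])
      (auto simp: flat_def eventually_at_left_field intro!: exI[of _ "-1"])
  ultimately have "((\<lambda>h. flat n h / h) \<longlongrightarrow> 0) (at 0)" by (simp add: filterlim_split_at)
  then have "(flat n has_real_derivative 0) (at 0)"
    by (simp add: has_field_derivative_iff flat_def)
  then show ?thesis using equal by (simp add: flat_def)
qed

lemma inner_self_sum: "x \<bullet> x = (\<Sum>i\<in>UNIV. x $ i * x $ i)" for x :: "real^'n"
  by (simp add: inner_vec_def)

lemma smooth_inner_self: "smooth (\<lambda>x::real^'n. x \<bullet> x)"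
  unfolding inner_self_sum by (intro smooth_sum smooth_mult smooth_component)

lemma partial_comp_inner_self:
  assumes "(g has_real_derivative d) (at (c + e * (x \<bullet> x)))"
  shows "partial i (\<lambda>x::real^'n. g (c + e * (x \<bullet> x))) x = 2 * e * d * x $ i"
proof -
  have "((\<lambda>x::real^'n. c + e * (x \<bullet> x)) has_derivative (\<lambda>h. e * (2 * (x \<bullet> h)))) (at x)"
    by (auto intro!: derivative_eq_intros simp: inner_commute)
  moreover from partial_eq[OF this, of i] have "partial i (\<lambda>x::real^'n. c + e * (x \<bullet> x)) x = 2 * e * x $ i"
    by (simp add: inner_axis)
  ultimately show ?thesis using partial_real_comp[of "\<lambda>x. c + e * (x \<bullet> x)" x g d i] assms
    by (simp add: differentiableI)
qed

lemma smooth_affine_inner_self: "smooth (\<lambda>x::real^'n. c + e * (x \<bullet> x))"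
  by (intro smooth_add smooth_mult smooth_const smooth_inner_self)

lemma smooth_flat_comp: "smooth q \<Longrightarrow> smooth (\<lambda>x::real^'n. flat n (q x))"
  using smooth_real_comp[where T=UNIV and g=flat and B="\<lambda>n. {n + 1, n + 2}" and c="\<lambda>n m. if m = n + 2 then 1 else - real n" and q=q and a=n] DERIV_flat
  by simp

text \<open>The standard bump function \<open>exp (-1 / (1 - |x|\<^sup>2))\<close>, supported in the closed unit ball.  The
  argument of \<open>flat\<close> is written in the form required by lemma \<open>partial_comp_inner_self\<close>.\<close>

definition bump :: "real^'n \<Rightarrow> real" where
  "bump x = flat 0 (1 + (- 1) * (x \<bullet> x))"

lemma bump_eq_0: "1 < norm z \<Longrightarrow> bump z = 0" for z :: "real^'n"
proof -
  assume "1 < norm z"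
  then have "1 * 1 < norm z * norm z" by (intro mult_strict_mono) auto
  then show ?thesis by (simp add: bump_def flat_def power2_norm_eq_inner[symmetric] power2_eq_square)
qed

lemma partial_outside:
  assumes "\<And>z. 1 < norm z \<Longrightarrow> f z = 0" "1 < norm z" shows "partial i f z = 0"
  by (rule partial_eq_0[of "cball 0 1"]) (use assms in auto)

lemma test_fun_bump: "test_fun bump"
proof -
  have "bump x = 0" if "x \<notin> cball 0 1" for x :: "real^'n" using bump_eq_0[of x] that by simp
  then show ?thesis unfolding test_fun_iff bump_def
    by (intro conjI smooth_flat_comp smooth_affine_inner_self exI[of _ "cball 0 1"]) auto
qed

lemma bump_nonneg: "bump x \<ge> 0" by (simp add: bump_def flat_def)

lemma bump_0: "bump 0 = exp (- 1)" by (simp add: bump_def flat_def)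

lemma partial_bump: "partial i bump = (\<lambda>x. (- 2 * flat 2 (1 + (- 1) * (x \<bullet> x))) * x $ i)"
  using partial_comp_inner_self[OF DERIV_flat[of 0], where c=1 and e="-1"]
  by (auto simp: bump_def[abs_def] numeral_2_eq_2)

lemma partial_partial_bump_0: "partial j (partial i bump) 0 = (if i = j then - 2 * exp (- 1) else 0)"
proof -
  have "smooth (\<lambda>x. - 2 * flat 2 (1 + (- 1) * (x \<bullet> x)))"
    by (intro smooth_mult smooth_const smooth_flat_comp smooth_affine_inner_self)
  from smooth_differentiable[OF this] show ?thesis unfolding partial_bump
    by (subst partial_mult) (auto simp: smooth_differentiable smooth_component flat_def)
qed

section \<open>Mollification in \<open>L\<^sup>2\<close>\<close>

lemma lborel_integrable_affine:
  fixes f :: "'a::euclidean_space \<Rightarrow> real"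
  assumes f: "integrable lborel f" and c: "c \<noteq> 0"
  shows "integrable lborel (\<lambda>x. f (t + c *\<^sub>R x))"
proof -
  have [measurable]: "f \<in> borel_measurable borel" using f by auto
  have "integrable (density (distr lborel borel (\<lambda>x. t + c *\<^sub>R x)) (\<lambda>_. \<bar>c\<bar>^DIM('a))) f"
    using f lborel_affine[OF c, of t, symmetric] by simp
  then have "integrable lborel (\<lambda>x. \<bar>c\<bar>^DIM('a) *\<^sub>R f (t + c *\<^sub>R x))"
    by (subst (asm) integrable_density) (auto simp: integrable_distr_eq)
  then show ?thesis using c by simp
qed

lemma lborel_integral_affine:
  fixes f :: "'a::euclidean_space \<Rightarrow> real"
  assumes [measurable]: "f \<in> borel_measurable borel" and c: "c \<noteq> 0"
  shows "(LINT x|lborel. f x) = \<bar>c\<bar>^DIM('a) * (LINT x|lborel. f (t + c *\<^sub>R x))"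
proof -
  have "(LINT x|lborel. f x) = (LINT x|density (distr lborel borel (\<lambda>x. t + c *\<^sub>R x)) (\<lambda>_. ennreal (\<bar>c\<bar>^DIM('a))). f x)"
    using lborel_affine[OF c, of t, symmetric] by simp
  also have "\<dots> = \<bar>c\<bar>^DIM('a) * (LINT x|lborel. f (t + c *\<^sub>R x))"
    by (subst integral_density) (auto simp: integral_distr)
  finally show ?thesis .
qed

text \<open>Borel functions in \<open>L\<^sup>2\<close> that vanish outside a ball.\<close>

definition L2_cs :: "('a::euclidean_space \<Rightarrow> real) \<Rightarrow> bool" where
  "L2_cs a \<longleftrightarrow> a \<in> borel_measurable borel \<and> integrable lborel (\<lambda>x. (a x)\<^sup>2) \<and>
     (\<exists>R. \<forall>x. x \<notin> cball 0 R \<longrightarrow> a x = 0)"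

lemma abs_mult_le_squares: "\<bar>a * b\<bar> \<le> a\<^sup>2 + (b::real)\<^sup>2"
proof -
  have "2 * \<bar>a * b\<bar> \<le> a\<^sup>2 + b\<^sup>2"
    using sum_squares_bound[of "\<bar>a\<bar>" "\<bar>b\<bar>"] by (simp add: abs_mult)
  then show ?thesis using abs_ge_zero[of "a * b"] by linarith
qed

lemma integrable_indicator_cball: "integrable lborel (indicator (cball c R) :: 'a::euclidean_space \<Rightarrow> real)"
  by (rule integrable_real_indicator, simp) (rule emeasure_bounded_finite, simp)

lemma integrable_mult_L2:
  fixes a b :: "'a \<Rightarrow> real"
  assumes "a \<in> borel_measurable M" "b \<in> borel_measurable M"
    "integrable M (\<lambda>x. (a x)\<^sup>2)" "integrable M (\<lambda>x. (b x)\<^sup>2)"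
  shows "integrable M (\<lambda>x. a x * b x)"
proof (rule Bochner_Integration.integrable_bound[OF Bochner_Integration.integrable_add[OF assms(3,4)]])
  show "(\<lambda>x. a x * b x) \<in> borel_measurable M" using assms(1,2) by measurable
  show "AE x in M. norm (a x * b x) \<le> norm ((a x)\<^sup>2 + (b x)\<^sup>2)"
    using abs_mult_le_squares[of "a _" "b _"] by simp
qed

text \<open>The Cauchy--Schwarz inequality, up to a constant, in the form obtained from Young's inequality; the free
  parameter \<open>t\<close> replaces square roots of integrals.\<close>

lemma abs_integral_mult_le:
  fixes a b :: "'a \<Rightarrow> real"
  assumes [measurable]: "a \<in> borel_measurable M" "b \<in> borel_measurable M"
    and "integrable M (\<lambda>x. (a x)\<^sup>2)" "integrable M (\<lambda>x. (b x)\<^sup>2)" "t > 0"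
  shows "\<bar>LINT x|M. a x * b x\<bar> \<le> t * (LINT x|M. (a x)\<^sup>2) + (LINT x|M. (b x)\<^sup>2) / t"
proof -
  have "norm (LINT x|M. a x * b x) \<le> (LINT x|M. norm (a x * b x))" by (rule integral_norm_bound)
  also have "\<dots> \<le> (LINT x|M. t * (a x)\<^sup>2 + (b x)\<^sup>2 / t)"
  proof (rule integral_mono)
    show "integrable M (\<lambda>x. norm (a x * b x))" by (intro integrable_norm integrable_mult_L2) fact+
    fix x
    have "\<bar>(sqrt t * a x) * (b x / sqrt t)\<bar> \<le> (sqrt t * a x)\<^sup>2 + (b x / sqrt t)\<^sup>2" by (rule abs_mult_le_squares)
    then show "norm (a x * b x) \<le> t * (a x)\<^sup>2 + (b x)\<^sup>2 / t"
      using assms(5) by (simp add: power_mult_distrib power_divide)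
  qed (use assms in auto)
  finally show ?thesis using assms by simp
qed

lemma L2_cs_integrable:
  assumes "L2_cs a" shows "integrable lborel a"
proof -
  obtain R where R: "\<And>x. x \<notin> cball 0 R \<Longrightarrow> a x = 0" using assms unfolding L2_cs_def by blast
  have m [measurable]: "a \<in> borel_measurable borel" using assms unfolding L2_cs_def by blast
  have "(\<lambda>x::'a. (indicator (cball 0 R) x :: real)\<^sup>2) = indicator (cball 0 R)"
    by (auto simp: indicator_def)
  then have "integrable lborel (\<lambda>x. a x * indicator (cball 0 R) x)"
    using assms m integrable_indicator_cball[of "0::'a" R] unfolding L2_cs_def
    by (intro integrable_mult_L2) auto
  moreover have "(\<lambda>x. a x * indicator (cball 0 R) x) = a"
    using R by (fastforce simp: indicator_def)
  ultimately show ?thesis by simp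
qed

text \<open>Truncation to the interval \<open>[-M, M]\<close>.\<close>

definition clip :: "real \<Rightarrow> real \<Rightarrow> real" where
  "clip M t = max (- M) (min M t)"

text \<open>Density of bounded continuous functions: truncate, then use that a Lebesgue measurable function is
  almost everywhere the limit of continuous functions, which may be truncated and cut off as well.\<close>

lemma L2_cs_approx_continuous:
  fixes a :: "'a::euclidean_space \<Rightarrow> real"
  assumes a: "L2_cs a" and e: "e > 0"
  obtains g C where "continuous_on UNIV g" "\<And>x. \<bar>g x\<bar> \<le> C"
    "integrable lborel (\<lambda>x. (a x - g x)\<^sup>2)" "(LINT x|lborel. (a x - g x)\<^sup>2) < e"
proof -
  have [measurable]: "a \<in> borel_measurable borel" and a2: "integrable lborel (\<lambda>x. (a x)\<^sup>2)"
    using a unfolding L2_cs_def by auto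
  obtain R where R: "\<And>x. x \<notin> cball 0 R \<Longrightarrow> a x = 0" using a unfolding L2_cs_def by blast
  have [measurable]: "clip M \<in> borel_measurable borel" for M unfolding clip_def[abs_def] by measurable
  have clip_cont: "continuous_on UNIV (clip M)" for M unfolding clip_def[abs_def] by (intro continuous_intros)
  have "(\<lambda>n. LINT x|lborel. (a x - clip (real n) (a x))\<^sup>2) \<longlonglongrightarrow> (LINT x::'a|lborel. 0)"
  proof (rule integral_dominated_convergence[where w="\<lambda>x. (a x)\<^sup>2"])
    show "AE x in lborel. (\<lambda>n. (a x - clip (real n) (a x))\<^sup>2) \<longlonglongrightarrow> 0"
    proof (rule AE_I2, rule tendsto_eventually)
      fix x
      obtain n where "\<bar>a x\<bar> \<le> real n" by (meson real_arch_simple)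
      then show "\<forall>\<^sub>F n in sequentially. (a x - clip (real n) (a x))\<^sup>2 = 0"
        by (intro eventually_sequentiallyI[of n]) (auto simp: clip_def)
    qed
    show "AE x in lborel. norm ((a x - clip (real n) (a x))\<^sup>2) \<le> (a x)\<^sup>2" for n
      by (rule AE_I2) (auto simp: clip_def abs_le_square_iff[symmetric])
  qed (use a2 in auto)
  then have "\<forall>\<^sub>F n in sequentially. (LINT x|lborel. (a x - clip (real n) (a x))\<^sup>2) < e/4"
    using e by (intro order_tendstoD(2)) auto
  then obtain n where n: "(LINT x|lborel. (a x - clip (real n) (a x))\<^sup>2) < e/4"
    by (meson eventually_sequentially order_refl)
  define M where "M = real n"
  define b where "b x = clip M (a x)" for x
  have bm [measurable]: "b \<in> borel_measurable borel" unfolding b_def by measurable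
  have ab: "integrable lborel (\<lambda>x. (a x - b x)\<^sup>2)"
    by (rule Bochner_Integration.integrable_bound[OF a2])
      (auto simp: b_def clip_def M_def abs_le_square_iff[symmetric])
  have "b measurable_on UNIV"
    by (rule lebesgue_measurable_imp_measurable_on) (auto intro: measurable_completion)
  then obtain N g where N: "negligible N" and g: "\<And>n. continuous_on UNIV (g n)"
    and lim: "\<And>x. x \<notin> N \<Longrightarrow> (\<lambda>n. g n x) \<longlonglongrightarrow> b x"
    unfolding measurable_on_def by auto
  define k where "k m x = max 0 (min 1 (R + 1 - norm x)) * clip M (g m x)" for m x
  have k: "continuous_on UNIV (k m)" for m
    unfolding k_def clip_def by (intro continuous_intros g)
  have [measurable]: "k m \<in> borel_measurable borel" for m
    using k by (rule borel_measurable_continuous_onI)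
  have M: "M \<ge> 0" by (simp add: M_def)
  have kM: "\<bar>k m x\<bar> \<le> M" for m x
  proof -
    have "\<bar>k m x\<bar> \<le> 1 * M" unfolding k_def abs_mult by (rule mult_mono) (use M in \<open>auto simp: clip_def\<close>)
    then show ?thesis by simp
  qed
  have dom: "(b x - k m x)\<^sup>2 \<le> indicator (cball 0 (R + 1)) x * (2 * M)\<^sup>2" for m x
  proof (cases "x \<in> cball 0 (R + 1)")
    case True
    have "\<bar>b x - k m x\<bar> \<le> 2 * M" using kM[of m x] M by (auto simp: b_def clip_def)
    then have "\<bar>b x - k m x\<bar>\<^sup>2 \<le> (2 * M)\<^sup>2" by (rule power_mono) simp
    then show ?thesis using True by simp
  next
    case False
    then show ?thesis using R[of x] M by (auto simp: k_def b_def clip_def)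
  qed
  have domI: "integrable lborel (\<lambda>x::'a. indicator (cball 0 (R + 1)) x * (2 * M)\<^sup>2)"
    using integrable_indicator_cball[of "0::'a" "R + 1"] by simp
  have "(\<lambda>m. LINT x|lborel. (b x - k m x)\<^sup>2) \<longlonglongrightarrow> (LINT x::'a|lborel. 0)"
  proof (rule integral_dominated_convergence[where w="\<lambda>x. indicator (cball 0 (R + 1)) x * (2 * M)\<^sup>2"])
    have "AE x in lebesgue. x \<notin> N" using N by (simp add: negligible_iff_null_sets AE_not_in)
    then have "AE x in lborel. x \<notin> N" by (simp add: AE_completion_iff)
    then show "AE x in lborel. (\<lambda>m. (b x - k m x)\<^sup>2) \<longlonglongrightarrow> 0"
    proof eventually_elim
      case (elim x)
      have "(\<lambda>m. k m x) \<longlonglongrightarrow> max 0 (min 1 (R + 1 - norm x)) * clip M (b x)"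
        unfolding k_def
        by (intro tendsto_intros isCont_tendsto_compose[OF _ lim[OF elim]])
          (use clip_cont in \<open>simp add: continuous_on_eq_continuous_at\<close>)
      moreover have "max 0 (min 1 (R + 1 - norm x)) * clip M (b x) = b x"
        using R[of x] M by (cases "norm x \<le> R") (auto simp: b_def clip_def)
      ultimately have "(\<lambda>m. (b x - k m x)\<^sup>2) \<longlonglongrightarrow> (b x - b x)\<^sup>2" by (intro tendsto_intros) simp
      then show ?case by simp
    qed
    show "AE x in lborel. norm ((b x - k m x)\<^sup>2) \<le> indicator (cball 0 (R + 1)) x * (2 * M)\<^sup>2" for m
      using dom by simp
  qed (use domI in auto)
  then have "\<forall>\<^sub>F m in sequentially. (LINT x|lborel. (b x - k m x)\<^sup>2) < e/4"
    using e by (intro order_tendstoD(2)) auto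
  then obtain m where m: "(LINT x|lborel. (b x - k m x)\<^sup>2) < e/4"
    by (meson eventually_sequentially order_refl)
  have bk: "integrable lborel (\<lambda>x. (b x - k m x)\<^sup>2)"
    by (rule Bochner_Integration.integrable_bound[OF domI]) (use dom in auto)
  have le: "(a x - k m x)\<^sup>2 \<le> 2 * (a x - b x)\<^sup>2 + 2 * (b x - k m x)\<^sup>2" for x
    using zero_le_power2[of "(a x - b x) - (b x - k m x)"] by (simp add: power2_eq_square algebra_simps)
  have I2: "integrable lborel (\<lambda>x. 2 * (a x - b x)\<^sup>2 + 2 * (b x - k m x)\<^sup>2)" using ab bk by simp
  have I: "integrable lborel (\<lambda>x. (a x - k m x)\<^sup>2)"
    by (rule Bochner_Integration.integrable_bound[OF I2]) (use le in auto)
  have "(LINT x|lborel. (a x - k m x)\<^sup>2) \<le> (LINT x|lborel. 2 * (a x - b x)\<^sup>2 + 2 * (b x - k m x)\<^sup>2)"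
    by (rule integral_mono[OF I I2]) (use le in auto)
  also have "\<dots> < e" using ab bk n m by (simp add: b_def M_def)
  finally show ?thesis using that[OF k kM I] by blast
qed

lemma translate_sq:
  fixes a :: "'a::euclidean_space \<Rightarrow> real"
  assumes "integrable lborel (\<lambda>x. (a x)\<^sup>2)" "a \<in> borel_measurable borel"
  shows "integrable lborel (\<lambda>x. (a (h + x))\<^sup>2)" "(LINT x|lborel. (a (h + x))\<^sup>2) = (LINT x|lborel. (a x)\<^sup>2)"
  using lborel_integrable_affine[OF assms(1), of 1 h] lborel_integral_affine[of "\<lambda>x. (a x)\<^sup>2" 1 h] assms(2)
  by auto

lemma L2_translation_tendsto:
  fixes a b :: "'a::euclidean_space \<Rightarrow> real"
  assumes a: "L2_cs a" and b: "L2_cs b" and h: "h \<longlonglongrightarrow> 0"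
  shows "(\<lambda>n. LINT x|lborel. a x * b (h n + x)) \<longlonglongrightarrow> (LINT x|lborel. a x * b x)"
proof (rule LIMSEQ_I, simp only: real_norm_def)
  fix e :: real assume e: "e > 0"
  have [measurable]: "a \<in> borel_measurable borel" "b \<in> borel_measurable borel"
    and a2: "integrable lborel (\<lambda>x. (a x)\<^sup>2)" and b2: "integrable lborel (\<lambda>x. (b x)\<^sup>2)"
    using a b unfolding L2_cs_def by auto
  define A where "A = (LINT x|lborel. (a x)\<^sup>2)"
  have A: "A \<ge> 0" unfolding A_def by simp
  define t where "t = e / (8 * (A + 1))"
  have t: "t > 0" "t * A < e / 4" using e A by (auto simp: t_def field_simps intro!: add_pos_nonneg)
  have te: "t * e / 8 > 0" using t e by simp
  obtain g C where g: "continuous_on UNIV g" "\<And>x. \<bar>g x\<bar> \<le> C"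
    and I: "integrable lborel (\<lambda>x. (b x - g x)\<^sup>2)" and d: "(LINT x|lborel. (b x - g x)\<^sup>2) < t * e / 8"
    using L2_cs_approx_continuous[OF b te] by blast
  have [measurable]: "g \<in> borel_measurable borel" using g(1) by (rule borel_measurable_continuous_onI)
  have near: "\<bar>LINT x|lborel. a x * (b (s + x) - g (s + x))\<bar> < e / 4 + e / 8" for s
  proof -
    have *: "\<bar>LINT x|lborel. a x * (b (s + x) - g (s + x))\<bar>
       \<le> t * (LINT x|lborel. (a x)\<^sup>2) + (LINT x|lborel. (b (s + x) - g (s + x))\<^sup>2) / t"
      by (rule abs_integral_mult_le) (use a2 t translate_sq[OF I] in auto)
    have "(LINT x|lborel. (b (s + x) - g (s + x))\<^sup>2) / t < e / 8"
      using translate_sq(2)[OF I, of s] d t by (simp add: field_simps)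
    with * t(2) show ?thesis unfolding A_def by linarith
  qed
  have ag: "integrable lborel (\<lambda>x. a x * g (s + x))" for s
  proof (rule Bochner_Integration.integrable_bound[of _ "\<lambda>x. C * \<bar>a x\<bar>"])
    show "integrable lborel (\<lambda>x. C * \<bar>a x\<bar>)" using L2_cs_integrable[OF a] by simp
    show "AE x in lborel. norm (a x * g (s + x)) \<le> norm (C * \<bar>a x\<bar>)"
    proof (rule AE_I2)
      fix x
      have "\<bar>a x\<bar> * \<bar>g (s + x)\<bar> \<le> \<bar>a x\<bar> * C" by (rule mult_left_mono) (use g in auto)
      also have "\<dots> \<le> norm (C * \<bar>a x\<bar>)" by (simp add: abs_mult mult.commute mult_right_mono)
      finally show "norm (a x * g (s + x)) \<le> norm (C * \<bar>a x\<bar>)" by (simp add: abs_mult)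
    qed
  qed measurable
  have "(\<lambda>n. LINT x|lborel. a x * g (h n + x)) \<longlonglongrightarrow> (LINT x|lborel. a x * g x)"
  proof (rule integral_dominated_convergence[where w="\<lambda>x. C * \<bar>a x\<bar>"])
    show "integrable lborel (\<lambda>x. C * \<bar>a x\<bar>)" using L2_cs_integrable[OF a] by simp
    show "AE x in lborel. norm (a x * g (h n + x)) \<le> C * \<bar>a x\<bar>" for n
      using g(2)[of "h n + _"] by (auto simp: abs_mult mult.commute[of C] intro!: mult_left_mono)
    show "AE x in lborel. (\<lambda>n. a x * g (h n + x)) \<longlonglongrightarrow> a x * g x"
    proof (rule AE_I2)
      fix x
      have "(\<lambda>n. h n + x) \<longlonglongrightarrow> 0 + x" by (intro tendsto_intros h)
      then have "(\<lambda>n. g (h n + x)) \<longlonglongrightarrow> g (0 + x)"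
        by (rule isCont_tendsto_compose[rotated]) (use g(1) in \<open>simp add: continuous_on_eq_continuous_at\<close>)
      then show "(\<lambda>n. a x * g (h n + x)) \<longlonglongrightarrow> a x * g x" by (auto intro: tendsto_intros)
    qed
  qed measurable
  from LIMSEQ_D[OF this, of "e / 4"]
  obtain n0 where n0: "\<And>n. n \<ge> n0 \<Longrightarrow> \<bar>(LINT x|lborel. a x * g (h n + x)) - (LINT x|lborel. a x * g x)\<bar> < e / 4"
    using e by auto
  have split: "(LINT x|lborel. a x * (b (s + x) - g (s + x))) = (LINT x|lborel. a x * b (s + x)) - (LINT x|lborel. a x * g (s + x))" for s
  proof -
    have "integrable lborel (\<lambda>x. a x * b (s + x))"
      by (rule integrable_mult_L2) (use a2 translate_sq[OF b2] in auto)
    then show ?thesis using ag[of s] by (simp add: right_diff_distrib)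
  qed
  show "\<exists>n0. \<forall>n\<ge>n0. \<bar>(LINT x|lborel. a x * b (h n + x)) - (LINT x|lborel. a x * b x)\<bar> < e"
  proof (intro exI allI impI)
    fix n assume "n \<ge> n0"
    from n0[OF this] near[of "h n"] near[of 0] split[of "h n"] split[of 0]
    show "\<bar>(LINT x|lborel. a x * b (h n + x)) - (LINT x|lborel. a x * b x)\<bar> < e"
      unfolding add_0_left by linarith
  qed
qed

text \<open>With \<open>k\<^sub>s(z) = s\<^sup>N k(s z)\<close>, the double integral of \<open>a(x) b(y) k\<^sub>s(x - y)\<close> tends to
  \<open>(\<integral> k) (\<integral> a b)\<close>.  After the substitution \<open>y = x - z/s\<close> it is an average over \<open>z\<close> of
  correlations of \<open>a\<close> with translates of \<open>b\<close>.\<close>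

lemma mollified_pairing_tendsto:
  fixes a b k :: "'a::euclidean_space \<Rightarrow> real"
  assumes a: "L2_cs a" and b: "L2_cs b" and k: "integrable lborel k"
  shows "(\<lambda>n. real (Suc n) ^ DIM('a) * (LINT x|lborel. LINT y|lborel. a x * b y * k (real (Suc n) *\<^sub>R (x - y))))
     \<longlonglongrightarrow> (LINT z|lborel. k z) * (LINT x|lborel. a x * b x)"
proof -
  have [measurable]: "a \<in> borel_measurable borel" "b \<in> borel_measurable borel" "k \<in> borel_measurable borel"
    and a2: "integrable lborel (\<lambda>x. (a x)\<^sup>2)" and b2: "integrable lborel (\<lambda>x. (b x)\<^sup>2)"
    using a b k unfolding L2_cs_def by auto
  define C where "C = (LINT x|lborel. (a x)\<^sup>2) + (LINT x|lborel. (b x)\<^sup>2)"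
  define h where "h n z = (- 1 / real (Suc n)) *\<^sub>R z" for n and z :: 'a
  have [measurable]: "h n \<in> borel_measurable borel" for n unfolding h_def by measurable
  have int: "integrable lborel (\<lambda>x. a x * b (s + x))" for s
    by (rule integrable_mult_L2) (use a2 translate_sq[OF b2] in auto)
  have bound: "(LINT x|lborel. \<bar>a x * b (s + x)\<bar>) \<le> C" for s
  proof -
    have "(LINT x|lborel. \<bar>a x * b (s + x)\<bar>) \<le> (LINT x|lborel. (a x)\<^sup>2 + (b (s + x))\<^sup>2)"
      by (rule integral_mono) (use int a2 translate_sq[OF b2] abs_mult_le_squares in auto)
    also have "\<dots> = C" unfolding C_def using a2 translate_sq[OF b2] by simp
    finally show ?thesis .
  qed
  have eq: "real (Suc n) ^ DIM('a) * (LINT x|lborel. LINT y|lborel. a x * b y * k (real (Suc n) *\<^sub>R (x - y)))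
      = (LINT z|lborel. k z * (LINT x|lborel. a x * b (h n z + x)))" for n
  proof -
    have F: "integrable (lborel \<Otimes>\<^sub>M lborel) (\<lambda>(z, x). k z * (a x * b (h n z + x)))"
    proof (rule lborel_pair.Fubini_integrable)
      have I: "(LINT x|lborel. norm (case (z, x) of (z, x) \<Rightarrow> k z * (a x * b (h n z + x)))) = \<bar>k z\<bar> * (LINT x|lborel. \<bar>a x * b (h n z + x)\<bar>)" for z
        by (simp add: abs_mult)
      show "integrable lborel (\<lambda>z. LINT x|lborel. norm (case (z, x) of (z, x) \<Rightarrow> k z * (a x * b (h n z + x))))"
        unfolding I
      proof (rule Bochner_Integration.integrable_bound[of _ "\<lambda>z. \<bar>k z\<bar> * C"])
        have "\<bar>k z\<bar> * (LINT x|lborel. \<bar>a x * b (h n z + x)\<bar>) \<le> \<bar>k z\<bar> * C" for z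
          by (intro mult_left_mono bound) simp
        moreover have "0 \<le> \<bar>k z\<bar> * (LINT x|lborel. \<bar>a x * b (h n z + x)\<bar>)" for z
          by simp
        ultimately show "AE z in lborel. norm (\<bar>k z\<bar> * (LINT x|lborel. \<bar>a x * b (h n z + x)\<bar>)) \<le> norm (\<bar>k z\<bar> * C)"
          by (intro AE_I2) (metis abs_of_nonneg order_trans real_norm_def)
      qed (use k in auto)
      show "AE z in lborel. integrable lborel (\<lambda>x. case (z, x) of (z, x) \<Rightarrow> k z * (a x * b (h n z + x)))"
        using int by auto
    qed measurable
    have "(LINT y|lborel. b y * k (real (Suc n) *\<^sub>R (x - y))) = (1 / real (Suc n)) ^ DIM('a) * (LINT z|lborel. b (h n z + x) * k z)" for x
    proof -
      have "real (Suc n) *\<^sub>R (x - (x + (- 1 / real (Suc n)) *\<^sub>R z)) = z" for z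
        by (simp del: of_nat_Suc)
      then show ?thesis
        by (subst lborel_integral_affine[where c="- 1 / real (Suc n)" and t=x]) (auto simp: h_def add.commute simp del: of_nat_Suc)
    qed
    then have "real (Suc n) ^ DIM('a) * (LINT y|lborel. a x * b y * k (real (Suc n) *\<^sub>R (x - y)))
        = (LINT z|lborel. k z * (a x * b (h n z + x)))" for x
      by (simp add: mult.assoc power_divide mult.left_commute[of _ "a x"] mult.commute[of "b _" "k _"] del: of_nat_Suc)
    then have "real (Suc n) ^ DIM('a) * (LINT x|lborel. LINT y|lborel. a x * b y * k (real (Suc n) *\<^sub>R (x - y)))
        = (LINT x|lborel. LINT z|lborel. k z * (a x * b (h n z + x)))"
      by (simp flip: integral_mult_right_zero del: of_nat_Suc)
    also have "\<dots> = (LINT z|lborel. LINT x|lborel. k z * (a x * b (h n z + x)))"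
      by (rule lborel_pair.Fubini_integral[OF F])
    also have "\<dots> = (LINT z|lborel. k z * (LINT x|lborel. a x * b (h n z + x)))" by simp
    finally show ?thesis .
  qed
  have "(\<lambda>n. LINT z|lborel. k z * (LINT x|lborel. a x * b (h n z + x)))
     \<longlonglongrightarrow> (LINT z|lborel. k z * (LINT x|lborel. a x * b x))"
  proof (rule integral_dominated_convergence[where w="\<lambda>z. \<bar>k z\<bar> * C"])
    show "AE z in lborel. (\<lambda>n. k z * (LINT x|lborel. a x * b (h n z + x))) \<longlonglongrightarrow> k z * (LINT x|lborel. a x * b x)"
    proof (rule AE_I2, intro tendsto_intros L2_translation_tendsto a b)
      fix z
      have "(\<lambda>n. 1 / real (Suc n)) \<longlonglongrightarrow> 0" using LIMSEQ_Suc[OF lim_1_over_n] by blast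
      from tendsto_minus[OF tendsto_scaleR[OF this tendsto_const[of z]]]
      show "(\<lambda>n. h n z) \<longlonglongrightarrow> 0" by (simp add: h_def del: of_nat_Suc)
    qed
    show "AE z in lborel. norm (k z * (LINT x|lborel. a x * b (h n z + x))) \<le> \<bar>k z\<bar> * C" for n
      using order_trans[OF integral_abs_bound bound] by (auto simp: abs_mult mult_left_mono)
  qed (use k in auto)
  then show ?thesis unfolding eq by simp
qed

section \<open>A product rule for weak derivatives\<close>

text \<open>Locally square integrable functions that are Borel, rather than Lebesgue, measurable.  Fubini's theorem
  needs these representatives because \<open>lborel\<close>, unlike its completion, is compatible with products.\<close>

definition L2_loc_borel :: "('a::euclidean_space \<Rightarrow> real) \<Rightarrow> bool" where
  "L2_loc_borel f \<longleftrightarrow> f \<in> borel_measurable borel \<and> (\<forall>R. integrable lborel (\<lambda>x. indicator (cball 0 R) x * (f x)\<^sup>2))"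

lemma test_fun_support:
  assumes "test_fun f" obtains R where "R > 0" "\<And>x. R < norm x \<Longrightarrow> f x = 0"
proof -
  obtain K where K: "compact K" "\<And>x. x \<notin> K \<Longrightarrow> f x = 0" using assms test_fun_iff by blast
  obtain R where "R > 0" "\<And>x. x \<in> K \<Longrightarrow> norm x \<le> R"
    using compact_imp_bounded[OF K(1)] unfolding bounded_pos by blast
  then show thesis using K(2) by (intro that[of R]) (auto simp: not_le[symmetric])
qed

lemma L2_cs_mult_bounded:
  assumes f: "L2_loc_borel f" and m [measurable]: "\<phi> \<in> borel_measurable borel"
    and C: "\<And>x. \<bar>\<phi> x\<bar> \<le> C" and R: "\<And>x. R < norm x \<Longrightarrow> \<phi> x = 0"
  shows "L2_cs (\<lambda>x. f x * \<phi> x)"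
proof -
  have [measurable]: "f \<in> borel_measurable borel" using f unfolding L2_loc_borel_def by blast
  have I: "integrable lborel (\<lambda>x. C\<^sup>2 * (indicator (cball 0 R) x * (f x)\<^sup>2))"
    using f unfolding L2_loc_borel_def by auto
  have "(f x * \<phi> x)\<^sup>2 \<le> C\<^sup>2 * (indicator (cball 0 R) x * (f x)\<^sup>2)" for x
  proof (cases "norm x \<le> R")
    case True
    have "\<bar>\<phi> x\<bar>\<^sup>2 \<le> C\<^sup>2" by (rule power_mono[OF C]) simp
    then show ?thesis using True by (simp add: power_mult_distrib mult.commute mult_right_mono)
  next
    case False then show ?thesis using R[of x] by simp
  qed
  then have "integrable lborel (\<lambda>x. (f x * \<phi> x)\<^sup>2)"
    by (intro Bochner_Integration.integrable_bound[OF I]) auto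
  then show ?thesis unfolding L2_cs_def using R by (auto intro!: exI[of _ R])
qed

lemma test_fun_borel:
  fixes \<psi> :: "real^'n \<Rightarrow> real"
  assumes "test_fun \<psi>" shows "\<psi> \<in> borel_measurable borel"
  using assms by (intro borel_measurable_continuous_onI test_fun_continuous)

lemma L2_cs_mult_test:
  assumes "L2_loc_borel f" "test_fun \<phi>" shows "L2_cs (\<lambda>x. f x * \<phi> x)"
proof -
  obtain C where C: "\<And>x. \<bar>\<phi> x\<bar> \<le> C" using test_fun_bounded[OF assms(2)] by (metis real_norm_def)
  obtain R where R: "\<And>x. R < norm x \<Longrightarrow> \<phi> x = 0" using test_fun_support[OF assms(2)] by blast
  show ?thesis by (rule L2_cs_mult_bounded[OF assms(1) test_fun_borel[OF assms(2)] C R])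
qed

lemma L2_cs_indicator:
  assumes "L2_loc_borel f" shows "L2_cs (\<lambda>x. f x * indicator (cball 0 R) x)"
  by (rule L2_cs_mult_bounded[OF assms, of _ 1 R]) (auto simp: indicator_def)

lemma L2_cs_add:
  assumes "L2_cs a" "L2_cs b" shows "L2_cs (\<lambda>x. a x + b x)"
proof -
  have [measurable]: "a \<in> borel_measurable borel" "b \<in> borel_measurable borel"
    and a2: "integrable lborel (\<lambda>x. (a x)\<^sup>2)" and b2: "integrable lborel (\<lambda>x. (b x)\<^sup>2)"
    using assms unfolding L2_cs_def by auto
  obtain R S where R: "\<And>x. x \<notin> cball 0 R \<Longrightarrow> a x = 0" and S: "\<And>x. x \<notin> cball 0 S \<Longrightarrow> b x = 0"
    using assms unfolding L2_cs_def by blast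
  have "integrable lborel (\<lambda>x. (a x)\<^sup>2 + (b x)\<^sup>2 + 2 * (a x * b x))"
    using a2 b2 integrable_mult_L2[OF _ _ a2 b2] by simp
  moreover have "(\<lambda>x. (a x)\<^sup>2 + (b x)\<^sup>2 + 2 * (a x * b x)) = (\<lambda>x. (a x + b x)\<^sup>2)"
    by (auto simp: power2_eq_square algebra_simps)
  ultimately have "integrable lborel (\<lambda>x. (a x + b x)\<^sup>2)" by simp
  moreover have "a x + b x = 0" if "x \<notin> cball 0 (max R S)" for x
    using that R[of x] S[of x] by auto
  ultimately show ?thesis unfolding L2_cs_def by (auto intro!: exI[of _ "max R S"])
qed

lemma L2_cs_sum: "(\<And>i. i \<in> I \<Longrightarrow> L2_cs (f i)) \<Longrightarrow> L2_cs (\<lambda>x. \<Sum>i\<in>I. f i x)"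
proof (induction I rule: infinite_finite_induct)
  case (insert i I)
  then show ?case using L2_cs_add[of "f i"] by simp
qed (simp_all add: L2_cs_def)

lemma L2_cs_mult_integrable:
  assumes a: "L2_cs a" and b: "L2_loc_borel b" shows "integrable lborel (\<lambda>x. a x * b x)"
proof -
  obtain R where R: "\<And>x. x \<notin> cball 0 R \<Longrightarrow> a x = 0" using a unfolding L2_cs_def by blast
  have "integrable lborel (\<lambda>x. a x * (b x * indicator (cball 0 R) x))"
    using a L2_cs_indicator[OF b, of R] unfolding L2_cs_def by (intro integrable_mult_L2) auto
  moreover have "(\<lambda>x. a x * (b x * indicator (cball 0 R) x)) = (\<lambda>x. a x * b x)"
    using R by (fastforce simp: indicator_def)
  ultimately show ?thesis by simp
qed

lemma integrable_pair_mult_bounded: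
  fixes a b :: "'a::euclidean_space \<Rightarrow> real"
  assumes a: "integrable lborel a" and b: "integrable lborel b"
    and k [measurable]: "case_prod k \<in> borel_measurable (borel \<Otimes>\<^sub>M borel)" and C: "\<And>x y. \<bar>k x y\<bar> \<le> C"
  shows "integrable (lborel \<Otimes>\<^sub>M lborel) (\<lambda>(x, y). a x * b y * k x y)"
proof -
  have [measurable]: "a \<in> borel_measurable borel" "b \<in> borel_measurable borel" using a b by auto
  have "integrable (lborel \<Otimes>\<^sub>M lborel) (\<lambda>(x, y). a x * b y)"
    by (rule lborel_pair.Fubini_integrable) (use a b in \<open>auto simp: abs_mult\<close>)
  then have I: "integrable (lborel \<Otimes>\<^sub>M lborel) (\<lambda>p. C * (case p of (x, y) \<Rightarrow> a x * b y))" by simp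
  show ?thesis
  proof (rule Bochner_Integration.integrable_bound[OF I])
    have "\<bar>a x * b y * k x y\<bar> \<le> \<bar>C * (a x * b y)\<bar>" for x y
    proof -
      have "\<bar>a x * b y\<bar> * \<bar>k x y\<bar> \<le> \<bar>a x * b y\<bar> * \<bar>C\<bar>"
        by (rule mult_left_mono) (use C[of x y] in auto)
      then show ?thesis by (simp add: abs_mult mult.commute)
    qed
    then show "AE p in lborel \<Otimes>\<^sub>M lborel. norm (case p of (x, y) \<Rightarrow> a x * b y * k x y) \<le> norm (C * (case p of (x, y) \<Rightarrow> a x * b y))"
      by auto
  qed measurable
qed

lemma integral_bump_pos: "(LINT x|lborel. bump (x::real^'n)) > 0"
proof -
  have [measurable]: "(bump :: real^'n \<Rightarrow> real) \<in> borel_measurable borel" by (rule test_fun_borel[OF test_fun_bump])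
  have "L2_loc_borel (\<lambda>x::real^'n. 1)" using integrable_indicator_cball[of "0::real^'n"] by (simp add: L2_loc_borel_def)
  from L2_cs_integrable[OF L2_cs_mult_test[OF this test_fun_bump]]
  have I: "integrable lborel (bump :: real^'n \<Rightarrow> real)" by simp
  have "(LINT x|lborel. bump (x::real^'n)) \<noteq> 0"
  proof
    assume "(LINT x|lborel. bump (x::real^'n)) = 0"
    then have "AE x in lborel. bump (x::real^'n) = 0"
      using integral_nonneg_eq_0_iff_AE[OF I] bump_nonneg by auto
    then have "AE x::real^'n in lborel. x \<notin> ball 0 1"
    proof eventually_elim
      case (elim x)
      have "\<not> norm x < 1"
      proof
        assume "norm x < 1"
        then have "norm x * norm x < 1 * 1" by (intro mult_strict_mono') auto
        then have "x \<bullet> x < 1" by (simp add: power2_norm_eq_inner[symmetric] power2_eq_square)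
        then show False using elim by (simp add: bump_def flat_def)
      qed
      then show ?case by simp
    qed
    then have "ball (0::real^'n) 1 \<in> null_sets lborel" by (simp add: AE_iff_null_sets)
    then have "negligible (ball (0::real^'n) 1)"
      by (simp add: negligible_iff_null_sets null_sets_completionI)
    then show False using open_not_negligible[of "ball (0::real^'n) 1"] by simp
  qed
  moreover have "(LINT x|lborel. bump (x::real^'n)) \<ge> 0" using bump_nonneg by (intro integral_nonneg_AE) auto
  ultimately show ?thesis by simp
qed

text \<open>If \<open>div F = h\<close> and \<open>\<nabla>g = G\<close> weakly, then \<open>div (g F) = h g + F \<bullet> G\<close> weakly.  The proof doubles
  the variables: the equation for \<open>F\<close> is tested in \<open>x\<close>, and the one for \<open>g\<close> in \<open>y\<close>, with
  \<open>\<psi>(x) \<eta>(s (x - y))\<close>, where \<open>\<eta>\<close> is the bump function.  The terms in which the derivative falls on \<open>\<eta>\<close> are exchanged by the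
  antisymmetry of \<open>\<eta>(s (x - y))\<close> under differentiation in \<open>x\<close> and \<open>y\<close>, and \<open>s \<rightarrow> \<infinity>\<close> recovers the
  diagonal.\<close>

lemma weak_divergence_product:
  fixes F G :: "'n \<Rightarrow> real^'n \<Rightarrow> real" and g h :: "real^'n \<Rightarrow> real"
  assumes F: "\<And>j. L2_loc_borel (F j)" and G: "\<And>j. L2_loc_borel (G j)" and g: "L2_loc_borel g" and h: "L2_loc_borel h"
    and divF: "\<And>\<psi>. test_fun \<psi> \<Longrightarrow> (LINT x|lborel. (\<Sum>j\<in>UNIV. F j x * partial j \<psi> x)) = - (LINT x|lborel. h x * \<psi> x)"
    and gradg: "\<And>j \<psi>. test_fun \<psi> \<Longrightarrow> (LINT x|lborel. g x * partial j \<psi> x) = - (LINT x|lborel. G j x * \<psi> x)"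
    and \<psi>: "test_fun \<psi>"
  shows "(LINT x|lborel. (\<Sum>j\<in>UNIV. F j x * g x * partial j \<psi> x)) =
    - (LINT x|lborel. (h x * g x + (\<Sum>j\<in>UNIV. F j x * G j x)) * \<psi> x)"
proof -
  note \<psi>' = test_fun_partial[OF \<psi>]
  have [measurable]: "F j \<in> borel_measurable borel" "G j \<in> borel_measurable borel" "g \<in> borel_measurable borel"
    "h \<in> borel_measurable borel" "\<psi> \<in> borel_measurable borel" "partial j \<psi> \<in> borel_measurable borel"
    "(bump :: real^'n \<Rightarrow> real) \<in> borel_measurable borel" "partial j (bump :: real^'n \<Rightarrow> real) \<in> borel_measurable borel" for j
    using F[of j] G[of j] g h test_fun_borel[OF \<psi>] test_fun_borel[OF \<psi>'] test_fun_borel[OF test_fun_bump] test_fun_borel[OF test_fun_partial[OF test_fun_bump]]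
    unfolding L2_loc_borel_def by auto
  define A where "A x = (\<Sum>j\<in>UNIV. F j x * partial j \<psi> x) + h x * \<psi> x" for x
  define B where "B j x = F j x * \<psi> x" for j x
  have A: "L2_cs A" unfolding A_def
    by (intro L2_cs_add L2_cs_sum L2_cs_mult_test F h \<psi> \<psi>')
  have B: "L2_cs (B j)" for j unfolding B_def by (intro L2_cs_mult_test F \<psi>)
  obtain R where R: "R > 0" "\<And>x. R < norm x \<Longrightarrow> \<psi> x = 0" using test_fun_support[OF \<psi>] by blast
  have R': "partial j \<psi> x = 0" if "R < norm x" for j x
    using partial_eq_0[of "cball 0 R" \<psi> x j] R that by auto
  have AR: "A x = 0" if "R < norm x" for x using that R R' by (simp add: A_def)
  have BR: "B j x = 0" if "R < norm x" for j x using that R by (simp add: B_def)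
  \<comment> \<open>Since \<open>\<psi>\<close> vanishes outside the ball of radius \<open>R\<close> and \<open>\<eta>(s z)\<close> outside the unit ball, only the values of \<open>g\<close>
      and \<open>G\<close> in the ball of radius \<open>R + 1\<close> matter.\<close>
  define gt where "gt x = g x * indicator (cball 0 (R + 1)) x" for x
  define Gt where "Gt j x = G j x * indicator (cball 0 (R + 1)) x" for j x
  have gt: "L2_cs gt" unfolding gt_def by (rule L2_cs_indicator[OF g])
  have Gt: "L2_cs (Gt j)" for j unfolding Gt_def by (rule L2_cs_indicator[OF G])
  note [measurable] = L2_cs_integrable[OF gt, THEN borel_measurable_integrable, simplified]
    L2_cs_integrable[OF Gt, THEN borel_measurable_integrable, simplified]
    L2_cs_integrable[OF A, THEN borel_measurable_integrable, simplified]
    L2_cs_integrable[OF B, THEN borel_measurable_integrable, simplified]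
  define c where "c = (LINT x|lborel. bump (x::real^'n))"
  have vanish: "k (real (Suc n) *\<^sub>R (x - y)) = 0"
    if "norm x \<le> R" "\<not> norm y \<le> R + 1" "\<And>z. 1 < norm z \<Longrightarrow> k z = (0::real)" for n x y and k :: "real^'n \<Rightarrow> real"
  proof -
    have "1 < norm (x - y)" using norm_triangle_ineq2[of y x] that by (simp add: norm_minus_commute)
    also have "\<dots> \<le> real (Suc n) * norm (x - y)" by (simp add: algebra_simps)
    finally show ?thesis using that(3) by simp
  qed
  have dbump_out: "partial j bump z = 0" if "1 < norm z" for j and z :: "real^'n"
    by (rule partial_outside[OF bump_eq_0 that])
  obtain C0 where C0: "\<And>z::real^'n. \<bar>bump z\<bar> \<le> C0" using test_fun_bounded[OF test_fun_bump] by (metis real_norm_def)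
  have Cj: "\<exists>C. \<forall>z::real^'n. \<bar>partial j bump z\<bar> \<le> C" for j
    using test_fun_bounded[OF test_fun_partial[OF test_fun_bump]] by (metis real_norm_def)
  have fub: "integrable (lborel \<Otimes>\<^sub>M lborel) (\<lambda>(x, y). a x * b y * k (s *\<^sub>R (x - y)))"
    if *: "L2_cs a" "L2_cs b" "k \<in> borel_measurable borel" "\<exists>C. \<forall>z. \<bar>k z\<bar> \<le> C" for a b k :: "real^'n \<Rightarrow> real" and s :: real
  proof -
    obtain C where C: "\<And>z. \<bar>k z\<bar> \<le> C" using * by blast
    have [measurable]: "k \<in> borel_measurable borel" by fact
    show ?thesis
      by (rule integrable_pair_mult_bounded[OF L2_cs_integrable L2_cs_integrable, OF *(1,2), where k="\<lambda>x y. k (s *\<^sub>R (x - y))", OF _ C])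
        measurable
  qed
  \<comment> \<open>The doubled identity, before passing to the limit.\<close>
  have zero: "(LINT x|lborel. LINT y|lborel. A x * gt y * bump (real (Suc n) *\<^sub>R (x - y)))
     + (\<Sum>j\<in>UNIV. LINT x|lborel. LINT y|lborel. B j x * Gt j y * bump (real (Suc n) *\<^sub>R (x - y))) = 0" for n
  proof -
    define s where "s = real (Suc n)"
    have s: "s > 0" by (simp add: s_def)
    have eq1: "(LINT x|lborel. A x * bump (s *\<^sub>R (x - y))) + (\<Sum>j\<in>UNIV. s * (LINT x|lborel. B j x * partial j bump (s *\<^sub>R (x - y)))) = 0" for y
    proof -
      define \<theta> where "\<theta> x = bump (s *\<^sub>R x + (- s) *\<^sub>R y)" for x
      have \<theta>_eq: "\<theta> x = bump (s *\<^sub>R (x - y))" for x by (simp add: \<theta>_def algebra_simps)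
      have \<theta>: "test_fun \<theta>" unfolding \<theta>_def using s by (intro test_fun_affine[OF test_fun_bump]) auto
      have d\<theta>: "partial j \<theta> x = s * partial j bump (s *\<^sub>R (x - y))" for j x
        unfolding \<theta>_def using partial_affine[OF test_fun_differentiable[OF test_fun_bump], where c=s and x=x and a="(-s) *\<^sub>R y" and i=j]
        by (simp add: algebra_simps)
      have T: "test_fun (\<lambda>x. \<psi> x * \<theta> x)" by (rule test_fun_mult_smooth[OF test_fun_smooth[OF \<psi>] \<theta>])
      have d: "partial j (\<lambda>x. \<psi> x * \<theta> x) x = \<psi> x * (s * partial j bump (s *\<^sub>R (x - y))) + partial j \<psi> x * bump (s *\<^sub>R (x - y))" for j x
        using partial_mult[OF test_fun_differentiable[OF \<psi>] test_fun_differentiable[OF \<theta>]] by (simp add: \<theta>_eq d\<theta>)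
      have I1: "integrable lborel (\<lambda>x. F j x * partial j (\<lambda>x. \<psi> x * \<theta> x) x)" for j
        by (intro L2_cs_integrable L2_cs_mult_test F test_fun_partial T)
      have I2: "integrable lborel (\<lambda>x. h x * (\<psi> x * \<theta> x))"
        by (intro L2_cs_integrable L2_cs_mult_test h T)
      have Imul: "integrable lborel (\<lambda>x. a x * k (s *\<^sub>R (x - y)))"
        if *: "L2_cs a" "k \<in> borel_measurable borel" "\<exists>C. \<forall>z. \<bar>k z\<bar> \<le> C" for a k :: "real^'n \<Rightarrow> real"
      proof -
        obtain C where C: "\<And>z. \<bar>k z\<bar> \<le> C" using * by blast
        have [measurable]: "k \<in> borel_measurable borel" by fact
        note Ia = L2_cs_integrable[OF *(1)]
        have [measurable]: "a \<in> borel_measurable borel" using Ia by auto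
        have "integrable lborel (\<lambda>x. C * a x)" using Ia by simp
        then show ?thesis
        proof (rule Bochner_Integration.integrable_bound)
          have "\<bar>a x\<bar> * \<bar>k z\<bar> \<le> \<bar>a x\<bar> * \<bar>C\<bar>" for x z
            by (rule mult_left_mono) (use C[of z] in auto)
          then show "AE x in lborel. norm (a x * k (s *\<^sub>R (x - y))) \<le> norm (C * a x)"
            by (simp add: abs_mult mult.commute)
        qed measurable
      qed
      have "0 = (LINT x|lborel. (\<Sum>j\<in>UNIV. F j x * partial j (\<lambda>x. \<psi> x * \<theta> x) x)) + (LINT x|lborel. h x * (\<psi> x * \<theta> x))"
        using divF[OF T] by simp
      also have "\<dots> = (LINT x|lborel. (\<Sum>j\<in>UNIV. F j x * partial j (\<lambda>x. \<psi> x * \<theta> x) x) + h x * (\<psi> x * \<theta> x))"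
        using I1 I2 by simp
      also have "\<dots> = (LINT x|lborel. A x * bump (s *\<^sub>R (x - y)) + (\<Sum>j\<in>UNIV. s * (B j x * partial j bump (s *\<^sub>R (x - y)))))"
        unfolding d unfolding \<theta>_eq A_def B_def
        by (intro Bochner_Integration.integral_cong refl)
          (simp add: algebra_simps sum.distrib sum_distrib_left)
      also have "\<dots> = (LINT x|lborel. A x * bump (s *\<^sub>R (x - y))) + (\<Sum>j\<in>UNIV. s * (LINT x|lborel. B j x * partial j bump (s *\<^sub>R (x - y))))"
        using Imul[OF A, of bump] Imul[OF B, of "partial _ bump"] C0 Cj by (subst Bochner_Integration.integral_add) (auto)
      finally show ?thesis by simp
    qed
    have eq2: "s * (LINT y|lborel. g y * partial j bump (s *\<^sub>R (x - y))) = (LINT y|lborel. G j y * bump (s *\<^sub>R (x - y)))" for x j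
    proof -
      define \<theta> where "\<theta> y = bump ((- s) *\<^sub>R y + s *\<^sub>R x)" for y
      have \<theta>_eq: "\<theta> y = bump (s *\<^sub>R (x - y))" for y by (simp add: \<theta>_def algebra_simps)
      have \<theta>: "test_fun \<theta>" unfolding \<theta>_def using s by (intro test_fun_affine[OF test_fun_bump]) auto
      have d\<theta>: "partial j \<theta> y = - s * partial j bump (s *\<^sub>R (x - y))" for j y
        unfolding \<theta>_def using partial_affine[OF test_fun_differentiable[OF test_fun_bump], where c="-s" and x=y and a="s *\<^sub>R x" and i=j]
        by (simp add: algebra_simps)
      have "(LINT y|lborel. - s * (g y * partial j bump (s *\<^sub>R (x - y)))) = - (LINT y|lborel. G j y * bump (s *\<^sub>R (x - y)))"
        using gradg[OF \<theta>, of j] by (simp add: d\<theta> \<theta>_eq mult_ac)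
      then show ?thesis by simp
    qed
    have eq3: "s * (LINT y|lborel. B j x * gt y * partial j bump (s *\<^sub>R (x - y))) = (LINT y|lborel. B j x * Gt j y * bump (s *\<^sub>R (x - y)))" for x j
    proof (cases "norm x \<le> R")
      case True
      have 1: "gt y * partial j bump (s *\<^sub>R (x - y)) = g y * partial j bump (s *\<^sub>R (x - y))" for y
        using vanish[OF True, of y "partial j bump" n] dbump_out by (auto simp: gt_def s_def indicator_def)
      have 2: "Gt j y * bump (s *\<^sub>R (x - y)) = G j y * bump (s *\<^sub>R (x - y))" for y
        using vanish[OF True, of y "bump" n] bump_eq_0 by (auto simp: Gt_def s_def indicator_def)
      show ?thesis using eq2[of j x] unfolding mult.assoc 1 2 by (simp add: mult.left_commute[of s])
    next
      case False
      then show ?thesis using BR[of x j] by simp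
    qed
    have "0 = (LINT y|lborel. gt y * ((LINT x|lborel. A x * bump (s *\<^sub>R (x - y))) + (\<Sum>j\<in>UNIV. s * (LINT x|lborel. B j x * partial j bump (s *\<^sub>R (x - y))))))"
      by (simp add: eq1)
    also have "\<dots> = (LINT y|lborel. (LINT x|lborel. A x * gt y * bump (s *\<^sub>R (x - y))) + (\<Sum>j\<in>UNIV. s * (LINT x|lborel. B j x * gt y * partial j bump (s *\<^sub>R (x - y)))))"
      by (simp add: distrib_left sum_distrib_left mult_ac flip: integral_mult_right_zero)
    also have "\<dots> = (LINT y|lborel. (LINT x|lborel. A x * gt y * bump (s *\<^sub>R (x - y)))) + (\<Sum>j\<in>UNIV. s * (LINT y|lborel. (LINT x|lborel. B j x * gt y * partial j bump (s *\<^sub>R (x - y)))))"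
    proof -
      have "integrable lborel (\<lambda>y. LINT x|lborel. A x * gt y * bump (s *\<^sub>R (x - y)))"
        by (rule lborel_pair.integrable_snd[OF fub[OF A gt]]) (use C0 in auto)
      moreover have "integrable lborel (\<lambda>y. LINT x|lborel. B j x * gt y * partial j bump (s *\<^sub>R (x - y)))" for j
        by (rule lborel_pair.integrable_snd[OF fub[OF B gt]]) (use Cj in auto)
      ultimately show ?thesis by simp
    qed
    also have "(LINT y|lborel. (LINT x|lborel. A x * gt y * bump (s *\<^sub>R (x - y)))) = (LINT x|lborel. LINT y|lborel. A x * gt y * bump (s *\<^sub>R (x - y)))"
      by (rule lborel_pair.Fubini_integral[OF fub[OF A gt]]) (use C0 in auto)
    also have "(\<Sum>j\<in>UNIV. s * (LINT y|lborel. (LINT x|lborel. B j x * gt y * partial j bump (s *\<^sub>R (x - y)))))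
       = (\<Sum>j\<in>UNIV. s * (LINT x|lborel. LINT y|lborel. B j x * gt y * partial j bump (s *\<^sub>R (x - y))))"
      by (intro sum.cong refl arg_cong[where f="\<lambda>t. s * t"] lborel_pair.Fubini_integral[OF fub[OF B gt]]) (use Cj in auto)
    also have "\<dots> = (\<Sum>j\<in>UNIV. LINT x|lborel. LINT y|lborel. B j x * Gt j y * bump (s *\<^sub>R (x - y)))"
      by (intro sum.cong refl) (subst integral_mult_right_zero[symmetric], simp only: eq3)
    finally show ?thesis by (simp add: s_def)
  qed
  have Ib: "integrable lborel (bump :: real^'n \<Rightarrow> real)"
    using integral_bump_pos[where 'n='n] not_integrable_integral_eq[of lborel "bump :: real^'n \<Rightarrow> real"]
    by (cases "integrable lborel (bump :: real^'n \<Rightarrow> real)") simp_all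
  have "(\<lambda>n. real (Suc n) ^ DIM(real^'n) * (LINT x|lborel. LINT y|lborel. A x * gt y * bump (real (Suc n) *\<^sub>R (x - y)))
     + (\<Sum>j\<in>UNIV. real (Suc n) ^ DIM(real^'n) * (LINT x|lborel. LINT y|lborel. B j x * Gt j y * bump (real (Suc n) *\<^sub>R (x - y)))))
     \<longlonglongrightarrow> c * (LINT x|lborel. A x * gt x) + (\<Sum>j\<in>UNIV. c * (LINT x|lborel. B j x * Gt j x))"
    unfolding c_def by (intro tendsto_intros mollified_pairing_tendsto A B gt Gt Ib)
  moreover have "real (Suc n) ^ DIM(real^'n) * (LINT x|lborel. LINT y|lborel. A x * gt y * bump (real (Suc n) *\<^sub>R (x - y)))
     + (\<Sum>j\<in>UNIV. real (Suc n) ^ DIM(real^'n) * (LINT x|lborel. LINT y|lborel. B j x * Gt j y * bump (real (Suc n) *\<^sub>R (x - y)))) = 0" for n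
    unfolding sum_distrib_left[symmetric] distrib_left[symmetric] zero by simp
  ultimately have "(\<lambda>n::nat. 0) \<longlonglongrightarrow> c * (LINT x|lborel. A x * gt x) + (\<Sum>j\<in>UNIV. c * (LINT x|lborel. B j x * Gt j x))"
    by simp
  then have "c * (LINT x|lborel. A x * gt x) + (\<Sum>j\<in>UNIV. c * (LINT x|lborel. B j x * Gt j x)) = 0"
    by (rule LIMSEQ_unique[OF _ tendsto_const])
  then have "c * ((LINT x|lborel. A x * gt x) + (\<Sum>j\<in>UNIV. LINT x|lborel. B j x * Gt j x)) = 0"
    by (simp add: distrib_left sum_distrib_left)
  then have z: "(LINT x|lborel. A x * gt x) + (\<Sum>j\<in>UNIV. LINT x|lborel. B j x * Gt j x) = 0"
    using integral_bump_pos[where 'n='n] by (simp add: c_def)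
  have "(\<lambda>x. A x * gt x) = (\<lambda>x. A x * g x)" "(\<lambda>x. B j x * Gt j x) = (\<lambda>x. B j x * G j x)" for j
    using AR BR R(1) by (fastforce simp: gt_def Gt_def indicator_def)+
  with z have "(LINT x|lborel. A x * g x) + (\<Sum>j\<in>UNIV. LINT x|lborel. B j x * G j x) = 0" by simp
  then have "(LINT x|lborel. A x * g x + (\<Sum>j\<in>UNIV. B j x * G j x)) = 0"
    using L2_cs_mult_integrable[OF A g] L2_cs_mult_integrable[OF B G] by simp
  also have "(LINT x|lborel. A x * g x + (\<Sum>j\<in>UNIV. B j x * G j x))
     = (LINT x|lborel. (\<Sum>j\<in>UNIV. F j x * g x * partial j \<psi> x) + (h x * g x + (\<Sum>j\<in>UNIV. F j x * G j x)) * \<psi> x)"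
    by (intro Bochner_Integration.integral_cong refl)
      (simp add: A_def B_def algebra_simps sum_distrib_left sum_distrib_right)
  also have "\<dots> = (LINT x|lborel. (\<Sum>j\<in>UNIV. F j x * g x * partial j \<psi> x)) + (LINT x|lborel. (h x * g x + (\<Sum>j\<in>UNIV. F j x * G j x)) * \<psi> x)"
  proof (rule Bochner_Integration.integral_add)
    have "integrable lborel (\<lambda>x. (F j x * partial j \<psi> x) * g x)" for j
      by (intro L2_cs_mult_integrable L2_cs_mult_test F \<psi>' g)
    then show "integrable lborel (\<lambda>x. \<Sum>j\<in>UNIV. F j x * g x * partial j \<psi> x)" by (simp add: mult_ac)
    have "integrable lborel (\<lambda>x. (h x * \<psi> x) * g x)" "integrable lborel (\<lambda>x. (F j x * \<psi> x) * G j x)" for j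
      by (intro L2_cs_mult_integrable L2_cs_mult_test F \<psi> g h G)+
    then show "integrable lborel (\<lambda>x. (h x * g x + (\<Sum>j\<in>UNIV. F j x * G j x)) * \<psi> x)"
      by (simp add: distrib_right distrib_left sum_distrib_right sum_distrib_left mult_ac)
  qed
  finally show ?thesis by simp
qed

section \<open>Weak solutions of the Poisson equation\<close>

lemma lebesgue_integral_representative:
  fixes f f' :: "'a::euclidean_space \<Rightarrow> real"
  assumes "f \<in> borel_measurable lebesgue" "f' \<in> borel_measurable borel" "AE x in lborel. f x = f' x"
  shows "(LINT x|lebesgue. f x) = (LINT x|lborel. f' x)" "integrable lebesgue f \<longleftrightarrow> integrable lborel f'"
proof -
  have m: "f' \<in> borel_measurable lebesgue" "f' \<in> borel_measurable lborel" using assms(2) by (auto intro: measurable_completion)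
  have ae: "AE x in lebesgue. f x = f' x" using AE_completion[OF assms(3)] .
  show "(LINT x|lebesgue. f x) = (LINT x|lborel. f' x)"
    using integral_cong_AE[OF assms(1) m(1) ae] integral_completion[OF m(2)] by simp
  show "integrable lebesgue f \<longleftrightarrow> integrable lborel f'"
    using integrable_cong_AE[OF assms(1) m(1) ae] integrable_completion[OF m(2)] by simp
qed

lemma L2_loc_representative:
  fixes f :: "'a::euclidean_space \<Rightarrow> real"
  assumes f: "L2_loc f"
  shows "\<exists>f'. L2_loc_borel f' \<and> (AE x in lborel. f x = f' x)"
proof -
  have fm: "f \<in> borel_measurable lebesgue" using f unfolding L2_loc_def by blast
  then obtain f' where f': "f' \<in> borel_measurable lborel" "AE x in lborel. f x = f' x"
    using completion_ex_borel_measurable_real by blast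
  have f'm: "f' \<in> borel_measurable borel" using f'(1) by simp
  have "integrable lborel (\<lambda>x. indicator (cball 0 R) x * (f' x)\<^sup>2)" for R
  proof -
    have "integrable lebesgue (\<lambda>x. indicator (cball 0 R) x * (f x)\<^sup>2)"
      using f unfolding L2_loc_def set_integrable_def by (auto dest: spec[of _ "cball 0 R"])
    moreover have "(\<lambda>x. indicat_real (cball 0 R) x * (f x)\<^sup>2) \<in> borel_measurable lebesgue"
      by (intro borel_measurable_times borel_measurable_indicator borel_measurable_power fm) simp
    moreover have "AE x in lborel. indicat_real (cball 0 R) x * (f x)\<^sup>2 = indicator (cball 0 R) x * (f' x)\<^sup>2"
      using f'(2) by eventually_elim simp
    moreover have "(\<lambda>x. indicat_real (cball 0 R) x * (f' x)\<^sup>2) \<in> borel_measurable borel"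
      by (intro borel_measurable_times borel_measurable_indicator borel_measurable_power f'm) simp
    ultimately show ?thesis
      using lebesgue_integral_representative(2) by blast
  qed
  then show ?thesis using f' unfolding L2_loc_borel_def by auto
qed

lemma test_fun_lebesgue:
  fixes \<psi> :: "real^'n \<Rightarrow> real"
  assumes "test_fun \<psi>" shows "\<psi> \<in> borel_measurable lebesgue"
  using test_fun_borel[OF assms] by (auto intro: measurable_completion)

lemma L1_loc_mult_test:
  fixes f \<psi> :: "real^'n \<Rightarrow> real"
  assumes f: "L1_loc_on UNIV f" and \<psi>: "test_fun \<psi>"
  shows "integrable lebesgue (\<lambda>x. f x * \<psi> x)"
proof -
  obtain C where C: "C > 0" "\<And>x. \<bar>\<psi> x\<bar> \<le> C" using test_fun_bounded[OF \<psi>] by (metis real_norm_def)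
  obtain R where R: "\<And>x. R < norm x \<Longrightarrow> \<psi> x = 0" using test_fun_support[OF \<psi>] by blast
  have I: "integrable lebesgue (\<lambda>x. indicator (cball 0 R) x * f x)"
    using f unfolding L1_loc_on_def set_integrable_def by (auto dest: spec[of _ "cball 0 R"])
  have eq: "f x * \<psi> x = (indicator (cball 0 R) x * f x) * \<psi> x" for x
    using R[of x] by (cases "norm x \<le> R") auto
  have I2: "integrable lebesgue (\<lambda>x. C * (indicator (cball 0 R) x * f x))" using I by simp
  show ?thesis unfolding eq
  proof (rule Bochner_Integration.integrable_bound[OF I2])
    show "(\<lambda>x. indicator (cball 0 R) x * f x * \<psi> x) \<in> borel_measurable lebesgue"
      using borel_measurable_integrable[OF I] test_fun_lebesgue[OF \<psi>] by (rule borel_measurable_times)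
    have *: "\<bar>a * \<psi> x\<bar> \<le> \<bar>C * a\<bar>" for a x
      using mult_left_mono[OF C(2)[of x] abs_ge_zero[of a]] C(1) by (simp add: abs_mult mult.commute)
    show "AE x in lebesgue. norm (indicator (cball 0 R) x * f x * \<psi> x) \<le> norm (C * (indicator (cball 0 R) x * f x))"
      unfolding real_norm_def by (intro AE_I2 *)
  qed
qed

lemma L2_loc_mult:
  assumes f: "L2_loc f" and g: "L2_loc (g :: 'a::euclidean_space \<Rightarrow> real)"
  shows "L1_loc_on UNIV (\<lambda>x. f x * g x)"
  unfolding L1_loc_on_def
proof (intro allI impI, elim conjE)
  fix K :: "'a set" assume K: "compact K"
  have Km: "K \<in> sets lebesgue" using K by (simp add: compact_imp_closed)
  have I: "integrable lebesgue (\<lambda>x. indicator K x * (f x)\<^sup>2 + indicator K x * (g x)\<^sup>2)"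
    using f g K unfolding L2_loc_def set_integrable_def by auto
  have m: "f \<in> borel_measurable lebesgue" "g \<in> borel_measurable lebesgue" using f g unfolding L2_loc_def by auto
  show "set_integrable lebesgue K (\<lambda>x. f x * g x)" unfolding set_integrable_def
  proof (rule Bochner_Integration.integrable_bound[OF I])
    show "(\<lambda>x. indicat_real K x *\<^sub>R (f x * g x)) \<in> borel_measurable lebesgue"
      using m Km by auto
    show "AE x in lebesgue. norm (indicator K x *\<^sub>R (f x * g x)) \<le> norm (indicator K x * (f x)\<^sup>2 + indicator K x * (g x)\<^sup>2)"
      using abs_mult_le_squares[of "f _" "g _"] by (auto simp: indicator_def)
  qed
qed

lemma L2_loc_one: "L2_loc (\<lambda>x::'a::euclidean_space. 1::real)"
  unfolding L2_loc_def set_integrable_def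
proof (intro conjI allI impI)
  fix K :: "'a set" assume "compact K"
  then have "integrable lebesgue (indicator K :: 'a \<Rightarrow> real)"
    using lmeasurable_compact by (simp add: integrable_indicator_iff fmeasurable_def)
  then show "integrable lebesgue (\<lambda>x. indicat_real K x *\<^sub>R (norm (1::real))\<^sup>2)" by simp
qed simp

lemma L2_loc_imp_L1_loc:
  fixes f :: "'a::euclidean_space \<Rightarrow> real"
  assumes f: "L2_loc f" shows "L1_loc_on UNIV f"
  using L2_loc_mult[OF f L2_loc_one] by simp

lemma L2_loc_mult_test:
  fixes f :: "real^'n \<Rightarrow> real"
  shows "L2_loc f \<Longrightarrow> test_fun \<psi> \<Longrightarrow> integrable lebesgue (\<lambda>x. f x * \<psi> x)"
  by (intro L1_loc_mult_test L2_loc_imp_L1_loc)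

lemma weak_divergence_product_lebesgue:
  fixes F G :: "'n \<Rightarrow> real^'n \<Rightarrow> real" and g h :: "real^'n \<Rightarrow> real"
  assumes F: "\<And>j. L2_loc (F j)" and G: "\<And>j. L2_loc (G j)" and g: "L2_loc g" and h: "L2_loc h"
    and divF: "\<And>\<psi>. test_fun \<psi> \<Longrightarrow> (LINT x|lebesgue. (\<Sum>j\<in>UNIV. F j x * partial j \<psi> x)) = - (LINT x|lebesgue. h x * \<psi> x)"
    and gradg: "\<And>j. has_weak_partial j g (G j)"
    and \<psi>: "test_fun \<psi>"
  shows "(LINT x|lebesgue. (\<Sum>j\<in>UNIV. F j x * g x * partial j \<psi> x)) =
    - (LINT x|lebesgue. (h x * g x + (\<Sum>j\<in>UNIV. F j x * G j x)) * \<psi> x)"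
proof -
  obtain F' where F': "\<And>j. L2_loc_borel (F' j)" "\<And>j. AE x in lborel. F j x = F' j x"
    using L2_loc_representative[OF F] by metis
  obtain G' where G': "\<And>j. L2_loc_borel (G' j)" "\<And>j. AE x in lborel. G j x = G' j x"
    using L2_loc_representative[OF G] by metis
  obtain g' where g': "L2_loc_borel g'" "AE x in lborel. g x = g' x" using L2_loc_representative[OF g] by blast
  obtain h' where h': "L2_loc_borel h'" "AE x in lborel. h x = h' x" using L2_loc_representative[OF h] by blast
  have m: "F j \<in> borel_measurable lebesgue" "G j \<in> borel_measurable lebesgue" "g \<in> borel_measurable lebesgue"
      "h \<in> borel_measurable lebesgue" for j
    using F[of j] G[of j] g h unfolding L2_loc_def by auto
  have m': "F' j \<in> borel_measurable borel" "G' j \<in> borel_measurable borel" "g' \<in> borel_measurable borel"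
      "h' \<in> borel_measurable borel" for j
    using F'(1)[of j] G'(1)[of j] g'(1) h'(1) unfolding L2_loc_borel_def by auto
  have FA: "AE x in lborel. \<forall>j\<in>UNIV. F j x = F' j x" "AE x in lborel. \<forall>j\<in>UNIV. G j x = G' j x"
    by (intro AE_finite_allI finite F'(2) G'(2))+
  have 1: "(LINT x|lborel. (\<Sum>j\<in>UNIV. F' j x * partial j \<psi> x)) = - (LINT x|lborel. h' x * \<psi> x)" if \<psi>: "test_fun \<psi>" for \<psi>
  proof -
    have "(LINT x|lebesgue. (\<Sum>j\<in>UNIV. F j x * partial j \<psi> x)) = (LINT x|lborel. (\<Sum>j\<in>UNIV. F' j x * partial j \<psi> x))"
      using \<psi> by (intro lebesgue_integral_representative borel_measurable_sum borel_measurable_times m m'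
          test_fun_lebesgue test_fun_borel test_fun_partial eventually_mono[OF FA(1)]) auto
    moreover have "(LINT x|lebesgue. h x * \<psi> x) = (LINT x|lborel. h' x * \<psi> x)"
      using \<psi> by (intro lebesgue_integral_representative borel_measurable_times m m' test_fun_lebesgue test_fun_borel eventually_mono[OF h'(2)]) auto
    ultimately show ?thesis using divF[OF \<psi>] by simp
  qed
  have 2: "(LINT x|lborel. g' x * partial j \<psi> x) = - (LINT x|lborel. G' j x * \<psi> x)" if \<psi>: "test_fun \<psi>" for \<psi> j
  proof -
    have "(LINT x|lebesgue. g x * partial j \<psi> x) = (LINT x|lborel. g' x * partial j \<psi> x)"
      using \<psi> by (intro lebesgue_integral_representative borel_measurable_times m m' test_fun_lebesgue test_fun_borel test_fun_partial eventually_mono[OF g'(2)]) auto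
    moreover have "(LINT x|lebesgue. G j x * \<psi> x) = (LINT x|lborel. G' j x * \<psi> x)"
      using \<psi> by (intro lebesgue_integral_representative borel_measurable_times m m' test_fun_lebesgue test_fun_borel eventually_mono[OF G'(2)]) auto
    ultimately show ?thesis using gradg[of j] \<psi> unfolding has_weak_partial_def by simp
  qed
  note meas = borel_measurable_sum borel_measurable_times borel_measurable_add m m' test_fun_lebesgue[OF \<psi>]
    test_fun_borel[OF \<psi>] test_fun_lebesgue[OF test_fun_partial[OF \<psi>]] test_fun_borel[OF test_fun_partial[OF \<psi>]]
  have "(LINT x|lebesgue. (\<Sum>j\<in>UNIV. F j x * g x * partial j \<psi> x)) = (LINT x|lborel. (\<Sum>j\<in>UNIV. F' j x * g' x * partial j \<psi> x))"
  proof (rule lebesgue_integral_representative)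
    show "AE x in lborel. (\<Sum>j\<in>UNIV. F j x * g x * partial j \<psi> x) = (\<Sum>j\<in>UNIV. F' j x * g' x * partial j \<psi> x)"
      using FA(1) g'(2) by eventually_elim simp
  qed (intro meas)+
  moreover have "(LINT x|lebesgue. (h x * g x + (\<Sum>j\<in>UNIV. F j x * G j x)) * \<psi> x)
      = (LINT x|lborel. (h' x * g' x + (\<Sum>j\<in>UNIV. F' j x * G' j x)) * \<psi> x)"
  proof (rule lebesgue_integral_representative)
    show "AE x in lborel. (h x * g x + (\<Sum>j\<in>UNIV. F j x * G j x)) * \<psi> x = (h' x * g' x + (\<Sum>j\<in>UNIV. F' j x * G' j x)) * \<psi> x"
      using FA g'(2) h'(2) by eventually_elim simp
  qed (intro meas)+
  ultimately show ?thesis using weak_divergence_product[OF F'(1) G'(1) g'(1) h'(1) 1 2 \<psi>] by simp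
qed

lemma L2_loc_zero: "L2_loc (\<lambda>x. 0::real)" by (simp add: L2_loc_def set_integrable_def)

lemma weak_partial_square:
  fixes G :: "'n \<Rightarrow> real^'n \<Rightarrow> real"
  assumes g: "L2_loc g" and G: "\<And>j. L2_loc (G j)" and gG: "\<And>j. has_weak_partial j g (G j)" and \<phi>: "test_fun \<phi>"
  shows "(LINT x|lebesgue. g x * g x * partial i \<phi> x) = - (2 * (LINT x|lebesgue. g x * G i x * \<phi> x))"
proof -
  have "(LINT x|lebesgue. (\<Sum>l\<in>UNIV. (if l = i then g x else 0) * g x * partial l \<phi> x)) =
    - (LINT x|lebesgue. (G i x * g x + (\<Sum>l\<in>UNIV. (if l = i then g x else 0) * G l x)) * \<phi> x)"
  proof (rule weak_divergence_product_lebesgue[where G=G])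
    show "L2_loc (\<lambda>x. if l = i then g x else 0)" for l using g L2_loc_zero by (cases "l = i") auto
    fix \<psi> :: "real^'n \<Rightarrow> real" assume "test_fun \<psi>"
    then show "(LINT x|lebesgue. (\<Sum>l\<in>UNIV. (if l = i then g x else 0) * partial l \<psi> x)) = - (LINT x|lebesgue. G i x * \<psi> x)"
      using gG[of i] unfolding has_weak_partial_def by (simp add: if_distrib[of "\<lambda>c. c * _"] cong: if_cong)
  qed (use g G gG \<phi> in auto)
  moreover have "(\<Sum>l\<in>UNIV. (if l = i then g x else 0) * g x * partial l \<phi> x) = g x * g x * partial i \<phi> x"
    "(\<Sum>l\<in>UNIV. (if l = i then g x else 0) * G l x) = g x * G i x" for x
    by (subst sum.remove[of _ i]; simp)+
  moreover have "(G i x * g x + g x * G i x) * \<phi> x = 2 * (g x * G i x * \<phi> x)" for x by simp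
  ultimately show ?thesis by (simp add: mult.assoc)
qed

text \<open>A weak derivative \<open>H = \<partial>\<^sub>j\<partial>\<^sub>i f\<close> is also a weak derivative \<open>\<partial>\<^sub>i\<partial>\<^sub>j f\<close>.  This form of the symmetry of
  second derivatives avoids the almost everywhere uniqueness of weak derivatives.\<close>

lemma has_weak_partial_swap:
  assumes i: "has_weak_partial i f u" and j: "has_weak_partial j f w" and ji: "has_weak_partial j u H"
  shows "has_weak_partial i w H"
  unfolding has_weak_partial_def
proof (intro conjI allI impI)
  show "L1_loc_on UNIV w" "L1_loc_on UNIV H" using j ji unfolding has_weak_partial_def by auto
  fix \<psi> :: "real^'a \<Rightarrow> real" assume \<psi>: "test_fun \<psi>"
  have "(LINT x|lebesgue. w x * partial i \<psi> x) = - (LINT x|lebesgue. f x * partial j (partial i \<psi>) x)"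
    using j test_fun_partial[OF \<psi>] unfolding has_weak_partial_def by simp
  also have "\<dots> = - (LINT x|lebesgue. f x * partial i (partial j \<psi>) x)"
    by (simp add: partial_commute[OF test_fun_smooth[OF \<psi>], of i j])
  also have "\<dots> = (LINT x|lebesgue. u x * partial j \<psi> x)"
    using i test_fun_partial[OF \<psi>] unfolding has_weak_partial_def by simp
  also have "\<dots> = - (LINT x|lebesgue. H x * \<psi> x)"
    using ji \<psi> unfolding has_weak_partial_def by simp
  finally show "(LINT x|lebesgue. w x * partial i \<psi> x) = - (LINT x|lebesgue. H x * \<psi> x)" .
qed

lemma has_weak_partial_weak_partial: "weakly_differentiable i f \<Longrightarrow> has_weak_partial i f (weak_partial i f)"
  unfolding weakly_differentiable_def weak_partial_def by (rule someI_ex[of "has_weak_partial i f"])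

lemma W2_loc_2_derivatives:
  assumes "W2_loc 2 \<Phi>"
  shows "has_weak_partial i \<Phi> (weak_partial i \<Phi>)" "L2_loc (weak_partial i \<Phi>)"
    "has_weak_partial j (weak_partial i \<Phi>) (weak_partial j (weak_partial i \<Phi>))"
    "has_weak_partial i (weak_partial j \<Phi>) (weak_partial j (weak_partial i \<Phi>))"
    "L2_loc (weak_partial j (weak_partial i \<Phi>))"
proof -
  have w: "weakly_differentiable i \<Phi>" "L2_loc (weak_partial i \<Phi>)" "weakly_differentiable j (weak_partial i \<Phi>)"
    "L2_loc (weak_partial j (weak_partial i \<Phi>))" for i j
    using assms by (auto simp: numeral_2_eq_2)
  show "has_weak_partial i \<Phi> (weak_partial i \<Phi>)" "L2_loc (weak_partial i \<Phi>)"
    "has_weak_partial j (weak_partial i \<Phi>) (weak_partial j (weak_partial i \<Phi>))"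
    "L2_loc (weak_partial j (weak_partial i \<Phi>))" using w has_weak_partial_weak_partial by blast+
  then show "has_weak_partial i (weak_partial j \<Phi>) (weak_partial j (weak_partial i \<Phi>))"
    using has_weak_partial_swap has_weak_partial_weak_partial[OF w(1)] by blast
qed

lemma integral_sum_L2_loc_test:
  fixes F :: "'n \<Rightarrow> real^'n \<Rightarrow> real"
  assumes "\<And>j. L2_loc (F j)" "\<And>j. test_fun (\<psi> j)"
  shows "(LINT x|lebesgue. (\<Sum>j\<in>UNIV. F j x * \<psi> j x)) = (\<Sum>j\<in>UNIV. LINT x|lebesgue. F j x * \<psi> j x)"
  using L2_loc_mult_test[OF assms] by simp

lemma weak_grad_divergence:
  fixes \<Phi> \<rho> :: "real^'n \<Rightarrow> real"
  assumes W: "W2_loc 2 \<Phi>" and lap: "AE x in lebesgue. weak_laplacian \<Phi> x = \<rho> x" and \<rho>: "L2_loc \<rho>" and \<psi>: "test_fun \<psi>"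
  shows "(LINT x|lebesgue. (\<Sum>j\<in>UNIV. weak_partial j \<Phi> x * partial j \<psi> x)) = - (LINT x|lebesgue. \<rho> x * \<psi> x)"
proof -
  note w = W2_loc_2_derivatives[OF W]
  have m: "\<rho> \<in> borel_measurable lebesgue" "weak_partial j (weak_partial i \<Phi>) \<in> borel_measurable lebesgue" for i j
    using \<rho> w(5)[of j i] unfolding L2_loc_def by auto
  note [measurable] = m test_fun_lebesgue[OF \<psi>]
  have "(LINT x|lebesgue. (\<Sum>j\<in>UNIV. weak_partial j \<Phi> x * partial j \<psi> x)) = (\<Sum>j\<in>UNIV. LINT x|lebesgue. weak_partial j \<Phi> x * partial j \<psi> x)"
    by (rule integral_sum_L2_loc_test) (use w \<psi> test_fun_partial in auto)
  also have "\<dots> = (\<Sum>j\<in>UNIV. - (LINT x|lebesgue. weak_partial j (weak_partial j \<Phi>) x * \<psi> x))"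
    using w(3) \<psi> unfolding has_weak_partial_def by (intro sum.cong) auto
  also have "\<dots> = - (LINT x|lebesgue. (\<Sum>j\<in>UNIV. weak_partial j (weak_partial j \<Phi>) x * \<psi> x))"
    by (subst integral_sum_L2_loc_test) (use w \<psi> in \<open>auto simp: sum_negf\<close>)
  also have "(LINT x|lebesgue. (\<Sum>j\<in>UNIV. weak_partial j (weak_partial j \<Phi>) x * \<psi> x)) = (LINT x|lebesgue. \<rho> x * \<psi> x)"
    by (rule integral_cong_AE) (measurable, use lap in \<open>auto elim!: AE_mp simp: weak_laplacian_def sum_distrib_right[symmetric]\<close>)
  finally show ?thesis .
qed

text \<open>The force density \<open>\<rho> \<nabla>\<Phi>\<close> as the divergence of a stress tensor.  With \<open>u = \<nabla>\<Phi>\<close>, the product rule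
  gives \<open>div (u\<^sub>i u) = \<rho> u\<^sub>i + u \<bullet> \<nabla>u\<^sub>i\<close>, and \<open>u \<bullet> \<nabla>u\<^sub>i = u \<bullet> \<partial>\<^sub>iu = \<partial>\<^sub>i(|u|\<^sup>2/2)\<close>.\<close>

lemma poisson_stress:
  fixes \<Phi> \<rho> :: "real^'n \<Rightarrow> real"
  assumes W: "W2_loc 2 \<Phi>" and lap: "AE x in lebesgue. weak_laplacian \<Phi> x = \<rho> x" and \<rho>: "L2_loc \<rho>" and \<phi>: "test_fun \<phi>"
  shows "(LINT x|lebesgue. \<rho> x * weak_partial i \<Phi> x * \<phi> x) =
    (LINT x|lebesgue. (norm (weak_grad \<Phi> x))\<^sup>2 / 2 * partial i \<phi> x
       - (\<Sum>j\<in>UNIV. weak_partial i \<Phi> x * weak_partial j \<Phi> x * partial j \<phi> x))"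
proof -
  define u where "u j = weak_partial j \<Phi>" for j
  define U where "U i j = weak_partial j (weak_partial i \<Phi>)" for i j
  have u: "L2_loc (u j)" and U: "L2_loc (U i j)" and uU: "has_weak_partial j (u i) (U i j)" "has_weak_partial i (u j) (U i j)" for i j
    using W2_loc_2_derivatives[OF W] unfolding u_def U_def by auto
  note \<phi>' = test_fun_partial[OF \<phi>]
  have A: "(LINT x|lebesgue. (\<Sum>j\<in>UNIV. u j x * u i x * partial j \<phi> x)) =
    - (LINT x|lebesgue. (\<rho> x * u i x + (\<Sum>j\<in>UNIV. u j x * U i j x)) * \<phi> x)"
    by (rule weak_divergence_product_lebesgue[OF u U u \<rho> weak_grad_divergence[OF W lap \<rho>, folded u_def] uU(1) \<phi>])
  have B: "(LINT x|lebesgue. u j x * u j x * partial i \<phi> x) = - (2 * (LINT x|lebesgue. u j x * U i j x * \<phi> x))" for j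
    by (rule weak_partial_square[of "u j" "\<lambda>l. U l j"]) (use u U uU \<phi> in auto)
  have I1: "integrable lebesgue (\<lambda>x. u j x * u l x * partial m \<phi> x)" for j l m
    by (intro L1_loc_mult_test L2_loc_mult u \<phi>')
  have I2: "integrable lebesgue (\<lambda>x. \<rho> x * u i x * \<phi> x)" by (intro L1_loc_mult_test L2_loc_mult u \<phi> \<rho>)
  have I3: "integrable lebesgue (\<lambda>x. u j x * U i j x * \<phi> x)" for j by (intro L1_loc_mult_test L2_loc_mult u U \<phi>)
  have n: "(norm (weak_grad \<Phi> x))\<^sup>2 = (\<Sum>j\<in>UNIV. u j x * u j x)" for x
    by (simp add: power2_norm_eq_inner inner_vec_def weak_grad_def u_def)
  have "(LINT x|lebesgue. (norm (weak_grad \<Phi> x))\<^sup>2 / 2 * partial i \<phi> x - (\<Sum>j\<in>UNIV. u i x * u j x * partial j \<phi> x))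
    = (LINT x|lebesgue. (\<Sum>j\<in>UNIV. (u j x * u j x * partial i \<phi> x) / 2) - (\<Sum>j\<in>UNIV. u j x * u i x * partial j \<phi> x))"
    by (intro Bochner_Integration.integral_cong refl)
      (simp add: n sum_distrib_right sum_distrib_left sum_divide_distrib mult_ac)
  also have "\<dots> = (\<Sum>j\<in>UNIV. (LINT x|lebesgue. u j x * u j x * partial i \<phi> x) / 2) - (LINT x|lebesgue. (\<Sum>j\<in>UNIV. u j x * u i x * partial j \<phi> x))"
    using I1 by simp
  also have "\<dots> = - (\<Sum>j\<in>UNIV. LINT x|lebesgue. u j x * U i j x * \<phi> x) + (LINT x|lebesgue. (\<rho> x * u i x + (\<Sum>j\<in>UNIV. u j x * U i j x)) * \<phi> x)"
    unfolding A B by (simp add: sum_negf)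
  also have "\<dots> = (LINT x|lebesgue. \<rho> x * u i x * \<phi> x)"
    using I2 I3 by (simp add: distrib_right sum_distrib_right)
  finally show ?thesis by (simp add: u_def)
qed

section \<open>Local integrability\<close>

lemma L1_loc_measurable:
  fixes f :: "'a::euclidean_space \<Rightarrow> real"
  assumes "L1_loc_on UNIV f" shows "f \<in> borel_measurable lebesgue"
proof (rule borel_measurable_LIMSEQ_real)
  show "(\<lambda>x. indicator (cball 0 (real n)) x * f x) \<in> borel_measurable lebesgue" for n
    using assms unfolding L1_loc_on_def set_integrable_def by (auto dest!: spec[of _ "cball 0 (real n)"])
  fix x :: 'a
  obtain n where n: "norm x \<le> real n" by (meson real_arch_simple)
  show "(\<lambda>n. indicator (cball 0 (real n)) x * f x) \<longlonglongrightarrow> f x"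
    by (rule tendsto_eventually, rule eventually_sequentiallyI[of n]) (use n in \<open>auto simp: indicator_def\<close>)
qed

lemma L1_loc_sum:
  assumes "\<And>i. i \<in> I \<Longrightarrow> L1_loc_on S (f i)" shows "L1_loc_on S (\<lambda>x. \<Sum>i\<in>I. f i x)"
  using assms unfolding L1_loc_on_def set_integrable_def by (auto simp: sum_distrib_left)

lemma Linf_loc_mult:
  assumes \<rho>: "Linf_loc \<rho>" and f: "L1_loc_on UNIV f"
  shows "L1_loc_on UNIV (\<lambda>x. \<rho> x * f x)"
  unfolding L1_loc_on_def
proof (intro allI impI, elim conjE)
  fix K :: "'a set" assume K: "compact K"
  obtain C where C: "AE x in lebesgue. x \<in> K \<longrightarrow> \<bar>\<rho> x\<bar> \<le> C" using \<rho> K unfolding Linf_loc_def by blast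
  have I: "integrable lebesgue (\<lambda>x. C * (indicator K x *\<^sub>R f x))"
    using f K unfolding L1_loc_on_def set_integrable_def by auto
  show "set_integrable lebesgue K (\<lambda>x. \<rho> x * f x)" unfolding set_integrable_def
  proof (rule Bochner_Integration.integrable_bound[OF I])
    show "(\<lambda>x. indicat_real K x *\<^sub>R (\<rho> x * f x)) \<in> borel_measurable lebesgue"
      using \<rho> L1_loc_measurable[OF f] K unfolding Linf_loc_def
      by (auto intro!: borel_measurable_times borel_measurable_indicator simp: compact_imp_closed)
    show "AE x in lebesgue. norm (indicat_real K x *\<^sub>R (\<rho> x * f x)) \<le> norm (C * indicat_real K x *\<^sub>R f x)"
      using C
    proof eventually_elim
      case (elim x)
      show ?case
      proof (cases "x \<in> K")
        case True
        then have "\<bar>\<rho> x\<bar> * \<bar>f x\<bar> \<le> \<bar>C\<bar> * \<bar>f x\<bar>" using elim by (intro mult_right_mono) auto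
        then show ?thesis using True by (simp add: abs_mult)
      qed simp
    qed
  qed
qed

lemma Linf_loc_imp_L2_loc:
  assumes \<rho>: "Linf_loc \<rho>" shows "L2_loc \<rho>"
proof -
  have "L1_loc_on UNIV (\<lambda>x::'a. 1::real)"
    using L2_loc_mult[of "\<lambda>x::'a. 1::real" "\<lambda>x::'a. 1::real"] L2_loc_one by simp
  from Linf_loc_mult[OF \<rho> Linf_loc_mult[OF \<rho> this]]
  show ?thesis using \<rho> unfolding L2_loc_def Linf_loc_def L1_loc_on_def by (simp add: power2_eq_square)
qed

lemma L2_loc_component:
  fixes v :: "real^'m \<Rightarrow> real^'n"
  assumes "L2_loc v" shows "L2_loc (\<lambda>x. v x $ i)"
proof -
  have vm: "v \<in> borel_measurable lebesgue" using assms unfolding L2_loc_def by blast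
  have m: "(\<lambda>x. v x $ i) \<in> borel_measurable lebesgue"
    using measurable_compose[OF vm, of "\<lambda>y. y $ i" borel] by (simp add: borel_measurable_continuous_onI continuous_intros)
  show ?thesis unfolding L2_loc_def
  proof (intro conjI allI impI m)
    fix K :: "(real^'m) set" assume K: "compact K"
    have I: "integrable lebesgue (\<lambda>x. indicator K x *\<^sub>R (norm (v x))\<^sup>2)"
      using assms K unfolding L2_loc_def set_integrable_def by auto
    have *: "(v x $ i)\<^sup>2 \<le> (norm (v x))\<^sup>2" for x
      using power_mono[OF component_le_norm_cart[of "v x" i] abs_ge_zero, of 2] by simp
    show "set_integrable lebesgue K (\<lambda>x. (norm (v x $ i))\<^sup>2)" unfolding set_integrable_def
    proof (rule Bochner_Integration.integrable_bound[OF I])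
      show "(\<lambda>x. indicat_real K x *\<^sub>R (norm (v x $ i))\<^sup>2) \<in> borel_measurable lebesgue"
        using m K by (auto intro!: borel_measurable_times borel_measurable_indicator borel_measurable_power simp: compact_imp_closed)
    qed (use * in \<open>auto simp: indicator_def\<close>)
  qed
qed

section \<open>Gradient test fields\<close>

lemma grad_eq_sum: "grad \<psi> = (\<lambda>x. \<Sum>j\<in>UNIV. partial j \<psi> x *\<^sub>R axis j 1)"
  by (rule ext, simp add: grad_def vec_eq_iff axis_def if_distrib cong: if_cong)

lemma grad_nth [simp]: "grad \<psi> x $ j = partial j \<psi> x" by (simp add: grad_def)

lemma test_fun_grad: "test_fun \<psi> \<Longrightarrow> test_fun (grad \<psi>)"
  unfolding grad_eq_sum
  by (intro test_fun_sum test_fun_linear_image[OF bounded_linear_scaleR_left] test_fun_partial)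

lemma partial_nth:
  fixes f :: "real^'n \<Rightarrow> real^'m"
  assumes "f differentiable (at x)"
  shows "partial i f x $ j = partial i (\<lambda>x. f x $ j) x"
  using partial_bounded_linear[OF bounded_linear_vec_nth assms] by simp

lemma partial_grad: "test_fun \<psi> \<Longrightarrow> partial i (grad \<psi>) x $ j = partial i (partial j \<psi>) x"
  using partial_nth[OF test_fun_differentiable[OF test_fun_grad], of \<psi> i x j] by simp

lemma divergence_grad: "test_fun \<psi> \<Longrightarrow> divergence (grad \<psi>) = laplacian \<psi>"
  by (simp add: divergence_def laplacian_def partial_grad fun_eq_iff)

lemma partial_sum:
  "(\<And>j. j \<in> J \<Longrightarrow> test_fun (f j)) \<Longrightarrow> partial i (\<lambda>x. \<Sum>j\<in>J. f j x) x = (\<Sum>j\<in>J. partial i (f j) x)"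
  by (induction J rule: infinite_finite_induct)
    (auto simp: partial_add test_fun_differentiable test_fun_sum)

lemma test_fun_laplacian: "test_fun \<psi> \<Longrightarrow> test_fun (laplacian \<psi>)"
  unfolding laplacian_def[abs_def] by (intro test_fun_sum test_fun_partial)

lemma partial_laplacian:
  assumes "test_fun \<psi>"
  shows "partial j (laplacian \<psi>) x = (\<Sum>i\<in>UNIV. partial j (partial i (partial i \<psi>)) x)"
  unfolding laplacian_def[abs_def] by (rule partial_sum) (intro test_fun_partial assms)

lemma laplacian_grad:
  fixes \<psi> :: "real^'n \<Rightarrow> real"
  assumes \<psi>: "test_fun \<psi>"
  shows "laplacian (grad \<psi>) x = grad (laplacian \<psi>) x"
proof -
  note sm = test_fun_smooth[OF \<psi>]
  have pg: "partial i (grad \<psi>) = grad (partial i \<psi>)" for i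
    by (rule ext) (simp add: vec_eq_iff partial_grad[OF \<psi>] partial_commute[OF sm, of i])
  have "laplacian (grad \<psi>) x $ j = grad (laplacian \<psi>) x $ j" for j
  proof -
    have "laplacian (grad \<psi>) x $ j = (\<Sum>i\<in>UNIV. partial i (partial j (partial i \<psi>)) x)"
      by (simp add: laplacian_def pg partial_grad[OF test_fun_partial[OF \<psi>]])
    also have "\<dots> = (\<Sum>i\<in>UNIV. partial j (partial i (partial i \<psi>)) x)"
      using partial_commute[OF smooth_partial[OF sm]] by metis
    also have "\<dots> = grad (laplacian \<psi>) x $ j" by (simp add: partial_laplacian[OF \<psi>])
    finally show ?thesis .
  qed
  then show ?thesis by (simp add: vec_eq_iff)
qed

section \<open>The stress identity\<close>

text \<open>The contraction \<open>T : H\<close> of the matrix \<open>H\<close> with the total stress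
  \<open>T = \<rho> v \<otimes> v + p I + k (|u|\<^sup>2/2 I - u \<otimes> u)\<close>, \<open>u = \<nabla>\<Phi>\<close>, at the point \<open>x\<close>.\<close>

definition stress ::
  "real \<Rightarrow> (real \<Rightarrow> real) \<Rightarrow> (real^'n \<Rightarrow> real) \<Rightarrow> (real^'n \<Rightarrow> real^'n) \<Rightarrow> (real^'n \<Rightarrow> real) \<Rightarrow>
   real^'n \<Rightarrow> ('n \<Rightarrow> 'n \<Rightarrow> real) \<Rightarrow> real" where
  "stress k p \<rho> v \<Phi> x H =
     \<rho> x * (\<Sum>i\<in>UNIV. \<Sum>j\<in>UNIV. v x $ i * v x $ j * H i j) + p (\<rho> x) * (\<Sum>i\<in>UNIV. H i i)
     + k * ((norm (weak_grad \<Phi> x))\<^sup>2 / 2 * (\<Sum>i\<in>UNIV. H i i)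
            - (\<Sum>i\<in>UNIV. \<Sum>j\<in>UNIV. weak_partial i \<Phi> x * weak_partial j \<Phi> x * H i j))"

lemma norm_weak_grad_sq: "(norm (weak_grad \<Phi> x))\<^sup>2 = (\<Sum>j\<in>UNIV. weak_partial j \<Phi> x * weak_partial j \<Phi> x)"
  by (simp add: power2_norm_eq_inner inner_vec_def weak_grad_def)

context
  fixes k \<mu> lam p \<rho> v \<Phi>
  assumes sol: "stationary_weak_solution k \<mu> lam p \<rho> v (\<Phi> :: real^'n \<Rightarrow> real)"
begin

lemma sol_L2:
  "L2_loc (\<lambda>x. v x $ i)" "L2_loc \<rho>" "L2_loc (weak_partial i \<Phi>)" "L1_loc_on UNIV (\<lambda>x. p (\<rho> x))"
  "L1_loc_on UNIV (\<lambda>x. \<rho> x * (v x $ i * v x $ j))"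
  "L1_loc_on UNIV (\<lambda>x. weak_partial i \<Phi> x * weak_partial j \<Phi> x)"
  "L1_loc_on UNIV (\<lambda>x. (norm (weak_grad \<Phi> x))\<^sup>2)"
proof -
  have s: "Linf_loc \<rho>" "L2_loc v" "W2_loc 2 \<Phi>" "L1_loc_on UNIV (\<lambda>x. p (\<rho> x))"
    using sol unfolding stationary_weak_solution_def by auto
  show "L1_loc_on UNIV (\<lambda>x. p (\<rho> x))" by fact
  show v: "L2_loc (\<lambda>x. v x $ i)" for i by (rule L2_loc_component[OF s(2)])
  show "L2_loc \<rho>" by (rule Linf_loc_imp_L2_loc[OF s(1)])
  show u: "L2_loc (weak_partial i \<Phi>)" for i by (rule W2_loc_2_derivatives(2)[OF s(3)])
  show "L1_loc_on UNIV (\<lambda>x. \<rho> x * (v x $ i * v x $ j))" by (intro Linf_loc_mult s L2_loc_mult v)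
  show "L1_loc_on UNIV (\<lambda>x. weak_partial i \<Phi> x * weak_partial j \<Phi> x)" for i j by (intro L2_loc_mult u)
  then show "L1_loc_on UNIV (\<lambda>x. (norm (weak_grad \<Phi> x))\<^sup>2)" unfolding norm_weak_grad_sq by (intro L1_loc_sum)
qed

lemma stress_identity:
  assumes \<psi>: "test_fun \<psi>"
  shows "(LINT x|lebesgue. stress k p \<rho> v \<Phi> x (\<lambda>i j. partial i (partial j \<psi>) x))
      = - ((2 * \<mu> + lam) * (LINT x|lebesgue. v x \<bullet> grad (laplacian \<psi>) x))" (is ?eq)
    and "integrable lebesgue (\<lambda>x. stress k p \<rho> v \<Phi> x (\<lambda>i j. partial i (partial j \<psi>) x))" (is ?int)
proof -
  define u where "u i = weak_partial i \<Phi>" for i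
  define n2 where "n2 x = (norm (weak_grad \<Phi> x))\<^sup>2" for x
  define P where "P i j = partial i (partial j \<psi>)" for i j
  have P: "test_fun (P i j)" for i j unfolding P_def by (intro test_fun_partial \<psi>)
  have W: "W2_loc 2 \<Phi>" and lap: "AE x in lebesgue. weak_laplacian \<Phi> x = \<rho> x"
    using sol unfolding stationary_weak_solution_def by auto
  have I1: "integrable lebesgue (\<lambda>x. \<rho> x * (v x $ i * v x $ j) * P i j x)"
    and I2: "integrable lebesgue (\<lambda>x. p (\<rho> x) * P i i x)"
    and I3: "integrable lebesgue (\<lambda>x. n2 x * P i i x)"
    and I4: "integrable lebesgue (\<lambda>x. u i x * u j x * P i j x)"
    and I5: "integrable lebesgue (\<lambda>x. \<rho> x * u i x * partial i \<psi> x)" for i j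
    unfolding u_def n2_def
    by (intro L1_loc_mult_test sol_L2 P L2_loc_mult test_fun_partial[OF \<psi>])+
  have T: "(\<lambda>x. \<rho> x * tensor_contract (v x) (grad \<psi>) x) = (\<lambda>x. \<Sum>i\<in>UNIV. \<Sum>j\<in>UNIV. \<rho> x * (v x $ i * v x $ j) * P i j x)"
    by (simp add: tensor_contract_def partial_grad[OF \<psi>] P_def sum_distrib_left mult_ac)
  have D: "(\<lambda>x. p (\<rho> x) * divergence (grad \<psi>) x) = (\<lambda>x. \<Sum>i\<in>UNIV. p (\<rho> x) * P i i x)"
    by (simp add: divergence_def partial_grad[OF \<psi>] P_def sum_distrib_left)
  have IT: "integrable lebesgue (\<lambda>x. \<rho> x * tensor_contract (v x) (grad \<psi>) x)" unfolding T using I1 by simp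
  have ID: "integrable lebesgue (\<lambda>x. p (\<rho> x) * divergence (grad \<psi>) x)" unfolding D using I2 by simp
  define g where "g x = n2 x / 2 * (\<Sum>i\<in>UNIV. P i i x) - (\<Sum>i\<in>UNIV. \<Sum>j\<in>UNIV. u i x * u j x * P i j x)" for x
  have g: "g = (\<lambda>x. \<Sum>i\<in>UNIV. (n2 x * P i i x) / 2 - (\<Sum>j\<in>UNIV. u i x * u j x * P i j x))"
    by (auto simp: g_def sum_distrib_left sum_divide_distrib sum_subtractf mult_ac)
  have Ig: "integrable lebesgue g" unfolding g using I3 I4 by simp
  have F: "(LINT x|lebesgue. \<rho> x * (weak_grad \<Phi> x \<bullet> grad \<psi> x)) = (LINT x|lebesgue. g x)"
  proof -
    have "(LINT x|lebesgue. \<rho> x * (weak_grad \<Phi> x \<bullet> grad \<psi> x)) = (LINT x|lebesgue. (\<Sum>i\<in>UNIV. \<rho> x * u i x * partial i \<psi> x))"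
      by (simp add: inner_vec_def weak_grad_def u_def sum_distrib_left mult_ac)
    also have "\<dots> = (\<Sum>i\<in>UNIV. LINT x|lebesgue. \<rho> x * u i x * partial i \<psi> x)" using I5 by simp
    also have "\<dots> = (\<Sum>i\<in>UNIV. LINT x|lebesgue. n2 x / 2 * partial i (partial i \<psi>) x - (\<Sum>j\<in>UNIV. u i x * u j x * partial j (partial i \<psi>) x))"
      unfolding u_def n2_def by (intro sum.cong refl poisson_stress W lap sol_L2(2) test_fun_partial \<psi>)
    also have "\<dots> = (\<Sum>i\<in>UNIV. LINT x|lebesgue. (n2 x * P i i x) / 2 - (\<Sum>j\<in>UNIV. u i x * u j x * P i j x))"
      by (simp add: P_def partial_commute[OF test_fun_smooth[OF \<psi>]] cong: sum.cong)
    also have "\<dots> = (LINT x|lebesgue. g x)" unfolding g using I3 I4 by simp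
    finally show ?thesis .
  qed
  have S: "stress k p \<rho> v \<Phi> x (\<lambda>i j. partial i (partial j \<psi>) x)
     = \<rho> x * tensor_contract (v x) (grad \<psi>) x + p (\<rho> x) * divergence (grad \<psi>) x + k * g x" for x
    by (simp add: stress_def tensor_contract_def divergence_def partial_grad[OF \<psi>] g_def P_def u_def n2_def)
  show ?int unfolding S using IT ID Ig by simp
  have "(LINT x|lebesgue. \<rho> x * tensor_contract (v x) (grad \<psi>) x) =
          - (LINT x|lebesgue. p (\<rho> x) * divergence (grad \<psi>) x)
          - k * (LINT x|lebesgue. \<rho> x * (weak_grad \<Phi> x \<bullet> grad \<psi> x))
          - \<mu> * (LINT x|lebesgue. v x \<bullet> laplacian (grad \<psi>) x)
          - (\<mu> + lam) * (LINT x|lebesgue. v x \<bullet> grad (divergence (grad \<psi>)) x)"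
    using sol test_fun_grad[OF \<psi>] unfolding stationary_weak_solution_def by blast
  then show ?eq unfolding S using IT ID Ig F
    by (simp add: laplacian_grad[OF \<psi>] divergence_grad[OF \<psi>] algebra_simps)
qed

lemma energy_measurable: "energy k p \<rho> v \<Phi> \<in> borel_measurable lebesgue"
proof -
  have v: "(norm (v x))\<^sup>2 = (\<Sum>i\<in>UNIV. v x $ i * v x $ i)" for x by (simp add: power2_norm_eq_inner inner_vec_def)
  have "(\<lambda>x. \<rho> x * (norm (v x))\<^sup>2) = (\<lambda>x. \<Sum>i\<in>UNIV. \<rho> x * (v x $ i * v x $ i))" by (simp add: v sum_distrib_left)
  then have "(\<lambda>x. \<rho> x * (norm (v x))\<^sup>2) \<in> borel_measurable lebesgue"
    using L1_loc_measurable[OF sol_L2(5)] by simp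
  then show ?thesis unfolding energy_def[abs_def]
    by (intro borel_measurable_add[OF borel_measurable_add[OF _ L1_loc_measurable[OF sol_L2(4)]]
          borel_measurable_times[OF borel_measurable_const L1_loc_measurable[OF sol_L2(7)]]])
qed

lemma sol_nonneg: "AE x in lebesgue. \<rho> x \<ge> 0 \<and> p (\<rho> x) \<ge> 0 \<and> (p (\<rho> x) = 0 \<longrightarrow> \<rho> x = 0)"
proof -
  have "AE x in lebesgue. \<rho> x \<ge> 0" "AE x in lebesgue. p (\<rho> x) \<ge> 0 \<and> (p (\<rho> x) = 0 \<longrightarrow> \<rho> x = 0)"
    using sol unfolding stationary_weak_solution_def by auto
  then show ?thesis by eventually_elim auto
qed

lemma energy_nonneg: "k \<ge> 0 \<Longrightarrow> AE x in lebesgue. energy k p \<rho> v \<Phi> x \<ge> 0"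
  using sol_nonneg by eventually_elim (auto simp: energy_def)

end

lemma abs_quadratic_form_le:
  fixes a :: "real^'n"
  assumes "\<And>i j. \<bar>H i j\<bar> \<le> M"
  shows "\<bar>\<Sum>i\<in>UNIV. \<Sum>j\<in>UNIV. a $ i * a $ j * H i j\<bar> \<le> (real CARD('n))\<^sup>2 * M * (norm a)\<^sup>2"
proof -
  have "\<bar>\<Sum>i\<in>UNIV. \<Sum>j\<in>UNIV. a $ i * a $ j * H i j\<bar> \<le> (\<Sum>i\<in>(UNIV::'n set). \<Sum>j\<in>(UNIV::'n set). M * (norm a)\<^sup>2)"
  proof (intro order_trans[OF sum_abs] sum_mono)
    fix i j
    have "\<bar>a $ i\<bar> * \<bar>a $ j\<bar> * \<bar>H i j\<bar> \<le> norm a * norm a * M"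
      by (intro mult_mono component_le_norm_cart assms mult_nonneg_nonneg) auto
    then show "\<bar>a $ i * a $ j * H i j\<bar> \<le> M * (norm a)\<^sup>2" by (simp add: abs_mult power2_eq_square mult_ac)
  qed
  then show ?thesis by (simp add: power2_eq_square mult_ac)
qed

lemma abs_stress_le:
  assumes "\<rho> x \<ge> 0" "p (\<rho> x) \<ge> 0" "k \<ge> 0" and H: "\<And>i j. \<bar>H i j\<bar> \<le> M"
  shows "\<bar>stress k p \<rho> v (\<Phi> :: real^'n \<Rightarrow> real) x H\<bar> \<le> 2 * (real CARD('n))\<^sup>2 * M * energy k p \<rho> v \<Phi> x"
proof -
  define N where "N = (real CARD('n))\<^sup>2"
  have M: "M \<ge> 0" using H[of undefined undefined] by linarith
  have tr: "\<bar>\<Sum>i\<in>UNIV. H i i\<bar> \<le> N * M"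
  proof -
    have "\<bar>\<Sum>i\<in>UNIV. H i i\<bar> \<le> (\<Sum>i\<in>(UNIV::'n set). M)" by (intro order_trans[OF sum_abs] sum_mono H)
    also have "\<dots> = real CARD('n) * M" by simp
    also have "\<dots> \<le> N * M" unfolding N_def using M
      by (intro mult_right_mono) (auto simp: power2_eq_square Suc_le_eq)
    finally show ?thesis .
  qed
  let ?V = "\<Sum>i\<in>UNIV. \<Sum>j\<in>UNIV. v x $ i * v x $ j * H i j"
  let ?U = "\<Sum>i\<in>UNIV. \<Sum>j\<in>UNIV. weak_partial i \<Phi> x * weak_partial j \<Phi> x * H i j"
  let ?u = "(norm (weak_grad \<Phi> x))\<^sup>2"
  have V: "\<bar>?V\<bar> \<le> N * M * (norm (v x))\<^sup>2" using abs_quadratic_form_le[OF H, of "v x"] by (simp add: N_def)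
  have U: "\<bar>?U\<bar> \<le> N * M * ?u" using abs_quadratic_form_le[OF H, of "weak_grad \<Phi> x"] by (simp add: N_def weak_grad_def)
  have 1: "\<bar>\<rho> x * ?V\<bar> \<le> \<rho> x * (N * M * (norm (v x))\<^sup>2)"
    using mult_left_mono[OF V assms(1)] assms(1) by (simp add: abs_mult)
  have 2: "\<bar>p (\<rho> x) * (\<Sum>i\<in>UNIV. H i i)\<bar> \<le> p (\<rho> x) * (N * M)"
    using mult_left_mono[OF tr assms(2)] assms(2) by (simp add: abs_mult)
  have 3: "\<bar>?u / 2 * (\<Sum>i\<in>UNIV. H i i)\<bar> \<le> ?u / 2 * (N * M)"
    using mult_left_mono[OF tr, of "?u / 2"] by (simp add: abs_mult)
  have "\<bar>?u / 2 * (\<Sum>i\<in>UNIV. H i i) - ?U\<bar> \<le> 2 * N * M * ?u"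
    using 3 U mult_nonneg_nonneg[of "N * M" ?u] M by (simp add: N_def mult_ac)
  from mult_left_mono[OF this assms(3)]
  have 4: "\<bar>k * (?u / 2 * (\<Sum>i\<in>UNIV. H i i) - ?U)\<bar> \<le> k * (2 * N * M * ?u)"
    using assms(3) by (simp add: abs_mult)
  have 5: "0 \<le> \<rho> x * (N * M * (norm (v x))\<^sup>2)" "0 \<le> p (\<rho> x) * (N * M)" using assms M by (auto simp: N_def)
  have "\<bar>stress k p \<rho> v \<Phi> x H\<bar> \<le> \<bar>\<rho> x * ?V\<bar> + \<bar>p (\<rho> x) * (\<Sum>i\<in>UNIV. H i i)\<bar> + \<bar>k * (?u / 2 * (\<Sum>i\<in>UNIV. H i i) - ?U)\<bar>"
    unfolding stress_def by (intro order_trans[OF abs_triangle_ineq] add_right_mono abs_triangle_ineq)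
  also have "\<dots> \<le> 2 * (\<rho> x * (N * M * (norm (v x))\<^sup>2)) + 2 * (p (\<rho> x) * (N * M)) + k * (2 * N * M * ?u)"
    using 1 2 4 5 by linarith
  also have "\<dots> = 2 * N * M * energy k p \<rho> v \<Phi> x" by (simp add: energy_def algebra_simps)
  finally show ?thesis by (simp add: N_def)
qed

text \<open>Passage to the limit in the stress identity along test functions whose Hessians are dominated by an
  admissible weight \<open>m\<close> and converge pointwise to \<open>H\<close>.\<close>

lemma stress_limit:
  fixes \<Phi> :: "real^'n \<Rightarrow> real"
  assumes sol: "stationary_weak_solution k \<mu> lam p \<rho> v \<Phi>" and k: "k \<ge> 0"
    and \<psi>: "\<And>n. test_fun (\<psi> n)"
    and m: "integrable lebesgue (\<lambda>x. m x * energy k p \<rho> v \<Phi> x)"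
    and bound: "\<And>n i j x. \<bar>partial i (partial j (\<psi> n)) x\<bar> \<le> m x"
    and lim: "\<And>i j x. (\<lambda>n. partial i (partial j (\<psi> n)) x) \<longlonglongrightarrow> H x i j"
    and visc: "(\<lambda>n. (2 * \<mu> + lam) * (LINT x|lebesgue. v x \<bullet> grad (laplacian (\<psi> n)) x)) \<longlonglongrightarrow> 0"
  shows "integrable lebesgue (\<lambda>x. stress k p \<rho> v \<Phi> x (H x))" "(LINT x|lebesgue. stress k p \<rho> v \<Phi> x (H x)) = 0"
proof -
  define S where "S n x = stress k p \<rho> v \<Phi> x (\<lambda>i j. partial i (partial j (\<psi> n)) x)" for n x
  have Slim: "(\<lambda>n. S n x) \<longlonglongrightarrow> stress k p \<rho> v \<Phi> x (H x)" for x
    unfolding S_def stress_def by (intro tendsto_intros lim)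
  have Sm: "S n \<in> borel_measurable lebesgue" for n
    using stress_identity(2)[OF sol \<psi>] unfolding S_def by (rule borel_measurable_integrable)
  have Hm: "(\<lambda>x. stress k p \<rho> v \<Phi> x (H x)) \<in> borel_measurable lebesgue"
    by (rule borel_measurable_LIMSEQ_real[OF Slim Sm])
  have I: "integrable lebesgue (\<lambda>x. 2 * (real CARD('n))\<^sup>2 * (m x * energy k p \<rho> v \<Phi> x))" using m by simp
  have dom: "AE x in lebesgue. norm (S n x) \<le> 2 * (real CARD('n))\<^sup>2 * (m x * energy k p \<rho> v \<Phi> x)" for n
    using sol_nonneg[OF sol]
  proof eventually_elim
    case (elim x)
    then show ?case using abs_stress_le[of \<rho> x p k "\<lambda>i j. partial i (partial j (\<psi> n)) x" "m x" v \<Phi>] k bound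
      by (simp add: S_def mult.assoc)
  qed
  show "integrable lebesgue (\<lambda>x. stress k p \<rho> v \<Phi> x (H x))"
    by (rule integrable_dominated_convergence[OF Hm Sm I AE_I2[OF Slim] dom])
  have "(\<lambda>n. LINT x|lebesgue. S n x) \<longlonglongrightarrow> (LINT x|lebesgue. stress k p \<rho> v \<Phi> x (H x))"
    by (rule integral_dominated_convergence[OF Hm Sm I AE_I2[OF Slim] dom])
  moreover have "(\<lambda>n. LINT x|lebesgue. S n x) \<longlonglongrightarrow> - 0"
    unfolding S_def stress_identity(1)[OF sol \<psi>] by (intro tendsto_minus visc)
  ultimately show "(LINT x|lebesgue. stress k p \<rho> v \<Phi> x (H x)) = 0" by (simp add: LIMSEQ_unique)
qed

section \<open>Dilations of test functions\<close>

lemma inverse_Suc_tendsto: "(\<lambda>n. 1 / real (Suc n)) \<longlonglongrightarrow> 0"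
  using LIMSEQ_Suc[OF lim_1_over_n] by blast

text \<open>The dilation \<open>f(x/(n+1))\<close>; the summand \<open>0\<close> makes it literally an affine substitution.\<close>

definition dilate :: "(real^'n \<Rightarrow> real) \<Rightarrow> nat \<Rightarrow> real^'n \<Rightarrow> real" where
  "dilate f n x = f ((1 / real (Suc n)) *\<^sub>R x + 0)"

lemma test_fun_dilate: "test_fun f \<Longrightarrow> test_fun (dilate f n)"
  unfolding dilate_def by (rule test_fun_affine) simp_all

lemma partial_dilate: "test_fun f \<Longrightarrow> partial i (dilate f n) = (\<lambda>x. 1 / real (Suc n) * dilate (partial i f) n x)"
  unfolding dilate_def
  by (rule ext, subst partial_affine) (simp_all add: test_fun_differentiable)

lemma partial_cmult: "test_fun f \<Longrightarrow> partial i (\<lambda>x. c * f x) = (\<lambda>x. c * (partial i f x :: real))"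
  by (rule ext) (simp add: partial_mult[where f="\<lambda>_. c"] test_fun_differentiable)

lemma partial_partial_dilate:
  "test_fun f \<Longrightarrow> partial i (partial j (dilate f n)) = (\<lambda>x. (1 / real (Suc n))\<^sup>2 * dilate (partial i (partial j f)) n x)"
  unfolding partial_dilate partial_cmult[OF test_fun_dilate[OF test_fun_partial]]
  by (simp only: partial_dilate[OF test_fun_partial] power2_eq_square mult.assoc)

lemma dilate_tendsto:
  assumes "test_fun f" shows "(\<lambda>n. dilate f n x) \<longlonglongrightarrow> f 0"
proof -
  from tendsto_add[OF tendsto_scaleR[OF inverse_Suc_tendsto tendsto_const[of x]] tendsto_const[of 0]]
  have "(\<lambda>n. (1 / real (Suc n)) *\<^sub>R x + 0) \<longlonglongrightarrow> 0" by simp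
  then show ?thesis unfolding dilate_def
    by (rule isCont_tendsto_compose[rotated])
      (use test_fun_continuous[OF assms] in \<open>simp add: continuous_on_eq_continuous_at\<close>)
qed

lemma test_fun_family_bounded:
  fixes f :: "'m::finite \<Rightarrow> real^'n \<Rightarrow> real"
  assumes "\<And>i. test_fun (f i)" obtains C where "C > 0" "\<And>i x. \<bar>f i x\<bar> \<le> C"
proof -
  have "\<exists>C>0. \<forall>x. \<bar>f i x\<bar> \<le> C" for i using test_fun_bounded[OF assms[of i]] by (metis real_norm_def)
  then obtain C where C: "\<And>i. C i > 0" "\<And>i x. \<bar>f i x\<bar> \<le> C i" by metis
  have "C i \<le> sum C UNIV" for i using C(1) by (intro member_le_sum) (auto simp: less_imp_le)
  then have "\<bar>f i x\<bar> \<le> sum C UNIV" for i x using C(2) order_trans by blast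
  moreover have "sum C UNIV > 0" by (rule sum_pos) (use C(1) in auto)
  ultimately show thesis using that by blast
qed

section \<open>A Liouville theorem\<close>

text \<open>Each \<open>u\<^sub>i = \<partial>\<^sub>i\<Phi>\<close> is weakly harmonic, so \<open>\<integral> |\<nabla>u\<^sub>i|\<^sup>2 \<psi> = 1/2 \<integral> u\<^sub>i\<^sup>2 \<Delta>\<psi>\<close>.  For dilated bump
  functions \<open>\<psi>\<close> the right-hand side tends to zero, hence \<open>\<nabla>u\<^sub>i = 0\<close>.  Then \<open>u\<^sub>i\<^sup>2\<close> is integrable with
  vanishing weak gradient, and testing this with \<open>x\<^sub>j b(x/n)\<close> gives \<open>\<integral> u\<^sub>i\<^sup>2 = 0\<close>.\<close>

lemma weak_harmonic_gradient_eq_0: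
  fixes \<Phi> :: "real^'n \<Rightarrow> real"
  assumes W: "W2_loc 2 \<Phi>" and lap: "AE x in lebesgue. weak_laplacian \<Phi> x = 0"
    and fin: "integrable lebesgue (\<lambda>x. (norm (weak_grad \<Phi> x))\<^sup>2)"
  shows "AE x in lebesgue. weak_grad \<Phi> x = 0"
proof -
  define u where "u i = weak_partial i \<Phi>" for i
  define U where "U i j = weak_partial j (weak_partial i \<Phi>)" for i j
  have u: "L2_loc (u j)" and U: "L2_loc (U i j)" and uU: "has_weak_partial j (u i) (U i j)" "has_weak_partial i (u j) (U i j)" for i j
    using W2_loc_2_derivatives[OF W] unfolding u_def U_def by auto
  have um: "u i \<in> borel_measurable lebesgue" for i using u unfolding L2_loc_def by blast
  have u2: "integrable lebesgue (\<lambda>x. u i x * u i x)" for i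
  proof (rule Bochner_Integration.integrable_bound[OF fin])
    show "(\<lambda>x. u i x * u i x) \<in> borel_measurable lebesgue" by (intro borel_measurable_times um)
    have "\<bar>u i x * u i x\<bar> \<le> (norm (weak_grad \<Phi> x))\<^sup>2" for x
      using power_mono[OF component_le_norm_cart[of "weak_grad \<Phi> x" i] abs_ge_zero, of 2]
      by (simp add: u_def weak_grad_def power2_eq_square)
    then show "AE x in lebesgue. norm (u i x * u i x) \<le> norm ((norm (weak_grad \<Phi> x))\<^sup>2)" by simp
  qed
  have "AE x in lebesgue. u i x = 0" for i
  proof -
    have div0: "(LINT x|lebesgue. (\<Sum>j\<in>UNIV. U i j x * partial j \<psi> x)) = - (LINT x|lebesgue. 0 * \<psi> x)" if \<psi>: "test_fun \<psi>" for \<psi>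
    proof -
      note \<psi>' = test_fun_partial[OF \<psi>]
      have "(LINT x|lebesgue. (\<Sum>j\<in>UNIV. U i j x * partial j \<psi> x)) = (\<Sum>j\<in>UNIV. LINT x|lebesgue. U i j x * partial j \<psi> x)"
        by (rule integral_sum_L2_loc_test[OF U \<psi>'])
      also have "\<dots> = (\<Sum>j\<in>UNIV. - (LINT x|lebesgue. u j x * partial j (partial i \<psi>) x))"
      proof (intro sum.cong refl)
        fix j
        show "(LINT x|lebesgue. U i j x * partial j \<psi> x) = - (LINT x|lebesgue. u j x * partial j (partial i \<psi>) x)"
          using uU(2)[of i j] \<psi>'[of j] unfolding has_weak_partial_def partial_commute[OF test_fun_smooth[OF \<psi>], of j i]
          by simp
      qed
      also have "\<dots> = - (LINT x|lebesgue. (\<Sum>j\<in>UNIV. u j x * partial j (partial i \<psi>) x))"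
        by (subst integral_sum_L2_loc_test) (auto simp: sum_negf u \<psi> test_fun_partial)
      also have "\<dots> = 0"
        using weak_grad_divergence[OF W lap L2_loc_zero \<psi>'[of i]] by (simp add: u_def)
      finally show ?thesis by simp
    qed
    define f where "f x = (\<Sum>j\<in>UNIV. U i j x * U i j x)" for x
    have fL: "L1_loc_on UNIV f" unfolding f_def[abs_def] by (intro L1_loc_sum L2_loc_mult U)
    have f0: "f x \<ge> 0" for x unfolding f_def by (intro sum_nonneg) simp
    have caccioppoli: "(LINT x|lebesgue. f x * \<psi> x) = (LINT x|lebesgue. u i x * u i x * laplacian \<psi> x) / 2"
      if \<psi>: "test_fun \<psi>" for \<psi>
    proof -
      note \<psi>' = test_fun_partial[OF \<psi>]
      have I: "integrable lebesgue (\<lambda>x. u i x * U i j x * partial j \<psi> x)" "integrable lebesgue (\<lambda>x. u i x * u i x * partial j (partial j \<psi>) x)" for j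
        by (intro L1_loc_mult_test L2_loc_mult u U test_fun_partial \<psi>)+
      have "(LINT x|lebesgue. (\<Sum>j\<in>UNIV. U i j x * u i x * partial j \<psi> x)) =
        - (LINT x|lebesgue. (0 * u i x + (\<Sum>j\<in>UNIV. U i j x * U i j x)) * \<psi> x)"
        by (rule weak_divergence_product_lebesgue[OF U U u L2_loc_zero div0 uU(1) \<psi>])
      then have "(LINT x|lebesgue. f x * \<psi> x) = - (LINT x|lebesgue. (\<Sum>j\<in>UNIV. u i x * U i j x * partial j \<psi> x))"
        by (simp add: f_def mult_ac)
      also have "\<dots> = - (\<Sum>j\<in>UNIV. LINT x|lebesgue. u i x * U i j x * partial j \<psi> x)" using I by simp
      also have "\<dots> = (\<Sum>j\<in>UNIV. (LINT x|lebesgue. u i x * u i x * partial j (partial j \<psi>) x) / 2)"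
        using weak_partial_square[OF u U uU(1) \<psi>', of i] by (simp add: sum_negf[symmetric])
      also have "\<dots> = (LINT x|lebesgue. u i x * u i x * laplacian \<psi> x) / 2"
        using I by (simp add: laplacian_def sum_distrib_left sum_divide_distrib)
      finally show ?thesis .
    qed
    define b where "b = (bump :: real^'n \<Rightarrow> real)"
    have b: "test_fun b" unfolding b_def by (rule test_fun_bump)
    obtain M where M: "M > 0" "\<And>x. \<bar>laplacian b x\<bar> \<le> M"
      using test_fun_bounded[OF test_fun_laplacian[OF b]] by (metis real_norm_def)
    define E where "E = (LINT x|lebesgue. u i x * u i x)"
    have le: "(LINT x|lebesgue. f x * dilate b n x) \<le> (1 / real (Suc n)) * (1 / real (Suc n)) * (M * E)" for n
    proof -
      have l: "laplacian (dilate b n) x = (1 / real (Suc n))\<^sup>2 * laplacian b ((1 / real (Suc n)) *\<^sub>R x + 0)" for x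
        unfolding laplacian_def partial_partial_dilate[OF b] by (simp add: dilate_def sum_distrib_left del: of_nat_Suc)
      have lb: "\<bar>laplacian (dilate b n) x\<bar> \<le> (1 / real (Suc n))\<^sup>2 * M" for x
        unfolding l abs_mult using M(2) by (simp add: mult_left_mono divide_right_mono del: of_nat_Suc)
      have *: "u i x * u i x * laplacian (dilate b n) x \<le> u i x * u i x * ((1 / real (Suc n))\<^sup>2 * M)" for x
        by (rule mult_left_mono[OF order_trans[OF abs_ge_self lb]]) simp
      have "(LINT x|lebesgue. u i x * u i x * laplacian (dilate b n) x) \<le> (LINT x|lebesgue. u i x * u i x * ((1 / real (Suc n))\<^sup>2 * M))"
        by (intro integral_mono * integrable_mult_left u2 L1_loc_mult_test L2_loc_mult u test_fun_laplacian test_fun_dilate b)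
      also have "\<dots> = (1 / real (Suc n))\<^sup>2 * M * E" by (simp add: E_def)
      finally have "(LINT x|lebesgue. f x * dilate b n x) \<le> (1 / real (Suc n))\<^sup>2 * M * E / 2"
        unfolding caccioppoli[OF test_fun_dilate[OF b]] by simp
      also have "\<dots> \<le> (1 / real (Suc n))\<^sup>2 * M * E"
        using M u2 by (simp add: E_def)
      finally show ?thesis by (simp add: power2_eq_square mult.assoc del: of_nat_Suc)
    qed
    have "AE x in lebesgue. x \<in> cball 0 (real R) \<longrightarrow> f x = 0" for R :: nat
    proof -
      have If: "integrable lebesgue (\<lambda>x. indicator (cball 0 (real R)) x * f x)"
        using fL unfolding L1_loc_on_def set_integrable_def by (auto dest: spec[of _ "cball 0 (real R)"])
      have low: "dilate b n x \<ge> exp (- 2)" if "n \<ge> 2 * R" "norm x \<le> real R" for n x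
      proof -
        define y where "y = (1 / real (Suc n)) *\<^sub>R x + 0"
        have "norm y \<le> 1 / 2" using that by (simp add: y_def field_simps)
        then have "norm y * norm y \<le> (1/2) * (1/2)" by (intro mult_mono) auto
        then have y: "y \<bullet> y \<le> 1/2" by (simp add: power2_norm_eq_inner[symmetric] power2_eq_square)
        then have "1 / (1 - y \<bullet> y) \<le> 2" by (subst divide_le_eq) auto
        then show ?thesis using y unfolding dilate_def y_def[symmetric] b_def bump_def flat_def by simp
      qed
      have "(LINT x|lebesgue. exp (- 2) * (indicator (cball 0 (real R)) x * f x)) \<le> (1 / real (Suc n)) * (1 / real (Suc n)) * (M * E)" if n: "n \<ge> 2 * R" for n
      proof (rule order_trans[OF _ le[of n]], rule integral_mono)
        show "integrable lebesgue (\<lambda>x. exp (- 2) * (indicator (cball 0 (real R)) x * f x))" using If by simp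
        show "integrable lebesgue (\<lambda>x. f x * dilate b n x)" by (rule L1_loc_mult_test[OF fL test_fun_dilate[OF b]])
        show "exp (- 2) * (indicator (cball 0 (real R)) x * f x) \<le> f x * dilate b n x" for x
          using mult_left_mono[OF low[OF n, of x] f0[of x]] f0[of x] bump_nonneg[of "(1 / real (Suc n)) *\<^sub>R x + 0"]
          by (cases "norm x \<le> real R") (auto simp: mult.commute b_def dilate_def)
      qed
      moreover have "(\<lambda>n. (1 / real (Suc n)) * (1 / real (Suc n)) * (M * E)) \<longlonglongrightarrow> 0 * 0 * (M * E)"
        by (intro tendsto_mult inverse_Suc_tendsto tendsto_const)
      ultimately have "(LINT x|lebesgue. exp (- 2) * (indicator (cball 0 (real R)) x * f x)) \<le> 0 * 0 * (M * E)"
        by (intro LIMSEQ_le_const) auto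
      then have "(LINT x|lebesgue. indicator (cball 0 (real R)) x * f x) \<le> 0" by (simp add: mult_le_0_iff)
      moreover have "(LINT x|lebesgue. indicator (cball 0 (real R)) x * f x) \<ge> 0"
        using f0 by (intro integral_nonneg_AE AE_I2) simp
      ultimately have "(LINT x|lebesgue. indicator (cball 0 (real R)) x * f x) = 0" by simp
      then have "AE x in lebesgue. indicator (cball 0 (real R)) x * f x = 0"
        using f0 by (subst (asm) integral_nonneg_eq_0_iff_AE[OF If]) auto
      then show ?thesis by eventually_elim auto
    qed
    then have "AE x in lebesgue. \<forall>R::nat. x \<in> cball 0 (real R) \<longrightarrow> f x = 0"
      unfolding AE_all_countable by blast
    then have fz: "AE x in lebesgue. f x = 0"
    proof eventually_elim
      case (elim x)
      then show ?case using real_arch_simple[of "norm x"] by auto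
    qed
    then have Uz: "AE x in lebesgue. U i j x = 0" for j
    proof eventually_elim
      case (elim x)
      then have "\<forall>j\<in>UNIV. U i j x * U i j x = 0" unfolding f_def by (subst (asm) sum_nonneg_eq_0_iff) auto
      then show ?case by simp
    qed
    have const: "(LINT x|lebesgue. u i x * u i x * partial j \<phi> x) = 0" if \<phi>: "test_fun \<phi>" for \<phi> j
    proof -
      have "(LINT x|lebesgue. u i x * U i j x * \<phi> x) = (LINT x::real^'n|lebesgue. 0::real)"
      proof (rule integral_cong_AE)
        show "(\<lambda>x. u i x * U i j x * \<phi> x) \<in> borel_measurable lebesgue"
          using L1_loc_mult_test[OF L2_loc_mult[OF u U] \<phi>] by (rule borel_measurable_integrable)
        show "AE x in lebesgue. u i x * U i j x * \<phi> x = 0" using Uz[of j] by eventually_elim simp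
      qed simp
      then show ?thesis using weak_partial_square[OF u U uU(1) \<phi>, of i j] by simp
    qed
    \<comment> \<open>Any coordinate direction \<open>j\<close> will do.\<close>
    obtain j :: 'n where True by blast
    obtain C where C: "C > 0" "\<And>x. \<bar>b x\<bar> \<le> C" using test_fun_bounded[OF b] by (metis real_norm_def)
    obtain D where D: "D > 0" "\<And>x. \<bar>partial j b x\<bar> \<le> D" using test_fun_bounded[OF test_fun_partial[OF b]] by (metis real_norm_def)
    define \<phi> where "\<phi> n x = x $ j * dilate b n x" for n x
    have \<phi>: "test_fun (\<phi> n)" for n unfolding \<phi>_def by (intro test_fun_mult_smooth smooth_component test_fun_dilate b)
    have d\<phi>: "partial j (\<phi> n) x = x $ j * (1 / real (Suc n)) * dilate (partial j b) n x + dilate b n x" for n x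
      unfolding \<phi>_def
      by (subst partial_mult) (simp_all add: smooth_differentiable[OF smooth_component] test_fun_differentiable[OF test_fun_dilate[OF b]] partial_dilate[OF b])
    have bd: "\<bar>partial j (\<phi> n) x\<bar> \<le> D + C" for n x
    proof -
      let ?y = "(1 / real (Suc n)) *\<^sub>R x + 0"
      have "\<bar>?y $ j * partial j b ?y\<bar> \<le> D"
      proof (cases "1 < norm ?y")
        case True
        then have "partial j b ?y = 0" using partial_outside[of b ?y j] bump_eq_0 by (auto simp: b_def)
        then show ?thesis using D(1) by simp
      next
        case False
        then have "\<bar>?y $ j\<bar> \<le> 1" using component_le_norm_cart[of ?y j] by linarith
        then have "\<bar>?y $ j\<bar> * \<bar>partial j b ?y\<bar> \<le> 1 * D" by (intro mult_mono D) auto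
        then show ?thesis by (simp only: abs_mult)
      qed
      moreover have "partial j (\<phi> n) x = ?y $ j * partial j b ?y + b ?y"
        unfolding d\<phi> dilate_def by (simp del: of_nat_Suc)
      ultimately show ?thesis using C(2)[of ?y] by linarith
    qed
    have "(\<lambda>n. LINT x|lebesgue. u i x * u i x * partial j (\<phi> n) x) \<longlonglongrightarrow> (LINT x|lebesgue. u i x * u i x * b 0)"
    proof (rule integral_dominated_convergence[where w="\<lambda>x. (u i x * u i x) * (D + C)"])
      show "integrable lebesgue (\<lambda>x. (u i x * u i x) * (D + C))" using u2 by simp
      show "(\<lambda>x. u i x * u i x * b 0) \<in> borel_measurable lebesgue"
        by (intro borel_measurable_times um borel_measurable_const)
      show "(\<lambda>x. u i x * u i x * partial j (\<phi> n) x) \<in> borel_measurable lebesgue" for n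
        by (intro borel_measurable_times um test_fun_lebesgue test_fun_partial \<phi>)
      show "AE x in lebesgue. norm (u i x * u i x * partial j (\<phi> n) x) \<le> u i x * u i x * (D + C)" for n
        using bd by (intro AE_I2) (simp add: abs_mult mult_left_mono)
      show "AE x in lebesgue. (\<lambda>n. u i x * u i x * partial j (\<phi> n) x) \<longlonglongrightarrow> u i x * u i x * b 0"
      proof (intro AE_I2 tendsto_mult tendsto_const)
        fix x
        have "(\<lambda>n. partial j (\<phi> n) x) \<longlonglongrightarrow> x $ j * 0 * partial j b 0 + b 0"
          unfolding d\<phi> by (intro tendsto_intros inverse_Suc_tendsto dilate_tendsto test_fun_partial b)
        then show "(\<lambda>n. partial j (\<phi> n) x) \<longlonglongrightarrow> b 0" by simp
      qed
    qed
    then have "(LINT x|lebesgue. u i x * u i x * b 0) = 0"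
      unfolding const[OF \<phi>] using LIMSEQ_unique[OF tendsto_const] by metis
    then have "(LINT x|lebesgue. u i x * u i x) = 0" by (simp add: b_def bump_0)
    then have "AE x in lebesgue. u i x * u i x = 0" by (subst (asm) integral_nonneg_eq_0_iff_AE[OF u2]) auto
    then show ?thesis by eventually_elim simp
  qed
  then have "AE x in lebesgue. \<forall>i\<in>UNIV. u i x = 0" by (intro AE_finite_allI) auto
  then show ?thesis by eventually_elim (simp add: weak_grad_def u_def vec_eq_iff)
qed

section \<open>Finite energy\<close>

text \<open>Young's inequality for the exponents \<open>N/(N-1)\<close> and \<open>N\<close>, with a weaker power of the parameter than
  the optimal one.\<close>

lemma young_parametric:
  fixes a b t :: real and N :: nat
  assumes "a \<ge> 0" "b \<ge> 0" "t \<ge> 1" "N \<ge> 2"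
  shows "a * b \<le> t * a powr (real N / (real N - 1)) + b ^ N / t"
proof (cases "a = 0")
  case True
  then show ?thesis using assms by simp
next
  case False
  then have a: "a > 0" using assms by simp
  obtain m where m: "N = Suc m" "m \<ge> 1" using assms(4) by (cases N) auto
  define r where "r = a powr (1 / real m)"
  have r: "r > 0" using a by (simp add: r_def)
  have rm: "r ^ m = a" using a m(2) by (simp add: r_def powr_realpow[symmetric] powr_powr)
  have "a powr (real N / (real N - 1)) = a powr (1 + 1 / real m)" using m by (simp add: field_simps)
  also have "\<dots> = a * r" using a by (simp add: powr_add r_def)
  finally have q: "a powr (real N / (real N - 1)) = a * r" .
  show ?thesis
  proof (cases "b \<le> t * r")
    case True
    have "a * b \<le> a * (t * r)" using True a by (intro mult_left_mono) auto
    then show ?thesis using q assms by (simp add: mult_ac add_increasing2)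
  next
    case False
    then have "r \<le> b / t" using assms(3) by (simp add: field_simps)
    then have "a \<le> (b / t) ^ m" using r by (subst rm[symmetric], intro power_mono) auto
    then have "a * b \<le> (b / t) ^ m * b" using assms by (intro mult_right_mono) auto
    also have "\<dots> = b ^ N / t ^ m" by (simp add: power_divide m(1))
    also have "\<dots> \<le> b ^ N / t"
    proof (rule divide_left_mono)
      show "t \<le> t ^ m" using assms(3) m(2) self_le_power[of t m] by simp
    qed (use assms in auto)
    finally show ?thesis using q assms(3) a r by (simp add: add_increasing)
  qed
qed

text \<open>Here \<open>|v \<bullet> c B(c x)| \<le> |v| b\<close> where \<open>b = b\<^sub>n\<close> tends to zero uniformly while \<open>\<integral> b\<^sup>N = K\<close> is
  independent of \<open>n\<close>.  By Young's inequality the positive part of \<open>|v| b - b\<^sup>N/t\<close> is dominated by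
  \<open>t |v|\<^sup>q\<close>, \<open>q = N/(N-1)\<close>, so its integral tends to zero; the remainder \<open>K/t\<close> is small for large \<open>t\<close>.\<close>

lemma viscous_pairing_tendsto:
  fixes v B :: "real^'n \<Rightarrow> real^'n"
  assumes N: "CARD('n) \<ge> 2" and vm: "v \<in> borel_measurable lebesgue"
    and fin: "integrable lebesgue (\<lambda>x. norm (v x) powr (real CARD('n) / (real CARD('n) - 1)))"
    and B: "continuous_on UNIV B" "\<And>z. norm (B z) \<le> M" "\<And>z. 1 < norm z \<Longrightarrow> B z = 0"
  shows "(\<lambda>n. LINT x|lebesgue. v x \<bullet> ((1 / real (Suc n)) *\<^sub>R B ((1 / real (Suc n)) *\<^sub>R x + 0))) \<longlonglongrightarrow> 0"
proof -
  define N where "N = CARD('n)"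
  define c where "c n = 1 / real (Suc n)" for n
  have c: "c n > 0" for n by (simp add: c_def)
  have clim: "c \<longlonglongrightarrow> 0" unfolding c_def by (rule inverse_Suc_tendsto)
  have M: "M \<ge> 0" using B(2)[of 0] norm_ge_zero order_trans by blast
  define b where "b n x = c n * M * indicator (cball 0 1) (c n *\<^sub>R x)" for n and x :: "real^'n"
  have b0: "b n x \<ge> 0" for n x using c[of n] M by (simp add: b_def)
  have "(\<lambda>x. c n *\<^sub>R x) \<in> borel_measurable lebesgue" for n
    by (rule measurable_completion) simp
  then have indm: "(\<lambda>x::real^'n. indicat_real (cball 0 1) (c n *\<^sub>R x)) \<in> borel_measurable lebesgue" for n
    by (rule measurable_compose) (rule borel_measurable_indicator, simp)
  have bm: "b n \<in> borel_measurable lebesgue" for n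
    unfolding b_def[abs_def] by (intro borel_measurable_times borel_measurable_const indm)
  define V where "V = (LINT x|lborel. indicator (cball (0::real^'n) 1) x :: real)"
  have Vint: "integrable lborel (\<lambda>x::real^'n. indicat_real (cball 0 1) (c n *\<^sub>R x))" for n
    using lborel_integrable_affine[OF integrable_indicator_cball[of "0::real^'n" 1], of "c n" 0] c[of n] by simp
  have indb: "indicat_real (cball (0::real^'n) 1) \<in> borel_measurable borel" by (rule borel_measurable_indicator) simp
  have V: "c n ^ N * (LINT x|lborel. indicator (cball (0::real^'n) 1) (c n *\<^sub>R x)) = V" for n
    unfolding V_def N_def
    using lborel_integral_affine[OF indb, of "c n" 0] c[of n] by simp
  have bN: "b n x ^ N = (M ^ N * c n ^ N) * indicator (cball 0 1) (c n *\<^sub>R x)" for n x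
    using N by (simp add: b_def power_mult_distrib indicator_def N_def mult_ac)
  have bNI: "integrable lebesgue (\<lambda>x. b n x ^ N)" for n
    unfolding bN using Vint[of n] integrable_completion[of "\<lambda>x::real^'n. indicat_real (cball 0 1) (c n *\<^sub>R x)" lborel] by simp
  define K where "K = M ^ N * V"
  have bNK: "(LINT x|lebesgue. b n x ^ N) = K" for n
    unfolding bN using V[of n] integral_completion[OF borel_measurable_integrable[OF Vint[of n]]]
    by (simp add: K_def mult.assoc)
  have K: "K \<ge> 0" using M by (simp add: K_def V_def integral_nonneg_AE)
  define F where "F n x = v x \<bullet> (c n *\<^sub>R B (c n *\<^sub>R x + 0))" for n x
  have Fb: "\<bar>F n x\<bar> \<le> norm (v x) * b n x" for n x
  proof -
    have "\<bar>F n x\<bar> \<le> norm (v x) * (c n * norm (B (c n *\<^sub>R x + 0)))"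
      unfolding F_def using Cauchy_Schwarz_ineq2[of "v x" "c n *\<^sub>R B (c n *\<^sub>R x + 0)"] c[of n] by simp
    also have "\<dots> \<le> norm (v x) * b n x"
    proof (intro mult_left_mono)
      show "c n * norm (B (c n *\<^sub>R x + 0)) \<le> b n x"
        using B(2,3)[of "c n *\<^sub>R x"] c[of n] by (cases "norm (c n *\<^sub>R x) \<le> 1") (auto simp: b_def mult_left_mono)
    qed simp
    finally show ?thesis .
  qed
  have Bm: "B \<in> borel_measurable borel" using B(1) by (rule borel_measurable_continuous_onI)
  have "(\<lambda>x. c n *\<^sub>R B (c n *\<^sub>R x + 0)) \<in> borel_measurable borel" for n
    using Bm by measurable
  then have Fm: "F n \<in> borel_measurable lebesgue" for n
    unfolding F_def[abs_def] by (intro borel_measurable_inner vm measurable_completion) simp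
  show ?thesis unfolding c_def[symmetric] F_def[symmetric]
  proof (rule LIMSEQ_I, simp only: real_norm_def diff_0_right)
    fix e :: real assume e: "e > 0"
    define t where "t = 2 * K / e + 1"
    have t: "t \<ge> 1" using e K by (simp add: t_def)
    have Kt: "K / t < e / 2" using e K t by (simp add: t_def field_simps)
    define g where "g n x = max 0 (norm (v x) * b n x - b n x ^ N / t)" for n x
    have nv: "(\<lambda>x. norm (v x)) \<in> borel_measurable lebesgue" using vm by simp
    have gm: "g n \<in> borel_measurable lebesgue" for n
      unfolding g_def[abs_def]
      by (intro borel_measurable_max borel_measurable_diff borel_measurable_times borel_measurable_divide borel_measurable_power borel_measurable_const bm nv)
    have gdom: "\<bar>g n x\<bar> \<le> t * norm (v x) powr (real CARD('n) / (real CARD('n) - 1))" for n x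
      using young_parametric[of "norm (v x)" "b n x" t N] b0[of n x] t N by (simp add: g_def N_def)
    have It: "integrable lebesgue (\<lambda>x. t * norm (v x) powr (real CARD('n) / (real CARD('n) - 1)))" using fin by simp
    have gI: "integrable lebesgue (g n)" for n
      by (rule Bochner_Integration.integrable_bound[OF It gm])
        (intro AE_I2, unfold real_norm_def, rule order_trans[OF gdom abs_ge_self])
    have "(\<lambda>n. LINT x|lebesgue. g n x) \<longlonglongrightarrow> (LINT x::real^'n|lebesgue. 0)"
    proof (rule integral_dominated_convergence[OF _ gm It])
      show "AE x in lebesgue. (\<lambda>n. g n x) \<longlonglongrightarrow> 0"
      proof (rule AE_I2)
        fix x
        have "(\<lambda>n. b n x) \<longlonglongrightarrow> 0"
        proof (rule tendsto_sandwich[OF _ _ tendsto_const])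
          show "\<forall>\<^sub>F n in sequentially. 0 \<le> b n x" using b0 by simp
          show "\<forall>\<^sub>F n in sequentially. b n x \<le> c n * M" using c M by (simp add: b_def indicator_def less_imp_le)
          show "(\<lambda>n. c n * M) \<longlonglongrightarrow> 0" using tendsto_mult_left_zero[OF clim] .
        qed
        then have "(\<lambda>n. g n x) \<longlonglongrightarrow> max 0 (norm (v x) * 0 - 0 ^ N / t)"
          unfolding g_def by (intro tendsto_intros) (use t in auto)
        then show "(\<lambda>n. g n x) \<longlonglongrightarrow> 0" using N by (simp add: N_def zero_power)
      qed
    qed (use gdom in auto)
    from LIMSEQ_D[OF this, of "e / 2"] e obtain n0 where n0: "\<And>n. n \<ge> n0 \<Longrightarrow> \<bar>LINT x|lebesgue. g n x\<bar> < e / 2" by auto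
    show "\<exists>n0. \<forall>n\<ge>n0. \<bar>LINT x|lebesgue. F n x\<bar> < e"
    proof (intro exI allI impI)
      fix n assume n: "n \<ge> n0"
      have I: "integrable lebesgue (\<lambda>x. g n x + b n x ^ N / t)" using gI bNI by simp
      have le: "norm (F n x) \<le> g n x + b n x ^ N / t" for x using Fb[of n x] by (simp add: g_def)
      have FI: "integrable lebesgue (F n)"
        by (rule Bochner_Integration.integrable_bound[OF I Fm]) (intro AE_I2, rule order_trans[OF le], simp)
      have "norm (LINT x|lebesgue. F n x) \<le> (LINT x|lebesgue. norm (F n x))" by (rule integral_norm_bound)
      also have "\<dots> \<le> (LINT x|lebesgue. g n x + b n x ^ N / t)"
        by (rule integral_mono[OF integrable_norm[OF FI] I le])
      also have "\<dots> = (LINT x|lebesgue. g n x) + K / t" using gI bNI bNK by simp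
      also have "\<dots> < e" using n0[OF n] Kt by linarith
      finally show "\<bar>LINT x|lebesgue. F n x\<bar> < e" by simp
    qed
  qed
qed

lemma quadratic_form_diag: "(\<Sum>i\<in>UNIV. \<Sum>j\<in>UNIV. a $ i * a $ j * (if i = j then d else 0)) = d * (norm (a::real^'n))\<^sup>2"
  by (simp add: if_distrib[of "\<lambda>c. _ * c"] power2_norm_eq_inner inner_vec_def sum_distrib_left mult_ac cong: if_cong)

lemma quadratic_form_rank_one: "(\<Sum>i\<in>UNIV. \<Sum>j\<in>UNIV. a $ i * a $ j * (x $ i * x $ j)) = (a \<bullet> (x::real^'n))\<^sup>2"
  by (simp add: inner_vec_def power2_eq_square sum_product mult_ac)

lemma stress_diag:
  "stress k p \<rho> v (\<Phi> :: real^'n \<Rightarrow> real) x (\<lambda>i j. if i = j then d else 0) =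
    d * (\<rho> x * (norm (v x))\<^sup>2 + real CARD('n) * p (\<rho> x) + k * ((real CARD('n) / 2 - 1) * (norm (weak_grad \<Phi> x))\<^sup>2))"
  using quadratic_form_diag[of "v x" d] quadratic_form_diag[of "weak_grad \<Phi> x" d]
  by (simp add: stress_def weak_grad_def algebra_simps)

text \<open>The test functions are \<open>n\<^sup>2 b(x/n)\<close>, with Hessian \<open>(\<nabla>\<^sup>2b)(x/n)\<close>.\<close>

lemma finite_energy_vanishing:
  fixes \<Phi> :: "real^'n \<Rightarrow> real"
  assumes N: "CARD('n) \<ge> 2" and k: "k \<ge> 0" and sol: "stationary_weak_solution k \<mu> lam p \<rho> v \<Phi>"
    and fin: "integrable lebesgue (energy k p \<rho> v \<Phi>)"
    and visc: "2 * \<mu> + lam = 0 \<or> integrable lebesgue (\<lambda>x. norm (v x) powr (real CARD('n) / (real CARD('n) - 1)))"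
  shows "(AE x in lebesgue. \<rho> x = 0) \<and> (k \<noteq> 0 \<longrightarrow> (AE x in lebesgue. weak_grad \<Phi> x = 0))"
proof -
  define b where "b = (bump :: real^'n \<Rightarrow> real)"
  have b: "test_fun b" unfolding b_def by (rule test_fun_bump)
  define \<psi> where "\<psi> n x = (real (Suc n))\<^sup>2 * dilate b n x" for n x
  have \<psi>: "test_fun (\<psi> n)" for n unfolding \<psi>_def by (intro test_fun_mult_smooth smooth_const test_fun_dilate b)
  have d2: "partial i (partial j (\<psi> n)) = dilate (partial i (partial j b)) n" for i j n
    unfolding \<psi>_def partial_cmult[OF test_fun_dilate[OF b]] partial_cmult[OF test_fun_partial[OF test_fun_dilate[OF b]]]
      partial_partial_dilate[OF b] by (auto simp: power_divide simp del: of_nat_Suc)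
  obtain M where M: "M > 0" "\<And>ij x. \<bar>partial (fst ij) (partial (snd ij) b) x\<bar> \<le> M"
    using test_fun_family_bounded[of "\<lambda>ij::'n\<times>'n. partial (fst ij) (partial (snd ij) b)"] test_fun_partial[OF test_fun_partial[OF b]] by blast
  have bound: "\<bar>partial i (partial j (\<psi> n)) x\<bar> \<le> M" for n i j x
    unfolding d2 dilate_def using M(2)[of "(i, j)"] by simp
  have lim: "(\<lambda>n. partial i (partial j (\<psi> n)) x) \<longlonglongrightarrow> (if i = j then - 2 * exp (- 1) else 0)" for i j x
    unfolding d2 using dilate_tendsto[OF test_fun_partial[OF test_fun_partial[OF b]], of i j x] partial_partial_bump_0[of i j]
    by (auto simp: b_def split: if_splits)
  have lap: "laplacian (\<psi> n) = dilate (laplacian b) n" for n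
    by (rule ext) (simp add: laplacian_def d2 dilate_def)
  have gl: "grad (laplacian (\<psi> n)) x = (1 / real (Suc n)) *\<^sub>R grad (laplacian b) ((1 / real (Suc n)) *\<^sub>R x + 0)" for n x
    unfolding lap vec_eq_iff grad_nth vector_scaleR_component partial_dilate[OF test_fun_laplacian[OF b]] by (simp add: dilate_def)
  have visc': "(\<lambda>n. (2 * \<mu> + lam) * (LINT x|lebesgue. v x \<bullet> grad (laplacian (\<psi> n)) x)) \<longlonglongrightarrow> 0"
  proof (cases "2 * \<mu> + lam = 0")
    case False
    have vm: "v \<in> borel_measurable lebesgue" using sol unfolding stationary_weak_solution_def L2_loc_def by blast
    obtain C where C: "\<And>z. norm (grad (laplacian b) z) \<le> C"
      using test_fun_bounded[OF test_fun_grad[OF test_fun_laplacian[OF b]]] by blast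
    have b1: "b z = 0" if "1 < norm z" for z using bump_eq_0[OF that] by (simp add: b_def)
    have "partial i (partial i b) z = 0" if "1 < norm z" for i z
      by (rule partial_outside[OF partial_outside[OF b1] that])
    then have "laplacian b z = 0" if "1 < norm z" for z using that by (simp add: laplacian_def)
    then have "partial i (laplacian b) z = 0" if "1 < norm z" for i z using partial_outside that by blast
    then have G0: "grad (laplacian b) z = 0" if "1 < norm z" for z using that by (simp add: vec_eq_iff)
    have "(\<lambda>n. LINT x|lebesgue. v x \<bullet> grad (laplacian (\<psi> n)) x) \<longlonglongrightarrow> 0"
      unfolding gl using visc False
      by (intro viscous_pairing_tendsto[OF N vm _ test_fun_continuous[OF test_fun_grad[OF test_fun_laplacian[OF b]]] C G0]) auto
    then show ?thesis by (rule tendsto_mult_right_zero)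
  qed simp
  have m: "integrable lebesgue (\<lambda>x. M * energy k p \<rho> v \<Phi> x)" using fin by simp
  define S where "S x = \<rho> x * (norm (v x))\<^sup>2 + real CARD('n) * p (\<rho> x) + k * ((real CARD('n) / 2 - 1) * (norm (weak_grad \<Phi> x))\<^sup>2)" for x
  have SI: "integrable lebesgue S" and S0: "(LINT x|lebesgue. S x) = 0"
    using stress_limit[OF sol k \<psi> m bound lim visc'] unfolding stress_diag S_def by simp_all
  have pos: "AE x in lebesgue. real CARD('n) * p (\<rho> x) \<le> S x \<and> k * ((real CARD('n) / 2 - 1) * (norm (weak_grad \<Phi> x))\<^sup>2) \<le> S x \<and> 0 \<le> S x"
    using sol_nonneg[OF sol]
  proof eventually_elim
    case (elim x)
    have "0 \<le> \<rho> x * (norm (v x))\<^sup>2" "0 \<le> real CARD('n) * p (\<rho> x)" "0 \<le> k * ((real CARD('n) / 2 - 1) * (norm (weak_grad \<Phi> x))\<^sup>2)"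
      using elim k N by (auto intro!: mult_nonneg_nonneg)
    then show ?case unfolding S_def by linarith
  qed
  have "AE x in lebesgue. S x = 0"
    using S0 pos by (subst (asm) integral_nonneg_eq_0_iff_AE[OF SI]) auto
  with pos sol_nonneg[OF sol] have zero: "AE x in lebesgue. \<rho> x = 0 \<and> k * ((real CARD('n) / 2 - 1) * (norm (weak_grad \<Phi> x))\<^sup>2) \<le> 0"
  proof eventually_elim
    case (elim x)
    then have "real CARD('n) * p (\<rho> x) \<le> 0" by simp
    then have "p (\<rho> x) \<le> 0" using N by (simp add: mult_le_0_iff)
    then show ?case using elim by auto
  qed
  have "AE x in lebesgue. weak_grad \<Phi> x = 0" if k0: "k \<noteq> 0"
  proof (rule weak_harmonic_gradient_eq_0)
    show "W2_loc 2 \<Phi>" using sol unfolding stationary_weak_solution_def by blast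
    have "AE x in lebesgue. weak_laplacian \<Phi> x = \<rho> x" using sol unfolding stationary_weak_solution_def by blast
    with zero show "AE x in lebesgue. weak_laplacian \<Phi> x = 0" by eventually_elim simp
    have I: "integrable lebesgue (\<lambda>x. (1 / k) * energy k p \<rho> v \<Phi> x)" using fin by simp
    show "integrable lebesgue (\<lambda>x. (norm (weak_grad \<Phi> x))\<^sup>2)"
    proof (rule Bochner_Integration.integrable_bound[OF I L1_loc_measurable[OF sol_L2(7)[OF sol]]])
      show "AE x in lebesgue. norm ((norm (weak_grad \<Phi> x))\<^sup>2) \<le> norm ((1 / k) * energy k p \<rho> v \<Phi> x)"
        using sol_nonneg[OF sol]
      proof eventually_elim
        case (elim x)
        have "0 \<le> \<rho> x * (norm (v x))\<^sup>2" using elim by simp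
        then have "k * (norm (weak_grad \<Phi> x))\<^sup>2 \<le> energy k p \<rho> v \<Phi> x" using elim by (simp add: energy_def)
        then have "(norm (weak_grad \<Phi> x))\<^sup>2 \<le> (1 / k) * energy k p \<rho> v \<Phi> x" using k k0 by (simp add: field_simps)
        from order_trans[OF this abs_ge_self] show ?case
          by (simp only: real_norm_def abs_of_nonneg[OF zero_le_power2])
      qed
    qed
  qed
  with zero show ?thesis by auto
qed

section \<open>Weighted energy\<close>

text \<open>The smooth convex function \<open>\<surd>(1 + |x|\<^sup>2)\<close>, comparable to \<open>1 + |x|\<close>.\<close>

definition bracket :: "real^'n \<Rightarrow> real" where
  "bracket x = sqrt (1 + x \<bullet> x)"

lemma bracket_ge_1: "bracket x \<ge> 1" and bracket_sq: "(bracket x)\<^sup>2 = 1 + (norm x)\<^sup>2"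
  by (simp_all add: bracket_def power2_norm_eq_inner)

lemma norm_le_bracket: "norm x \<le> bracket x"
  unfolding bracket_def by (rule real_le_rsqrt) (simp add: power2_norm_eq_inner)

lemma bracket_le: "bracket x \<le> 1 + norm x"
  unfolding bracket_def by (rule real_le_lsqrt) (simp_all add: power2_norm_eq_inner[symmetric] power2_eq_square algebra_simps)

lemma smooth_powr_inner: "smooth (\<lambda>x::real^'n. (1 + 1 * (x \<bullet> x)) powr a)"
proof (rule smooth_real_comp[where T="{0<..}" and g="\<lambda>a t. t powr a" and B="\<lambda>a. {a - 1}" and c="\<lambda>a _. a"])
  show "((\<lambda>t. t powr a) has_real_derivative (\<Sum>b\<in>{a - 1}. a * t powr b)) (at t)" if "t \<in> {0<..}" for a t :: real
    using that by (auto intro!: derivative_eq_intros)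
  show "1 + 1 * (x \<bullet> x) \<in> {0<..}" for x :: "real^'n" using inner_ge_zero[of x] by (simp add: add_pos_nonneg)
qed (rule smooth_affine_inner_self)

lemma partial_powr_inner:
  "partial i (\<lambda>x::real^'n. (1 + 1 * (x \<bullet> x)) powr a) = (\<lambda>x. (2 * a * (1 + 1 * (x \<bullet> x)) powr (a - 1)) * x $ i)"
proof
  fix x :: "real^'n"
  have "1 + 1 * (x \<bullet> x) > 0" using inner_ge_zero[of x] by (simp add: add_pos_nonneg)
  then have "((\<lambda>t. t powr a) has_real_derivative a * (1 + 1 * (x \<bullet> x)) powr (a - 1)) (at (1 + 1 * (x \<bullet> x)))"
    by (auto intro!: derivative_eq_intros)
  from partial_comp_inner_self[OF this] show "partial i (\<lambda>x::real^'n. (1 + 1 * (x \<bullet> x)) powr a) x = (2 * a * (1 + 1 * (x \<bullet> x)) powr (a - 1)) * x $ i"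
    by simp
qed

lemma powr_inner_bracket:
  "(1 + 1 * (x \<bullet> x)) powr (1/2) = bracket x"
  "(1 + 1 * (x \<bullet> x)) powr (- (1/2)) = 1 / bracket x"
  "(1 + 1 * (x \<bullet> x)) powr (- (3/2)) = 1 / bracket x ^ 3" for x :: "real^'n"
proof -
  have pos: "1 + x \<bullet> x > 0" using inner_ge_zero[of x] by (simp add: add_pos_nonneg)
  show h: "(1 + 1 * (x \<bullet> x)) powr (1/2) = bracket x" using pos by (simp add: bracket_def powr_half_sqrt)
  then show "(1 + 1 * (x \<bullet> x)) powr (- (1/2)) = 1 / bracket x" by (simp add: powr_minus_divide)
  have "(1 + 1 * (x \<bullet> x)) powr (3/2) = ((1 + 1 * (x \<bullet> x)) powr (1/2)) ^ 3"
    using pos by (simp add: powr_power)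
  then have "(1 + 1 * (x \<bullet> x)) powr (3/2) = bracket x ^ 3" unfolding h .
  then show "(1 + 1 * (x \<bullet> x)) powr (- (3/2)) = 1 / bracket x ^ 3" by (simp add: powr_minus_divide)
qed

lemma bracket_eq_powr: "bracket = (\<lambda>x::real^'n. (1 + 1 * (x \<bullet> x)) powr (1/2))"
  by (rule ext) (rule powr_inner_bracket(1)[symmetric])

lemma smooth_bracket: "smooth bracket" unfolding bracket_eq_powr by (rule smooth_powr_inner)

lemma partial_bracket: "partial j (bracket :: real^'n \<Rightarrow> real) = (\<lambda>x. (1 / bracket x) * x $ j)"
proof -
  have "partial j (bracket :: real^'n \<Rightarrow> real) = (\<lambda>x. (2 * (1/2) * (1 + 1 * (x \<bullet> x)) powr (1/2 - 1)) * x $ j)"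
    unfolding bracket_eq_powr by (rule partial_powr_inner)
  also have "1/2 - 1 = - (1/2::real)" by simp
  finally show ?thesis unfolding powr_inner_bracket by simp
qed

lemma partial_partial_bracket:
  fixes x :: "real^'n"
  shows "partial i (partial j bracket) x = (if i = j then 1 / bracket x else 0) - (x $ i * x $ j) / bracket x ^ 3"
proof -
  have eq: "(\<lambda>x::real^'n. 1 / bracket x) = (\<lambda>x. (1 + 1 * (x \<bullet> x)) powr (- (1/2)))"
    by (rule ext) (rule powr_inner_bracket(2)[symmetric])
  have sm: "smooth (\<lambda>x::real^'n. 1 / bracket x)" unfolding eq by (rule smooth_powr_inner)
  have "partial i (\<lambda>x::real^'n. 1 / bracket x) = (\<lambda>x. (2 * - (1/2) * (1 + 1 * (x \<bullet> x)) powr (- (1/2) - 1)) * x $ i)"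
    unfolding eq by (rule partial_powr_inner)
  also have "- (1/2) - 1 = - (3/2::real)" by simp
  finally have d: "partial i (\<lambda>x::real^'n. 1 / bracket x) x = - (1 / bracket x ^ 3) * x $ i" unfolding powr_inner_bracket by simp
  show ?thesis unfolding partial_bracket
    by (subst partial_mult[OF smooth_differentiable[OF sm] smooth_differentiable[OF smooth_component]])
      (simp add: d)
qed

text \<open>For \<open>R \<le> 1\<close> the first term of the weight is at least \<open>w 1\<close>, and for \<open>R > 1\<close> the second one is at
  least \<open>w 1 / R\<close>.\<close>

lemma radial_weight_ge:
  fixes w :: "real \<Rightarrow> real"
  assumes w: "L1_loc_on {0..} w" "\<And>s. s \<ge> 0 \<Longrightarrow> w s > 0" "antimono_on {0..} w" and that: "R \<ge> 0"
  shows "w 1 / (1 + R) \<le> radial_weight w R"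
proof -
  have nn: "0 \<le> (LINT s:{0..r}|lebesgue. w s)" for r
    unfolding set_lebesgue_integral_def
    by (intro integral_nonneg_AE AE_I2) (use w(2) in \<open>auto simp: indicator_def less_imp_le\<close>)
  have third: "0 \<le> 1 / R\<^sup>2 * (LINT r:{0..R}|lebesgue. LINT s:{0..r}|lebesgue. w s)"
    unfolding set_lebesgue_integral_def[of _ _ "\<lambda>r. LINT s:{0..r}|lebesgue. w s"]
    by (intro mult_nonneg_nonneg integral_nonneg_AE AE_I2) (use nn in auto)
  show ?thesis
  proof (cases "R \<le> 1")
    case True
    have "w 1 \<le> w R" using w(3) that True unfolding monotone_on_def by auto
    moreover have "w 1 / (1 + R) \<le> w 1" using w(2)[of 1] that by (simp add: field_simps)
    moreover have "0 \<le> 1 / R * (LINT s:{0..R}|lebesgue. w s)" using nn that by simp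
    ultimately show ?thesis using third unfolding radial_weight_def by linarith
  next
    case False
    have I: "set_integrable lebesgue {0..R} w" using w(1) unfolding L1_loc_on_def by auto
    have "w 1 = (LINT s:{0..1::real}|lebesgue. w 1)"
      by (simp add: set_lebesgue_integral_def)
    also have "\<dots> \<le> (LINT s:{0..R}|lebesgue. w s)"
      unfolding set_lebesgue_integral_def
    proof (rule integral_mono)
      show "integrable lebesgue (\<lambda>s. indicat_real {0..1::real} s *\<^sub>R w 1)"
        by (intro integrable_scaleR_left impI integrable_real_indicator) auto
      show "integrable lebesgue (\<lambda>s. indicat_real {0..R} s *\<^sub>R w s)" using I unfolding set_integrable_def .
      fix s :: real
      show "indicat_real {0..1} s *\<^sub>R w 1 \<le> indicat_real {0..R} s *\<^sub>R w s"
        using w(3) w(2)[of s] False unfolding monotone_on_def by (auto simp: indicator_def less_imp_le)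
    qed
    finally have "w 1 / R \<le> 1 / R * (LINT s:{0..R}|lebesgue. w s)" using False by (simp add: field_simps)
    moreover have "w 1 / (1 + R) \<le> w 1 / R" using w(2)[of 1] False by (intro divide_left_mono) auto
    moreover have "w R > 0" using w(2) that by blast
    ultimately show ?thesis using third unfolding radial_weight_def by linarith
  qed
qed

text \<open>With \<open>q = \<surd>(1 + |x|\<^sup>2)\<close> the Hessian of \<open>q\<close> is \<open>I/q - x \<otimes> x/q\<^sup>3\<close>.  It is positive, which takes care
  of \<open>\<rho> v \<otimes> v\<close>, and its trace is at least \<open>2/q + 1/q\<^sup>3\<close> because \<open>N \<ge> 3\<close>, just enough to absorb
  \<open>- u \<otimes> u\<close>.\<close>

lemma stress_hessian_bracket_ge:
  fixes \<Phi> :: "real^'n \<Rightarrow> real"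
  assumes N: "CARD('n) \<ge> 3" and k: "k \<ge> 0" and \<rho>: "\<rho> x \<ge> 0" and p: "p (\<rho> x) \<ge> 0"
  shows "p (\<rho> x) / bracket x + k * (norm (weak_grad \<Phi> x))\<^sup>2 / (2 * bracket x ^ 3)
     \<le> stress k p \<rho> v \<Phi> x (\<lambda>i j. partial i (partial j bracket) x)"
proof -
  define q where "q = bracket x"
  have q: "q \<ge> 1" "q\<^sup>2 = 1 + (norm x)\<^sup>2" using bracket_ge_1[of x] bracket_sq[of x] by (simp_all add: q_def)
  have form: "(\<Sum>i\<in>UNIV. \<Sum>j\<in>UNIV. a $ i * a $ j * partial i (partial j bracket) x) = (norm a)\<^sup>2 / q - (a \<bullet> x)\<^sup>2 / q ^ 3" for a
  proof -
    have "(\<Sum>i\<in>UNIV. \<Sum>j\<in>UNIV. a $ i * a $ j * partial i (partial j bracket) x)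
      = (\<Sum>i\<in>UNIV. \<Sum>j\<in>UNIV. a $ i * a $ j * (if i = j then 1 / q else 0)) - (\<Sum>i\<in>UNIV. \<Sum>j\<in>UNIV. a $ i * a $ j * (x $ i * x $ j)) / q ^ 3"
      unfolding partial_partial_bracket q_def[symmetric] by (simp add: sum_subtractf right_diff_distrib sum_divide_distrib)
    then show ?thesis unfolding quadratic_form_diag quadratic_form_rank_one by simp
  qed
  have tr: "(\<Sum>i\<in>UNIV. partial i (partial i bracket) x) = real CARD('n) / q - (norm x)\<^sup>2 / q ^ 3"
    by (simp add: partial_partial_bracket q_def sum_subtractf sum_divide_distrib[symmetric] power2_norm_eq_inner inner_vec_def)
  have form_ge: "(a \<bullet> x)\<^sup>2 / q ^ 3 \<le> (norm a)\<^sup>2 / q" for a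
  proof -
    have "(a \<bullet> x)\<^sup>2 \<le> (norm a)\<^sup>2 * (norm x)\<^sup>2" using Cauchy_Schwarz_ineq[of a x] by (simp add: power2_norm_eq_inner)
    also have "\<dots> \<le> (norm a)\<^sup>2 * q\<^sup>2" using q by (intro mult_left_mono) auto
    finally have "(a \<bullet> x)\<^sup>2 / q ^ 3 \<le> (norm a)\<^sup>2 * q\<^sup>2 / q ^ 3" using q(1) by (intro divide_right_mono) auto
    also have "\<dots> = (norm a)\<^sup>2 / q" using q(1) by (simp add: power3_eq_cube power2_eq_square)
    finally show ?thesis .
  qed
  have x2: "(norm x)\<^sup>2 / q ^ 3 = 1 / q - 1 / q ^ 3"
  proof -
    have "(norm x)\<^sup>2 = q\<^sup>2 - 1" using q(2) by simp
    then show ?thesis using q(1) by (simp add: diff_divide_distrib power3_eq_cube power2_eq_square)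
  qed
  have 1: "0 \<le> \<rho> x * ((norm (v x))\<^sup>2 / q - (v x \<bullet> x)\<^sup>2 / q ^ 3)" using form_ge[of "v x"] \<rho> by simp
  have N3: "3 / q \<le> real CARD('n) / q" using N q by (intro divide_right_mono) auto
  have tr_ge: "2 / q + 1 / q ^ 3 \<le> real CARD('n) / q - (norm x)\<^sup>2 / q ^ 3" using N3 x2 by (simp add: field_simps)
  have "1 / q \<le> 2 / q + 1 / q ^ 3" using q by (simp add: add_increasing2 divide_right_mono)
  then have 2: "p (\<rho> x) * (1 / q) \<le> p (\<rho> x) * (real CARD('n) / q - (norm x)\<^sup>2 / q ^ 3)"
    using p tr_ge by (intro mult_left_mono) auto
  let ?u = "(norm (weak_grad \<Phi> x))\<^sup>2"
  have "?u / 2 * (2 / q + 1 / q ^ 3) \<le> ?u / 2 * (real CARD('n) / q - (norm x)\<^sup>2 / q ^ 3)"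
    using tr_ge by (intro mult_left_mono) auto
  moreover have "?u / 2 * (2 / q + 1 / q ^ 3) = ?u / q + ?u / (2 * q ^ 3)" by (simp add: field_simps)
  moreover have "0 \<le> (weak_grad \<Phi> x \<bullet> x)\<^sup>2 / q ^ 3" using q by simp
  ultimately have "?u / (2 * q ^ 3) \<le> ?u / 2 * (real CARD('n) / q - (norm x)\<^sup>2 / q ^ 3) - (?u / q - (weak_grad \<Phi> x \<bullet> x)\<^sup>2 / q ^ 3)"
    by linarith
  from mult_left_mono[OF this k]
  have 3: "k * ?u / (2 * q ^ 3) \<le> k * (?u / 2 * (real CARD('n) / q - (norm x)\<^sup>2 / q ^ 3) - (?u / q - (weak_grad \<Phi> x \<bullet> x)\<^sup>2 / q ^ 3))"
    by simp
  have "stress k p \<rho> v \<Phi> x (\<lambda>i j. partial i (partial j bracket) x) =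
    \<rho> x * ((norm (v x))\<^sup>2 / q - (v x \<bullet> x)\<^sup>2 / q ^ 3) + p (\<rho> x) * (real CARD('n) / q - (norm x)\<^sup>2 / q ^ 3)
    + k * (?u / 2 * (real CARD('n) / q - (norm x)\<^sup>2 / q ^ 3) - (?u / q - (weak_grad \<Phi> x \<bullet> x)\<^sup>2 / q ^ 3))"
    using form[of "v x"] form[of "weak_grad \<Phi> x"] unfolding stress_def tr by (simp add: weak_grad_def)
  with 1 2 3 show ?thesis unfolding q_def[symmetric] by simp
qed

text \<open>The test functions are \<open>q(x) b(x/n)\<close> with \<open>q = \<surd>(1 + |x|\<^sup>2)\<close>; on the support of \<open>b(x/n)\<close> one has
  \<open>1/n \<le> 2/q(x)\<close>, which bounds every term of the Hessian by a multiple of \<open>1/q\<close>.\<close>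

lemma weighted_energy_vanishing:
  fixes \<Phi> :: "real^'n \<Rightarrow> real"
  assumes N: "CARD('n) \<ge> 3" and k: "k \<ge> 0" and sol: "stationary_weak_solution k \<mu> lam p \<rho> v \<Phi>"
    and visc: "2 * \<mu> + lam = 0"
    and fin: "integrable lebesgue (\<lambda>x. energy k p \<rho> v \<Phi> x / bracket x)"
  shows "(AE x in lebesgue. \<rho> x = 0) \<and> (k \<noteq> 0 \<longrightarrow> (AE x in lebesgue. weak_grad \<Phi> x = 0))"
proof -
  define b where "b = (bump :: real^'n \<Rightarrow> real)"
  have b: "test_fun b" unfolding b_def by (rule test_fun_bump)
  have bn: "test_fun (dilate b n)" for n by (rule test_fun_dilate[OF b])
  define \<psi> where "\<psi> n x = bracket x * dilate b n x" for n x
  have \<psi>: "test_fun (\<psi> n)" for n unfolding \<psi>_def by (intro test_fun_mult_smooth smooth_bracket bn)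
  note sd = smooth_differentiable[OF smooth_bracket] smooth_differentiable[OF smooth_partial[OF smooth_bracket]]
    test_fun_differentiable[OF bn] test_fun_differentiable[OF test_fun_partial[OF bn]]
  have d1: "partial j (\<psi> n) = (\<lambda>x. bracket x * partial j (dilate b n) x + partial j bracket x * dilate b n x)" for j n
    unfolding \<psi>_def by (rule ext) (simp add: partial_mult sd)
  have d2: "partial i (partial j (\<psi> n)) x =
      bracket x * ((1 / real (Suc n))\<^sup>2 * dilate (partial i (partial j b)) n x) + partial i bracket x * (1 / real (Suc n) * dilate (partial j b) n x)
      + (partial j bracket x * (1 / real (Suc n) * dilate (partial i b) n x) + partial i (partial j bracket) x * dilate b n x)" for i j n x
  proof -
    have m: "(\<lambda>x. bracket x * partial j (dilate b n) x) differentiable (at x)" "(\<lambda>x. partial j bracket x * dilate b n x) differentiable (at x)"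
      by (intro test_fun_differentiable test_fun_mult_smooth smooth_bracket smooth_partial test_fun_partial bn)+
    show ?thesis unfolding d1 partial_add[OF m] partial_mult[OF sd(1,4)] partial_mult[OF sd(2,3)]
      by (simp only: partial_dilate[OF b] partial_partial_dilate[OF b])
        (simp only: partial_dilate[OF b, symmetric] partial_partial_dilate[OF b])
  qed
  obtain M0 where M0: "M0 > 0" "\<And>x. \<bar>b x\<bar> \<le> M0" using test_fun_bounded[OF b] by (metis real_norm_def)
  obtain M1 where M1: "M1 > 0" "\<And>i x. \<bar>partial i b x\<bar> \<le> M1"
    using test_fun_family_bounded[of "\<lambda>i. partial i b"] test_fun_partial[OF b] by blast
  obtain M2 where M2: "M2 > 0" "\<And>ij x. \<bar>partial (fst ij) (partial (snd ij) b) x\<bar> \<le> M2"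
    using test_fun_family_bounded[of "\<lambda>ij::'n\<times>'n. partial (fst ij) (partial (snd ij) b)"] test_fun_partial[OF test_fun_partial[OF b]] by blast
  define C where "C = 4 * M2 + 2 * M1 + 2 * M1 + 2 * M0"
  have dj1: "\<bar>partial j bracket x\<bar> \<le> 1" for j and x :: "real^'n"
    using component_le_norm_cart[of x j] norm_le_bracket[of x] bracket_ge_1[of x] by (simp add: partial_bracket abs_mult divide_le_eq)
  have dj2: "\<bar>partial i (partial j bracket) x\<bar> \<le> 2 / bracket x" for i j and x :: "real^'n"
  proof -
    have q: "bracket x > 0" using bracket_ge_1[of x] by linarith
    have "\<bar>x $ i\<bar> * \<bar>x $ j\<bar> \<le> bracket x * bracket x"
      using component_le_norm_cart[of x] norm_le_bracket[of x] q by (intro mult_mono) (auto intro: order_trans)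
    then have "\<bar>(x $ i * x $ j) / bracket x ^ 3\<bar> \<le> (bracket x * bracket x) / bracket x ^ 3"
      using q by (simp add: abs_mult divide_right_mono)
    also have "\<dots> = 1 / bracket x" using q by (simp add: power3_eq_cube)
    finally have "\<bar>(x $ i * x $ j) / bracket x ^ 3\<bar> \<le> 1 / bracket x" .
    moreover have "\<bar>if i = j then 1 / bracket x else 0\<bar> \<le> 1 / bracket x" using q by simp
    moreover have "2 / bracket x = 1 / bracket x + 1 / bracket x" by simp
    ultimately show ?thesis unfolding partial_partial_bracket
      using abs_triangle_ineq4[of "if i = j then 1 / bracket x else 0" "(x $ i * x $ j) / bracket x ^ 3"] by linarith
  qed
  have bound: "\<bar>partial i (partial j (\<psi> n)) x\<bar> \<le> C / bracket x" for n i j x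
  proof (cases "1 < norm ((1 / real (Suc n)) *\<^sub>R x + 0)")
    case True
    have b1: "b z = 0" if "1 < norm z" for z using bump_eq_0[OF that] by (simp add: b_def)
    have b2: "partial i b z = 0" if "1 < norm z" for z i by (rule partial_outside[OF b1 that])
    have b3: "partial i (partial j b) z = 0" if "1 < norm z" for z i j by (rule partial_outside[OF b2 that])
    have "partial i (partial j (\<psi> n)) x = 0" unfolding d2 dilate_def using b1[OF True] b2[OF True] b3[OF True] by simp
    moreover have "C / bracket x \<ge> 0" using bracket_ge_1[of x] M0 M1 M2 by (simp add: C_def)
    ultimately show ?thesis by simp
  next
    case False
    define c where "c = 1 / real (Suc n)"
    have c: "0 < c" "c \<le> 1" by (simp_all add: c_def)
    have q: "bracket x \<ge> 1" "bracket x > 0" using bracket_ge_1[of x] by auto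
    have "c * norm x \<le> 1" using False c by (simp add: c_def)
    then have "c * (1 + norm x) \<le> 2" using c by (simp add: distrib_left)
    moreover have "c * bracket x \<le> c * (1 + norm x)" using c bracket_le by (intro mult_left_mono) auto
    ultimately have cq: "c \<le> 2 / bracket x" using q by (simp add: field_simps)
    have t1: "\<bar>bracket x * (c\<^sup>2 * dilate (partial i (partial j b)) n x)\<bar> \<le> bracket x * ((2 / bracket x)\<^sup>2 * M2)"
      unfolding abs_mult dilate_def using q c cq M2(2)[of "(i, j)"]
      by (intro mult_mono) (auto intro: power_mono)
    have t2: "\<bar>partial i bracket x * (c * dilate (partial j b) n x)\<bar> \<le> 1 * (2 / bracket x * M1)" for i j
      unfolding abs_mult dilate_def using q c cq M1 dj1 by (intro mult_mono) auto
    have t3: "\<bar>partial i (partial j bracket) x * dilate b n x\<bar> \<le> 2 / bracket x * M0"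
      unfolding abs_mult dilate_def using q M0 dj2 by (intro mult_mono) auto
    have "bracket x * ((2 / bracket x)\<^sup>2 * M2) = 4 * M2 / bracket x" using q by (simp add: power2_eq_square)
    moreover have "4 * M2 / bracket x + 2 / bracket x * M1 + (2 / bracket x * M1 + 2 / bracket x * M0) = C / bracket x" by (simp add: C_def add_divide_distrib)
    ultimately show ?thesis using t1 t2[of i j] t2[of j i] t3 unfolding d2 c_def[symmetric] by linarith
  qed
  have lim: "(\<lambda>n. partial i (partial j (\<psi> n)) x) \<longlonglongrightarrow> exp (- 1) * partial i (partial j bracket) x" for i j x
  proof -
    have "(\<lambda>n. partial i (partial j (\<psi> n)) x) \<longlonglongrightarrow>
      bracket x * (0\<^sup>2 * partial i (partial j b) 0) + partial i bracket x * (0 * partial j b 0) + (partial j bracket x * (0 * partial i b 0) + partial i (partial j bracket) x * b 0)"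
      unfolding d2 by (intro tendsto_intros inverse_Suc_tendsto dilate_tendsto test_fun_partial b)
    then show ?thesis by (simp add: b_def bump_0 mult.commute)
  qed
  have m: "integrable lebesgue (\<lambda>x. C / bracket x * energy k p \<rho> v \<Phi> x)"
    using integrable_mult_right[OF fin, of C] by simp
  have visc': "(\<lambda>n. (2 * \<mu> + lam) * (LINT x|lebesgue. v x \<bullet> grad (laplacian (\<psi> n)) x)) \<longlonglongrightarrow> 0" using visc by simp
  define S where "S x = stress k p \<rho> v \<Phi> x (\<lambda>i j. partial i (partial j bracket) x)" for x
  have hom: "stress k p \<rho> v \<Phi> x (\<lambda>i j. exp (- 1) * partial i (partial j bracket) x) = exp (- 1) * S x" for x
    by (simp add: stress_def S_def sum_distrib_left algebra_simps)
  have SI: "integrable lebesgue S" and S0: "(LINT x|lebesgue. S x) = 0"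
    using stress_limit[OF sol k \<psi> m bound lim visc'] unfolding hom by simp_all
  have pos: "AE x in lebesgue. 0 \<le> p (\<rho> x) / bracket x \<and> 0 \<le> k * (norm (weak_grad \<Phi> x))\<^sup>2 / (2 * bracket x ^ 3) \<and>
      p (\<rho> x) / bracket x + k * (norm (weak_grad \<Phi> x))\<^sup>2 / (2 * bracket x ^ 3) \<le> S x"
    using sol_nonneg[OF sol]
  proof eventually_elim
    case (elim x)
    have "bracket x > 0" using bracket_ge_1[of x] by linarith
    then show ?case using stress_hessian_bracket_ge[OF N k, of \<rho> x p \<Phi> v] elim k by (simp add: S_def)
  qed
  then have "AE x in lebesgue. 0 \<le> S x" by eventually_elim linarith
  then have "AE x in lebesgue. S x = 0" using integral_nonneg_eq_0_iff_AE[OF SI] S0 by blast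
  with pos sol_nonneg[OF sol] have "AE x in lebesgue. \<rho> x = 0 \<and> k * (norm (weak_grad \<Phi> x))\<^sup>2 = 0"
  proof eventually_elim
    case (elim x)
    have q: "bracket x > 0" using bracket_ge_1[of x] by linarith
    have "p (\<rho> x) / bracket x = 0" "k * (norm (weak_grad \<Phi> x))\<^sup>2 / (2 * bracket x ^ 3) = 0" using elim by linarith+
    then show ?case using q elim by auto
  qed
  then show ?thesis by auto
qed

theorem theorem1p1:
  fixes k \<mu> lam :: real
    and p :: "real \<Rightarrow> real"
    and \<rho> :: "real^'n \<Rightarrow> real"
    and v :: "real^'n \<Rightarrow> real^'n"
    and \<Phi> :: "real^'n \<Rightarrow> real"
  assumes N: "CARD('n) \<ge> 2"
    and k: "k \<ge> 0"
    and sol: "stationary_weak_solution k \<mu> lam p \<rho> v \<Phi>"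
    and cases:
      "(\<mu> = 0 \<and> lam = 0 \<and>
          (CARD('n) \<ge> 3 \<longrightarrow>
             (\<exists>w::real \<Rightarrow> real. L1_loc_on {0..} w \<and> (\<forall>s\<ge>0. w s > 0) \<and> antimono_on {0..} w \<and>
                integrable lebesgue (\<lambda>x. energy k p \<rho> v \<Phi> x * radial_weight w (norm x)))) \<and>
          (CARD('n) = 2 \<longrightarrow> integrable lebesgue (energy k p \<rho> v \<Phi>)))
       \<or> (\<mu> > 0 \<and>
          (2 * \<mu> + lam = 0 \<longrightarrow> integrable lebesgue (energy k p \<rho> v \<Phi>)) \<and>
          (2 * \<mu> + lam \<noteq> 0 \<longrightarrow>
             integrable lebesgue (\<lambda>x. energy k p \<rho> v \<Phi> x
               + norm (v x) powr (real CARD('n) / (real CARD('n) - 1)))))"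
  shows "(AE x in lebesgue. \<rho> x = 0) \<and>
         (k \<noteq> 0 \<longrightarrow> (AE x in lebesgue. weak_grad \<Phi> x = 0))"
proof -
  consider (weighted) w where "CARD('n) \<ge> 3" "\<mu> = 0" "lam = 0" "L1_loc_on {0..} w" "\<forall>s\<ge>0. w s > 0" "antimono_on {0..} w"
      "integrable lebesgue (\<lambda>x. energy k p \<rho> v \<Phi> x * radial_weight w (norm x))"
    | (finite) "2 * \<mu> + lam = 0" "integrable lebesgue (energy k p \<rho> v \<Phi>)"
    | (viscous) "integrable lebesgue (\<lambda>x. energy k p \<rho> v \<Phi> x + norm (v x) powr (real CARD('n) / (real CARD('n) - 1)))"
  proof -
    have "CARD('n) = 2 \<or> CARD('n) \<ge> 3" using N by linarith
    moreover have "2 * \<mu> + lam = 0" if "\<mu> = 0" "lam = 0" using that by simp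
    ultimately show thesis using cases that by blast
  qed
  then show ?thesis
  proof cases
    case weighted
    have em: "energy k p \<rho> v \<Phi> \<in> borel_measurable lebesgue" by (rule energy_measurable[OF sol])
    have w1: "w 1 > 0" using weighted by simp
    have "(bracket :: real^'n \<Rightarrow> real) \<in> borel_measurable borel"
      by (rule borel_measurable_continuous_onI[OF smooth_continuous[OF smooth_bracket]])
    then have jm: "(bracket :: real^'n \<Rightarrow> real) \<in> borel_measurable lebesgue"
      by (intro measurable_completion) simp
    have I: "integrable lebesgue (\<lambda>x. (2 / w 1) * (energy k p \<rho> v \<Phi> x * radial_weight w (norm x)))"
      using weighted by simp
    have "integrable lebesgue (\<lambda>x. energy k p \<rho> v \<Phi> x / bracket x)"
    proof (rule Bochner_Integration.integrable_bound[OF I])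
      show "(\<lambda>x. energy k p \<rho> v \<Phi> x / bracket x) \<in> borel_measurable lebesgue" by (intro borel_measurable_divide em jm)
      show "AE x in lebesgue. norm (energy k p \<rho> v \<Phi> x / bracket x) \<le> norm ((2 / w 1) * (energy k p \<rho> v \<Phi> x * radial_weight w (norm x)))"
        using energy_nonneg[OF sol k]
      proof eventually_elim
        case (elim x)
        have q: "bracket x \<ge> 1" by (rule bracket_ge_1)
        have "1 + norm x \<le> 2 * bracket x" using q norm_le_bracket[of x] by linarith
        then have "2 / (2 * bracket x) \<le> 2 / (1 + norm x)"
          using q norm_ge_zero[of x] by (intro divide_left_mono) (auto intro!: mult_pos_pos add_pos_nonneg)
        then have "1 / bracket x \<le> 2 / (1 + norm x)" by simp
        also have "\<dots> = (2 / w 1) * (w 1 / (1 + norm x))" using w1 by simp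
        also have "\<dots> \<le> (2 / w 1) * radial_weight w (norm x)"
          using w1 weighted by (intro mult_left_mono radial_weight_ge) (auto intro: less_imp_le)
        finally have "energy k p \<rho> v \<Phi> x * (1 / bracket x) \<le> energy k p \<rho> v \<Phi> x * ((2 / w 1) * radial_weight w (norm x))"
          using elim by (intro mult_left_mono) auto
        then have le: "energy k p \<rho> v \<Phi> x / bracket x \<le> (2 / w 1) * (energy k p \<rho> v \<Phi> x * radial_weight w (norm x))"
          by (simp add: mult_ac)
        have ge: "0 \<le> energy k p \<rho> v \<Phi> x / bracket x" using elim q by simp
        show ?case unfolding real_norm_def abs_of_nonneg[OF ge] by (rule order_trans[OF le abs_ge_self])
      qed
    qed
    then show ?thesis using weighted by (intro weighted_energy_vanishing[OF _ k sol]) auto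
  next
    case finite
    then show ?thesis by (intro finite_energy_vanishing[OF N k sol]) auto
  next
    case viscous
    have em: "energy k p \<rho> v \<Phi> \<in> borel_measurable lebesgue" by (rule energy_measurable[OF sol])
    have e: "integrable lebesgue (energy k p \<rho> v \<Phi>)"
    proof (rule Bochner_Integration.integrable_bound[OF viscous em])
      show "AE x in lebesgue. norm (energy k p \<rho> v \<Phi> x) \<le> norm (energy k p \<rho> v \<Phi> x + norm (v x) powr (real CARD('n) / (real CARD('n) - 1)))"
        using energy_nonneg[OF sol k] by eventually_elim simp
    qed
    from Bochner_Integration.integrable_diff[OF viscous this]
    have "integrable lebesgue (\<lambda>x. norm (v x) powr (real CARD('n) / (real CARD('n) - 1)))" by simp
    with e show ?thesis by (intro finite_energy_vanishing[OF N k sol]) auto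
  qed
qed

end
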